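(* Let $(M,L)$ be a Finsler manifold with Finsler metric $g$ and let $\nabla$ be its Cartan connection, with (h)hv-torsion $T$, v-curvature $S$, hv-curvature $P$ and (v)hv-torsion $\widehat P$. Then for all $\pi$-vector fields $X,Y,Z,W$: (a) $P(X,Y,Z,W)=-P(X,Y,W,Z)$; (b) $P(X,Y)Z-P(Z,Y)X=(\nabla_{\beta Z}T)(Y,X)-(\nabla_{\beta X}T)(Y,Z)-T(\widehat P(Z,Y),X)+T(\widehat P(X,Y),Z)$; (c) $P(X,Y,Z,W)=g((\nabla_{\beta Z}T)(X,Y),W)-g((\nabla_{\beta W}T)(X,Y),Z)+g(T(X,Z),\widehat P(W,Y))-g(T(X,W),\widehat P(Z,Y))$; (d) $\widehat P(\eta,X)=0$; (e) $\widehat P(X,Y)=(\nabla_{\beta\eta}T)(X,Y)$; (f) $\widehat P$ is symmetric: $\widehat P(X,Y)=\widehat P(Y,X)$; (g) $P(\eta,X)Y=P(X,\eta)Y=0$; (h) $(\nabla_{\gamma\eta}P)(X,Y,Z)=-P(X,Y)Z$; (i) $P(X,Y)Z=P(Y,X)Z-(\nabla_{\beta\eta}S)(X,Y,Z)$.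
   Context: $M$ is a real paracompact $C^\infty$ manifold of finite dimension, $\mathcal TM\subset TM$ is the set of nonzero tangent vectors, $\pi:\mathcal TM\to M$ the projection, $\pi^{-1}(TM)\to\mathcal TM$ the pullback of $TM$ by $\pi$; everything is $C^\infty$. Sections of $\pi^{-1}(TM)$ are called $\pi$-vector fields. $\eta$ is the $\pi$-vector field $\eta(u)=(u,u)$. $\rho:T(\mathcal TM)\to\pi^{-1}(TM)$ is $\rho(A)=(u,d\pi(A))$ for $A\in T_u(\mathcal TM)$, and $\gamma:\pi^{-1}(TM)\to T(\mathcal TM)$ is the vertical lift $\gamma(u,v)=\frac{d}{dt}|_{t=0}(u+tv)$; $V=\ker\rho=\operatorname{im}\gamma$. $(M,L)$ is a Finsler manifold: $L:TM\to[0,\infty)$ is smooth and positive on $\mathcal TM$, positively homogeneous of degree 1 on fibres, and the fibrewise Hessian of $E=\frac12L^2$ is positive definite on $\mathcal TM$; this Hessian (in coordinates $g_{ij}=\frac12\partial^2L^2/\partial y^i\partial y^j$) is the Finsler metric $g$ on $\pi^{-1}(TM)$. For a linear connection $D$ on $\pi^{-1}(TM)$, put $K(A)=D_A\eta$ and $H=\ker K$. $D$ is regular if $T(\mathcal TM)=V\oplus H$; then $\beta:=(\rho|_H)^{-1}:\pi^{-1}(TM)\to H$. Torsion: $\mathbf T(A,B)=D_A\rho B-D_B\rho A-\rho[A,B]$; curvature (note the sign): $\mathbf K(A,B)\rho C=-D_AD_B\rho C+D_BD_A\rho C+D_{[A,B]}\rho C$. $Q(X,Y)=\mathbf T(\beta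 X,\beta Y)$, $T(X,Y)=\mathbf T(\gamma X,\beta Y)$; h-, hv-, v-curvatures $R(X,Y)Z=\mathbf K(\beta X,\beta Y)Z$, $P(X,Y)Z=\mathbf K(\beta X,\gamma Y)Z$, $S(X,Y)Z=\mathbf K(\gamma X,\gamma Y)Z$; $\widehat P(X,Y)=P(X,Y)\eta$. The Cartan connection $\nabla$ is the unique regular connection on $\pi^{-1}(TM)$ with $\nabla g=0$, $Q=0$, and $g(T(X,Y),Z)=g(T(X,Z),Y)$. Notation: $P(X,Y,Z,W):=g(P(X,Y)Z,W)$. $(\nabla_AT)(X,Y)=\nabla_A(T(X,Y))-T(\nabla_AX,Y)-T(X,\nabla_AY)$; for $B\in\{P,S\}$, $(\nabla_AB)(X,Y,Z)=\nabla_A(B(X,Y)Z)-B(\nabla_AX,Y)Z-B(X,\nabla_AY)Z-B(X,Y)\nabla_AZ$ (vector-valued). *)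

theory Defs
  imports "HOL-Analysis.Analysis" "HOL-Library.Function_Algebras"
begin

text \<open>Functions into a real vector space form a real vector space, pointwise.  Tangent vectors
  and sections of bundles are functions below, so that \<open>+\<close>, \<open>-\<close>, \<open>0\<close> and \<open>*\<^sub>R\<close> on them
  are the usual fibrewise operations.\<close>

instantiation "fun" :: (type, real_vector) real_vector
begin

definition scaleR_fun_def: "r *\<^sub>R f = (\<lambda>x. r *\<^sub>R f x)"

instance
  by standard (auto simp: scaleR_fun_def plus_fun_def scaleR_add_right scaleR_add_left)

end


section \<open>Smooth maps between Euclidean spaces\<close>

text \<open>Only used on open sets \<open>S\<close>.\<close>

primrec Ck_on :: "nat \<Rightarrow> 'a::euclidean_space set \<Rightarrow> ('a \<Rightarrow> 'b::real_normed_vector) \<Rightarrow> bool" where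
  "Ck_on 0 S f \<longleftrightarrow> continuous_on S f"
| "Ck_on (Suc k) S f \<longleftrightarrow>
     (\<forall>x\<in>S. f differentiable (at x)) \<and> (\<forall>v. Ck_on k S (\<lambda>x. frechet_derivative f (at x) v))"

definition smooth_on :: "'a::euclidean_space set \<Rightarrow> ('a \<Rightarrow> 'b::real_normed_vector) \<Rightarrow> bool" where
  "smooth_on S f \<longleftrightarrow> (\<forall>k. Ck_on k S f)"


section \<open>Manifolds\<close>

text \<open>A chart \<open>(U, \<phi>)\<close> consists of its domain and of a total function whose values outside
  \<open>U\<close> are irrelevant.\<close>

type_synonym ('m, 'e) chart = "'m set \<times> ('m \<Rightarrow> 'e)"

abbreviation dom_of :: "('m, 'e) chart \<Rightarrow> 'm set" where "dom_of c \<equiv> fst c"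
abbreviation map_of_chart :: "('m, 'e) chart \<Rightarrow> 'm \<Rightarrow> 'e" where "map_of_chart c \<equiv> snd c"

definition img :: "('m, 'e) chart \<Rightarrow> 'e set" where
  "img c = map_of_chart c ` dom_of c"

definition chart_inv :: "('m, 'e) chart \<Rightarrow> 'e \<Rightarrow> 'm" where
  "chart_inv c = inv_into (dom_of c) (map_of_chart c)"

definition paracompact_space :: "'m topology \<Rightarrow> bool" where
  "paracompact_space M \<longleftrightarrow>
     (\<forall>\<U>. (\<forall>U\<in>\<U>. openin M U) \<and> \<Union>\<U> = topspace M \<longrightarrow>
       (\<exists>\<V>. (\<forall>V\<in>\<V>. openin M V \<and> (\<exists>U\<in>\<U>. V \<subseteq> U)) \<and> \<Union>\<V> = topspace M \<and> locally_finite_in M \<V>))"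

definition smooth_manifold :: "'m topology \<Rightarrow> ('m, 'e::euclidean_space) chart set \<Rightarrow> bool" where
  "smooth_manifold M \<A> \<longleftrightarrow>
     Hausdorff_space M \<and> paracompact_space M \<and>
     (\<Union>c\<in>\<A>. dom_of c) = topspace M \<and>
     (\<forall>c\<in>\<A>. openin M (dom_of c) \<and> open (img c) \<and>
        homeomorphic_map (subtopology M (dom_of c)) (top_of_set (img c)) (map_of_chart c)) \<and>
     (\<forall>c\<in>\<A>. \<forall>d\<in>\<A>.
        smooth_on (map_of_chart c ` (dom_of c \<inter> dom_of d)) (map_of_chart d \<circ> chart_inv c))"

text \<open>The notions from here to \<open>lie_bracket\<close> depend on the atlas only.  They are used for \<open>M\<close>
  and, with the induced atlas, for the manifold of nonzero tangent vectors.

  A tangent vector at \<open>p\<close> is the family of its components in the charts around \<open>p\<close>, which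
  transform by the Jacobians of the transition maps.  It is \<open>0\<close> on all other arguments, so that
  equality of tangent vectors is equality of functions.\<close>

type_synonym ('m, 'e) tvec = "('m, 'e) chart \<Rightarrow> 'e"

definition charts_at :: "('m, 'e) chart set \<Rightarrow> 'm \<Rightarrow> ('m, 'e) chart set" where
  "charts_at \<A> p = {c \<in> \<A>. p \<in> dom_of c}"

definition tangent_space :: "('m, 'e::euclidean_space) chart set \<Rightarrow> 'm \<Rightarrow> ('m, 'e) tvec set" where
  "tangent_space \<A> p = {v.
     (\<forall>c. c \<notin> charts_at \<A> p \<longrightarrow> v c = 0) \<and>
     (\<forall>c\<in>charts_at \<A> p. \<forall>d\<in>charts_at \<A> p.
        v d = frechet_derivative (map_of_chart d \<circ> chart_inv c) (at (map_of_chart c p)) (v c))}"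

text \<open>The tangent vector at \<open>p\<close> with component \<open>\<xi>\<close> in the chart \<open>c\<close>.  For fixed
  \<open>\<xi>\<close> this is a coordinate vector field of \<open>c\<close>.\<close>

definition coord_vec ::
    "('m, 'e::euclidean_space) chart set \<Rightarrow> ('m, 'e) chart \<Rightarrow> 'e \<Rightarrow> 'm \<Rightarrow> ('m, 'e) tvec" where
  "coord_vec \<A> c \<xi> p = (\<lambda>d. if d \<in> charts_at \<A> p
     then frechet_derivative (map_of_chart d \<circ> chart_inv c) (at (map_of_chart c p)) \<xi> else 0)"

text \<open>Differentials are computed in an arbitrarily selected chart; by the transformation rule
  in \<open>tangent_space\<close>, the choice is immaterial.\<close>

definition some_chart :: "('m, 'e) chart set \<Rightarrow> 'm \<Rightarrow> ('m, 'e) chart" where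
  "some_chart \<A> p = (SOME c. c \<in> charts_at \<A> p)"

definition differential :: "('m, 'e::euclidean_space) chart set \<Rightarrow> ('n, 'f::euclidean_space) chart set \<Rightarrow>
    ('m \<Rightarrow> 'n) \<Rightarrow> 'm \<Rightarrow> ('m, 'e) tvec \<Rightarrow> ('n, 'f) tvec" where
  "differential \<A> \<B> F p a = (\<lambda>d. if d \<in> charts_at \<B> (F p)
     then let c = some_chart \<A> p in
       frechet_derivative (map_of_chart d \<circ> F \<circ> chart_inv c) (at (map_of_chart c p)) (a c)
     else 0)"

text \<open>The derivative of the real function \<open>f\<close> along the tangent vector \<open>a\<close> at \<open>p\<close>.\<close>

definition dir_deriv ::
    "('m, 'e::euclidean_space) chart set \<Rightarrow> 'm \<Rightarrow> ('m, 'e) tvec \<Rightarrow> ('m \<Rightarrow> real) \<Rightarrow> real" where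
  "dir_deriv \<A> p a f = (let c = some_chart \<A> p in
     frechet_derivative (f \<circ> chart_inv c) (at (map_of_chart c p)) (a c))"

definition velocity :: "('m, 'e::euclidean_space) chart set \<Rightarrow> (real \<Rightarrow> 'm) \<Rightarrow> ('m, 'e) tvec" where
  "velocity \<A> \<sigma> = (\<lambda>c. if c \<in> charts_at \<A> (\<sigma> 0)
     then vector_derivative (map_of_chart c \<circ> \<sigma>) (at 0) else 0)"

definition smooth_fun :: "('m, 'e::euclidean_space) chart set \<Rightarrow> ('m \<Rightarrow> real) \<Rightarrow> bool" where
  "smooth_fun \<A> f \<longleftrightarrow> (\<forall>c\<in>\<A>. smooth_on (img c) (f \<circ> chart_inv c))"

definition lie_bracket :: "('m, 'e::euclidean_space) chart set \<Rightarrow>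
    ('m \<Rightarrow> ('m, 'e) tvec) \<Rightarrow> ('m \<Rightarrow> ('m, 'e) tvec) \<Rightarrow> 'm \<Rightarrow> ('m, 'e) tvec" where
  "lie_bracket \<A> A B = (\<lambda>p c. if c \<in> charts_at \<A> p
     then frechet_derivative (\<lambda>x. B (chart_inv c x) c) (at (map_of_chart c p)) (A p c)
        - frechet_derivative (\<lambda>x. A (chart_inv c x) c) (at (map_of_chart c p)) (B p c)
     else 0)"


section \<open>The slit tangent bundle\<close>

type_synonym ('m, 'e) tpoint = "'m \<times> ('m, 'e) tvec"

definition tangent_bundle :: "('m, 'e::euclidean_space) chart set \<Rightarrow> ('m, 'e) tpoint set" where
  "tangent_bundle \<A> = {(p, v). p \<in> (\<Union>c\<in>\<A>. dom_of c) \<and> v \<in> tangent_space \<A> p}"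

definition slit :: "('m, 'e::euclidean_space) chart set \<Rightarrow> ('m, 'e) tpoint set" where
  "slit \<A> = {u \<in> tangent_bundle \<A>. snd u \<noteq> 0}"

text \<open>The chart \<open>(x, y)\<close> of the slit tangent bundle induced by a chart \<open>x\<close> of \<open>M\<close>.\<close>

definition lift_chart :: "('m, 'e::euclidean_space) chart set \<Rightarrow> ('m, 'e) chart \<Rightarrow>
    (('m, 'e) tpoint, 'e \<times> 'e) chart" where
  "lift_chart \<A> c = ({u \<in> slit \<A>. fst u \<in> dom_of c}, \<lambda>u. (map_of_chart c (fst u), snd u c))"

definition slit_atlas :: "('m, 'e::euclidean_space) chart set \<Rightarrow>
    (('m, 'e) tpoint, 'e \<times> 'e) chart set" where
  "slit_atlas \<A> = lift_chart \<A> ` \<A>"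

text \<open>Tangent vectors of the slit tangent bundle.\<close>

type_synonym ('m, 'e) tvec2 = "(('m, 'e) tpoint, 'e \<times> 'e) tvec"

abbreviation tspace2 :: "('m, 'e::euclidean_space) chart set \<Rightarrow> ('m, 'e) tpoint \<Rightarrow>
    ('m, 'e) tvec2 set" where
  "tspace2 \<A> u \<equiv> tangent_space (slit_atlas \<A>) u"

text \<open>The fibre over \<open>u\<close> of the pullback bundle is the tangent space of \<open>M\<close> at
  \<open>fst u\<close>; an element \<open>(u, v)\<close> of the pullback bundle is written as \<open>v\<close>, with \<open>u\<close> a separate
  argument where needed.  Values of sections outside the slit tangent bundle are irrelevant.\<close>

type_synonym ('m, 'e) pi_section = "('m, 'e) tpoint \<Rightarrow> ('m, 'e) tvec"
type_synonym ('m, 'e) field2 = "('m, 'e) tpoint \<Rightarrow> ('m, 'e) tvec2"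

definition pi_field :: "('m, 'e::euclidean_space) chart set \<Rightarrow> ('m, 'e) pi_section \<Rightarrow> bool" where
  "pi_field \<A> X \<longleftrightarrow>
     (\<forall>u\<in>slit \<A>. X u \<in> tangent_space \<A> (fst u)) \<and>
     (\<forall>c\<in>\<A>. smooth_on (img (lift_chart \<A> c)) (\<lambda>x. X (chart_inv (lift_chart \<A> c) x) c))"

definition eta :: "('m, 'e) pi_section" where
  "eta u = snd u"

definition rho :: "('m, 'e::euclidean_space) chart set \<Rightarrow> ('m, 'e) tpoint \<Rightarrow>
    ('m, 'e) tvec2 \<Rightarrow> ('m, 'e) tvec" where
  "rho \<A> u a = differential (slit_atlas \<A>) \<A> fst u a"

definition gamma :: "('m, 'e::euclidean_space) chart set \<Rightarrow> ('m, 'e) tpoint \<Rightarrow>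
    ('m, 'e) tvec \<Rightarrow> ('m, 'e) tvec2" where
  "gamma \<A> u v = velocity (slit_atlas \<A>) (\<lambda>t. (fst u, snd u + t *\<^sub>R v))"

definition rho_field :: "('m, 'e::euclidean_space) chart set \<Rightarrow> ('m, 'e) field2 \<Rightarrow>
    ('m, 'e) pi_section" where
  "rho_field \<A> A = (\<lambda>u. rho \<A> u (A u))"

definition gamma_field :: "('m, 'e::euclidean_space) chart set \<Rightarrow> ('m, 'e) pi_section \<Rightarrow>
    ('m, 'e) field2" where
  "gamma_field \<A> X = (\<lambda>u. gamma \<A> u (X u))"


section \<open>Finsler manifolds\<close>

text \<open>The Hessian at \<open>u\<close> of the restriction of \<open>L\<^sup>2/2\<close> to the fibre through \<open>u\<close>.\<close>

definition finsler_metric :: "(('m, 'e) tpoint \<Rightarrow> real) \<Rightarrow> ('m, 'e::euclidean_space) tpoint \<Rightarrow>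
    ('m, 'e) tvec \<Rightarrow> ('m, 'e) tvec \<Rightarrow> real" where
  "finsler_metric L u v w =
     deriv (\<lambda>s. deriv (\<lambda>t. (1/2) * (L (fst u, snd u + s *\<^sub>R v + t *\<^sub>R w))\<^sup>2) 0) 0"

definition finsler_manifold :: "'m topology \<Rightarrow> ('m, 'e::euclidean_space) chart set \<Rightarrow>
    (('m, 'e) tpoint \<Rightarrow> real) \<Rightarrow> bool" where
  "finsler_manifold M \<A> L \<longleftrightarrow>
     smooth_manifold M \<A> \<and>
     (\<forall>u\<in>tangent_bundle \<A>. 0 \<le> L u) \<and>
     smooth_fun (slit_atlas \<A>) L \<and>
     (\<forall>u\<in>slit \<A>. 0 < L u) \<and>
     (\<forall>u\<in>tangent_bundle \<A>. \<forall>r>0. L (fst u, r *\<^sub>R snd u) = r * L u) \<and>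
     (\<forall>u\<in>slit \<A>. \<forall>v\<in>tangent_space \<A> (fst u). v \<noteq> 0 \<longrightarrow> 0 < finsler_metric L u v v)"


section \<open>Linear connections on the pullback bundle\<close>

text \<open>A linear connection sends a section \<open>X\<close> to the 1-form \<open>D X\<close> on the slit tangent bundle
  with values in the pullback bundle; \<open>D X u a\<close> is the covariant derivative of \<open>X\<close> along
  the tangent vector \<open>a\<close> at \<open>u\<close>.  Smoothness of \<open>D X\<close> is smoothness of its components, i.e. of
  its values on coordinate vector fields.  The first clause says that the values of \<open>X\<close> outside
  the slit tangent bundle do not matter.\<close>

type_synonym ('m, 'e) connection =
  "('m, 'e) pi_section \<Rightarrow> ('m, 'e) tpoint \<Rightarrow> ('m, 'e) tvec2 \<Rightarrow> ('m, 'e) tvec"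

definition linear_connection :: "('m, 'e::euclidean_space) chart set \<Rightarrow>
    ('m, 'e) connection \<Rightarrow> bool" where
  "linear_connection \<A> D \<longleftrightarrow>
     (\<forall>X Y. pi_field \<A> X \<and> pi_field \<A> Y \<and> (\<forall>u\<in>slit \<A>. X u = Y u) \<longrightarrow>
        (\<forall>u\<in>slit \<A>. \<forall>a\<in>tspace2 \<A> u. D X u a = D Y u a)) \<and>
     (\<forall>X. pi_field \<A> X \<longrightarrow>
        (\<forall>u\<in>slit \<A>. \<forall>a\<in>tspace2 \<A> u. D X u a \<in> tangent_space \<A> (fst u)) \<and>
        (\<forall>u\<in>slit \<A>. \<forall>a\<in>tspace2 \<A> u. \<forall>b\<in>tspace2 \<A> u. D X u (a + b) = D X u a + D X u b) \<and>
        (\<forall>u\<in>slit \<A>. \<forall>a\<in>tspace2 \<A> u. \<forall>r. D X u (r *\<^sub>R a) = r *\<^sub>R D X u a) \<and>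
        (\<forall>c\<in>\<A>. \<forall>\<xi>. smooth_on (img (lift_chart \<A> c))
           (\<lambda>x. let u = chart_inv (lift_chart \<A> c) x in
                D X u (coord_vec (slit_atlas \<A>) (lift_chart \<A> c) \<xi> u) c))) \<and>
     (\<forall>X Y. pi_field \<A> X \<and> pi_field \<A> Y \<longrightarrow>
        (\<forall>u\<in>slit \<A>. \<forall>a\<in>tspace2 \<A> u. D (X + Y) u a = D X u a + D Y u a)) \<and>
     (\<forall>f X. smooth_fun (slit_atlas \<A>) f \<and> pi_field \<A> X \<longrightarrow>
        (\<forall>u\<in>slit \<A>. \<forall>a\<in>tspace2 \<A> u.
           D (\<lambda>w. f w *\<^sub>R X w) u a = dir_deriv (slit_atlas \<A>) u a f *\<^sub>R X u + f u *\<^sub>R D X u a))"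

definition cov :: "('m, 'e) connection \<Rightarrow> ('m, 'e) field2 \<Rightarrow> ('m, 'e) pi_section \<Rightarrow>
    ('m, 'e) pi_section" where
  "cov D A X = (\<lambda>u. D X u (A u))"

definition vertical :: "('m, 'e::euclidean_space) chart set \<Rightarrow> ('m, 'e) tpoint \<Rightarrow>
    ('m, 'e) tvec2 set" where
  "vertical \<A> u = {a \<in> tspace2 \<A> u. rho \<A> u a = 0}"

definition horizontal :: "('m, 'e::euclidean_space) chart set \<Rightarrow> ('m, 'e) connection \<Rightarrow>
    ('m, 'e) tpoint \<Rightarrow> ('m, 'e) tvec2 set" where
  "horizontal \<A> D u = {a \<in> tspace2 \<A> u. D eta u a = 0}"

definition regular_connection :: "('m, 'e::euclidean_space) chart set \<Rightarrow>
    ('m, 'e) connection \<Rightarrow> bool" where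
  "regular_connection \<A> D \<longleftrightarrow> linear_connection \<A> D \<and>
     (\<forall>u\<in>slit \<A>. tspace2 \<A> u = {v + h | v h. v \<in> vertical \<A> u \<and> h \<in> horizontal \<A> D u} \<and>
        vertical \<A> u \<inter> horizontal \<A> D u = {0})"

definition beta :: "('m, 'e::euclidean_space) chart set \<Rightarrow> ('m, 'e) connection \<Rightarrow>
    ('m, 'e) tpoint \<Rightarrow> ('m, 'e) tvec \<Rightarrow> ('m, 'e) tvec2" where
  "beta \<A> D u = the_inv_into (horizontal \<A> D u) (rho \<A> u)"

definition beta_field :: "('m, 'e::euclidean_space) chart set \<Rightarrow> ('m, 'e) connection \<Rightarrow>
    ('m, 'e) pi_section \<Rightarrow> ('m, 'e) field2" where
  "beta_field \<A> D X = (\<lambda>u. beta \<A> D u (X u))"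

definition torsion :: "('m, 'e::euclidean_space) chart set \<Rightarrow> ('m, 'e) connection \<Rightarrow>
    ('m, 'e) field2 \<Rightarrow> ('m, 'e) field2 \<Rightarrow> ('m, 'e) pi_section" where
  "torsion \<A> D A B =
     cov D A (rho_field \<A> B) - cov D B (rho_field \<A> A)
       - rho_field \<A> (lie_bracket (slit_atlas \<A>) A B)"

text \<open>The sign is opposite to the most common one.\<close>

definition curvature :: "('m, 'e::euclidean_space) chart set \<Rightarrow> ('m, 'e) connection \<Rightarrow>
    ('m, 'e) field2 \<Rightarrow> ('m, 'e) field2 \<Rightarrow> ('m, 'e) pi_section \<Rightarrow> ('m, 'e) pi_section" where
  "curvature \<A> D A B Z =
     - cov D A (cov D B Z) + cov D B (cov D A Z) + cov D (lie_bracket (slit_atlas \<A>) A B) Z"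

definition Q_torsion :: "('m, 'e::euclidean_space) chart set \<Rightarrow> ('m, 'e) connection \<Rightarrow>
    ('m, 'e) pi_section \<Rightarrow> ('m, 'e) pi_section \<Rightarrow> ('m, 'e) pi_section" where
  "Q_torsion \<A> D X Y = torsion \<A> D (beta_field \<A> D X) (beta_field \<A> D Y)"

definition T_torsion :: "('m, 'e::euclidean_space) chart set \<Rightarrow> ('m, 'e) connection \<Rightarrow>
    ('m, 'e) pi_section \<Rightarrow> ('m, 'e) pi_section \<Rightarrow> ('m, 'e) pi_section" where
  "T_torsion \<A> D X Y = torsion \<A> D (gamma_field \<A> X) (beta_field \<A> D Y)"

definition P_curv :: "('m, 'e::euclidean_space) chart set \<Rightarrow> ('m, 'e) connection \<Rightarrow>
    ('m, 'e) pi_section \<Rightarrow> ('m, 'e) pi_section \<Rightarrow> ('m, 'e) pi_section \<Rightarrow> ('m, 'e) pi_section" where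
  "P_curv \<A> D X Y Z = curvature \<A> D (beta_field \<A> D X) (gamma_field \<A> Y) Z"

definition S_curv :: "('m, 'e::euclidean_space) chart set \<Rightarrow> ('m, 'e) connection \<Rightarrow>
    ('m, 'e) pi_section \<Rightarrow> ('m, 'e) pi_section \<Rightarrow> ('m, 'e) pi_section \<Rightarrow> ('m, 'e) pi_section" where
  "S_curv \<A> D X Y Z = curvature \<A> D (gamma_field \<A> X) (gamma_field \<A> Y) Z"

definition P_hat :: "('m, 'e::euclidean_space) chart set \<Rightarrow> ('m, 'e) connection \<Rightarrow>
    ('m, 'e) pi_section \<Rightarrow> ('m, 'e) pi_section \<Rightarrow> ('m, 'e) pi_section" where
  "P_hat \<A> D X Y = P_curv \<A> D X Y eta"

text \<open>Covariant derivatives of vector-valued tensors of type \<open>T\<close> and of type \<open>P\<close>, \<open>S\<close>.\<close>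

definition cov2 :: "('m, 'e) connection \<Rightarrow> ('m, 'e) field2 \<Rightarrow>
    (('m, 'e::euclidean_space) pi_section \<Rightarrow> ('m, 'e) pi_section \<Rightarrow> ('m, 'e) pi_section) \<Rightarrow>
    ('m, 'e) pi_section \<Rightarrow> ('m, 'e) pi_section \<Rightarrow> ('m, 'e) pi_section" where
  "cov2 D A B X Y = cov D A (B X Y) - B (cov D A X) Y - B X (cov D A Y)"

definition cov3 :: "('m, 'e) connection \<Rightarrow> ('m, 'e) field2 \<Rightarrow>
    (('m, 'e::euclidean_space) pi_section \<Rightarrow> ('m, 'e) pi_section \<Rightarrow> ('m, 'e) pi_section \<Rightarrow> ('m, 'e) pi_section) \<Rightarrow>
    ('m, 'e) pi_section \<Rightarrow> ('m, 'e) pi_section \<Rightarrow> ('m, 'e) pi_section \<Rightarrow> ('m, 'e) pi_section" where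
  "cov3 D A B X Y Z =
     cov D A (B X Y Z) - B (cov D A X) Y Z - B X (cov D A Y) Z - B X Y (cov D A Z)"

definition cartan_connection :: "('m, 'e::euclidean_space) chart set \<Rightarrow>
    (('m, 'e) tpoint \<Rightarrow> real) \<Rightarrow> ('m, 'e) connection \<Rightarrow> bool" where
  "cartan_connection \<A> L D \<longleftrightarrow> regular_connection \<A> D \<and>
     (\<forall>X Y. pi_field \<A> X \<and> pi_field \<A> Y \<longrightarrow>
        (\<forall>u\<in>slit \<A>. \<forall>a\<in>tspace2 \<A> u.
           dir_deriv (slit_atlas \<A>) u a (\<lambda>w. finsler_metric L w (X w) (Y w)) =
             finsler_metric L u (D X u a) (Y u) + finsler_metric L u (X u) (D Y u a))) \<and>
     (\<forall>X Y. pi_field \<A> X \<and> pi_field \<A> Y \<longrightarrow> (\<forall>u\<in>slit \<A>. Q_torsion \<A> D X Y u = 0)) \<and>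
     (\<forall>X Y Z. pi_field \<A> X \<and> pi_field \<A> Y \<and> pi_field \<A> Z \<longrightarrow>
        (\<forall>u\<in>slit \<A>. finsler_metric L u (T_torsion \<A> D X Y u) (Z u) =
                    finsler_metric L u (T_torsion \<A> D X Z u) (Y u)))"

end

theory Submission
  imports Defs
begin

text \<open>Once smoothness is settled, everything is formal algebra on global sections.  If \<open>Y\<close>, \<open>Z\<close>
  are \<open>\<pi>\<close>-vector fields then, by metricity and the symmetry axiom for \<open>T\<close>, twice \<open>g (T X Y) Z\<close>
  is the fibre derivative of \<open>g\<close> along \<open>X\<close>, i.e. the third fibre derivative of the energy.  Hence
  \<open>T\<close> is totally symmetric, \<open>T X \<eta> = 0\<close> by homogeneity, and \<open>D\<^bsub>\<gamma>X\<^esub> \<eta> = X\<close>, so that every vector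
  field \<open>A\<close> equals \<open>\<beta> (\<rho> A) + \<gamma> (D\<^bsub>A\<^esub> \<eta>)\<close>.  This expresses all brackets of horizontal and vertical
  lifts by \<open>D\<close>, \<open>T\<close> and \<open>Ph\<close>.  The first Bianchi identity then gives (b), and with the skewness (a)
  the Koszul trick gives (c), which implies (d)-(g).  The first Bianchi identity on vertical fields also
  yields \<open>S X Y Z = T X (T Y Z) - T Y (T X Z)\<close>, so \<open>S X \<eta> = 0\<close>, and (h), (i) are the
  second Bianchi identity for \<open>(\<gamma>\<eta>, \<beta>X, \<gamma>Y)\<close> and \<open>(\<beta>\<eta>, \<gamma>X, \<gamma>Y)\<close>.

  Connections are applied to global sections only, so no locality of \<open>D\<close> (hence no bump function) is
  needed.\<close>

section \<open>Smooth maps\<close>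

text \<open>Regularity is a pointwise condition and \<open>beta\<close> a pointwise inverse. That
  horizontal lifts of smooth sections are smooth must therefore be proved before brackets with them,
  or iterated derivatives along them, make sense. In a lifted chart the vertical component of a
  horizontal lift solves a linear system whose coefficients are the components of
  \<open>D eta\<close>, and smoothness is bootstrapped from that system.

  The step from (c) to (d)-(g) works because \<open>eta\<close> is parallel along horizontal fields
  and annihilated by \<open>T\<close>: a horizontal derivative of \<open>T\<close> vanishes as soon
  as one of its three metric slots contains \<open>eta\<close>. Putting \<open>Z = eta\<close> in
  (c) leaves \<open>P_hat eta\<close> as the only unknown, and \<open>X = eta\<close> then kills it.

  Pointwise identities are obtained by testing against global sections, the decisive test section
  being the difference of the two sides itself.\<close>

abbreviation fd :: "('a::real_normed_vector \<Rightarrow> 'b::real_normed_vector) \<Rightarrow> 'a \<Rightarrow> 'a \<Rightarrow> 'b" where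
  "fd f x \<equiv> frechet_derivative f (at x)"

lemma fd_eqI: "(f has_derivative f') (at x) \<Longrightarrow> fd f x = f'"
  by (metis frechet_derivative_at)

lemma fd_works: "f differentiable (at x) \<Longrightarrow> (f has_derivative fd f x) (at x)"
  using frechet_derivative_works by blast

text \<open>\<open>frechet_derivative\<close> is a choice among the derivatives at the point, and
  two functions that agree nearby have the same ones. The equation thus holds even where no
  derivative exists.\<close>

lemma fd_cong:
  assumes "open S" "x \<in> S" "\<And>y. y \<in> S \<Longrightarrow> f y = g y"
  shows "fd f x = fd g x"
proof -
  have "(f has_derivative f') (at x) \<longleftrightarrow> (g has_derivative f') (at x)" for f'
    using assms has_derivative_transform_within_open[of f f' x UNIV S g]
      has_derivative_transform_within_open[of g f' x UNIV S f] by auto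
  then show ?thesis
    by (simp add: frechet_derivative_def)
qed

lemma differentiable_cong_open:
  assumes "open S" "x \<in> S" "\<And>y. y \<in> S \<Longrightarrow> f y = g y" "f differentiable (at x)"
  shows "g differentiable (at x)"
  using assms has_derivative_transform_within_open[of f _ x UNIV S g]
  unfolding differentiable_def by blast

lemma Ck_on_cong:
  assumes "open S" "\<And>x. x \<in> S \<Longrightarrow> f x = g x" "Ck_on k S f"
  shows "Ck_on k S g"
  using assms(2,3)
proof (induction k arbitrary: f g)
  case 0
  then show ?case by (auto intro: continuous_on_eq)
next
  case (Suc k)
  have "g differentiable (at x)" if "x \<in> S" for x
    using differentiable_cong_open[OF assms(1) that Suc.prems(1)] Suc.prems(2) that by auto
  moreover have "Ck_on k S (\<lambda>x. fd g x v)" for v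
  proof (rule Suc.IH[where f = "\<lambda>x. fd f x v"])
    show "fd f x v = fd g x v" if "x \<in> S" for x
      using fd_cong[OF assms(1) that Suc.prems(1)] by simp
  qed (use Suc.prems in auto)
  ultimately show ?case by simp
qed

lemma Ck_on_imp_continuous_on:
  assumes "Ck_on k S f" shows "continuous_on S f"
  using assms
  by (cases k) (auto simp: continuous_on_eq_continuous_within
      intro: continuous_at_imp_continuous_within differentiable_imp_continuous_within)

lemma Ck_on_Suc_imp: "Ck_on (Suc k) S f \<Longrightarrow> Ck_on k S f"
proof (induction k arbitrary: f)
  case 0
  then show ?case using Ck_on_imp_continuous_on by fastforce
qed auto

lemma Ck_on_const: "Ck_on k S (\<lambda>x. c)"
  by (induction k arbitrary: c) auto

lemma Ck_on_add:
  assumes "open S" "Ck_on k S f" "Ck_on k S g"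
  shows "Ck_on k S (\<lambda>x. f x + g x)"
  using assms(2,3)
proof (induction k arbitrary: f g)
  case 0
  then show ?case by (auto intro: continuous_intros)
next
  case (Suc k)
  have "Ck_on k S (\<lambda>x. fd (\<lambda>x. f x + g x) x v)" for v
  proof (rule Ck_on_cong[OF assms(1)])
    show "Ck_on k S (\<lambda>x. fd f x v + fd g x v)"
      using Suc by auto
    show "fd f x v + fd g x v = fd (\<lambda>x. f x + g x) x v" if "x \<in> S" for x
      by (subst fd_eqI[OF has_derivative_add[OF fd_works fd_works]]) (use Suc.prems that in auto)
  qed
  then show ?case using Suc.prems by auto
qed

lemma Ck_on_bounded_linear:
  assumes "open S" "bounded_linear h" "Ck_on k S f"
  shows "Ck_on k S (\<lambda>x. h (f x))"
  using assms(3)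
proof (induction k arbitrary: f)
  case 0
  then show ?case using assms(2) by (auto intro: bounded_linear.continuous_on)
next
  case (Suc k)
  have *: "((\<lambda>x. h (f x)) has_derivative (\<lambda>v. h (fd f x v))) (at x)" if "x \<in> S" for x
    using Suc.prems that by (auto intro: bounded_linear.has_derivative[OF assms(2)] fd_works)
  have "Ck_on k S (\<lambda>x. fd (\<lambda>x. h (f x)) x v)" for v
    by (rule Ck_on_cong[OF assms(1), where f = "\<lambda>x. h (fd f x v)"])
      (use Suc * in \<open>auto simp: fd_eqI[OF *]\<close>)
  then show ?case using * by (auto simp: differentiable_def)
qed

lemma Ck_on_bounded_bilinear:
  assumes "bounded_bilinear b" "open S" "Ck_on k S f" "Ck_on k S g"
  shows "Ck_on k S (\<lambda>x. b (f x) (g x))"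
  using assms(3,4)
proof (induction k arbitrary: f g)
  case 0
  then show ?case using assms(1) by (auto intro: bounded_bilinear.continuous_on)
next
  case (Suc k)
  have *: "((\<lambda>x. b (f x) (g x)) has_derivative (\<lambda>v. b (f x) (fd g x v) + b (fd f x v) (g x))) (at x)"
    if "x \<in> S" for x
    by (rule bounded_bilinear.FDERIV[OF assms(1)]; rule fd_works) (use Suc.prems that in auto)
  have "Ck_on k S (\<lambda>x. fd (\<lambda>x. b (f x) (g x)) x v)" for v
  proof (rule Ck_on_cong[OF assms(2)])
    show "Ck_on k S (\<lambda>x. b (f x) (fd g x v) + b (fd f x v) (g x))"
      by (rule Ck_on_add[OF assms(2)]; rule Suc.IH) (use Suc.prems Ck_on_Suc_imp in auto)
  qed (simp add: fd_eqI[OF *])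
  then show ?case using * by (auto simp: differentiable_def)
qed

text \<open>For a linear inner map the chain rule differentiates \<open>f\<close> in the constant
  direction \<open>h v\<close>, so the induction hypothesis applies to
  \<open>\<lambda>x. fd f x (h v)\<close>.\<close>

lemma Ck_on_compose_linear:
  fixes h :: "'c::euclidean_space \<Rightarrow> 'a::euclidean_space"
  assumes "bounded_linear h" "open S" "Ck_on k S f" "open T" "h ` T \<subseteq> S"
  shows "Ck_on k T (\<lambda>x. f (h x))"
  using assms(3)
proof (induction k arbitrary: f)
  case 0
  then show ?case using assms(1,5)
    using continuous_on_compose2[of S f T h] linear_continuous_on by auto
next
  case (Suc k)
  have *: "((\<lambda>x. f (h x)) has_derivative (\<lambda>v. fd f (h x) (h v))) (at x)" if "x \<in> T" for x
    using Suc.prems that assms(5)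
    by (auto intro!: has_derivative_compose[of h h x UNIV f] fd_works
        bounded_linear_imp_has_derivative[OF assms(1)])
  have "Ck_on k T (\<lambda>x. fd (\<lambda>x. f (h x)) x v)" for v
  proof (rule Ck_on_cong[OF assms(4)])
    show "Ck_on k T (\<lambda>x. fd f (h x) (h v))"
      using Suc.IH[of "\<lambda>x. fd f x (h v)"] Suc.prems by auto
  qed (simp add: fd_eqI[OF *])
  then show ?case using * by (auto simp: differentiable_def)
qed

lemma Ck_on_sum:
  assumes "open S" "finite I" "\<And>i. i \<in> I \<Longrightarrow> Ck_on k S (f i)"
  shows "Ck_on k S (\<lambda>x. \<Sum>i\<in>I. f i x)"
  using assms(2,3) by (induction I rule: finite_induct) (auto intro: Ck_on_const Ck_on_add assms(1))

section \<open>Families of linear maps depending on a point\<close>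

lemma linear_expand:
  fixes v :: "'a::euclidean_space"
  assumes "linear h" shows "h v = (\<Sum>b\<in>Basis. (v \<bullet> b) *\<^sub>R h b)"
proof -
  have "h v = h (\<Sum>b\<in>Basis. (v \<bullet> b) *\<^sub>R b)"
    by (simp add: euclidean_representation)
  also have "\<dots> = (\<Sum>b\<in>Basis. (v \<bullet> b) *\<^sub>R h b)"
    by (simp add: linear_sum[OF assms] linear_scale[OF assms])
  finally show ?thesis .
qed

text \<open>Expanding \<open>f x\<close> in the basis turns this into a finite sum of products.
  Jacobians, metrics and connections applied to smooth fields are all of this form.\<close>

lemma Ck_on_linear_family:
  fixes h :: "'a::euclidean_space \<Rightarrow> 'b::euclidean_space \<Rightarrow> 'c::real_normed_vector"
  assumes S: "open S" and lin: "\<And>x. x \<in> S \<Longrightarrow> linear (h x)" and "\<And>v. Ck_on k S (\<lambda>x. h x v)" "Ck_on k S f"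
  shows "Ck_on k S (\<lambda>x. h x (f x))"
proof (rule Ck_on_cong[OF S])
  show "Ck_on k S (\<lambda>x. \<Sum>b\<in>Basis. (f x \<bullet> b) *\<^sub>R h x b)"
    by (intro Ck_on_sum Ck_on_bounded_bilinear[OF bounded_bilinear_scaleR]
        Ck_on_bounded_linear[OF _ bounded_linear_inner_left] S assms finite_Basis)
qed (simp add: linear_expand[OF lin, symmetric])

lemma smooth_on_differentiable: "smooth_on S f \<Longrightarrow> x \<in> S \<Longrightarrow> f differentiable (at x)"
  by (metis Ck_on.simps(2) smooth_on_def)

lemma smooth_on_has_derivative: "smooth_on S f \<Longrightarrow> x \<in> S \<Longrightarrow> (f has_derivative fd f x) (at x)"
  by (simp add: fd_works smooth_on_differentiable)

lemma smooth_on_fd: "smooth_on S f \<Longrightarrow> smooth_on S (\<lambda>x. fd f x v)"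
  by (metis Ck_on.simps(2) smooth_on_def)

lemma smooth_on_imp_continuous_on: "smooth_on S f \<Longrightarrow> continuous_on S f"
  by (metis Ck_on.simps(1) smooth_on_def)

lemma smooth_on_cong:
  "open S \<Longrightarrow> smooth_on S f \<Longrightarrow> (\<And>x. x \<in> S \<Longrightarrow> f x = g x) \<Longrightarrow> smooth_on S g"
  unfolding smooth_on_def using Ck_on_cong by blast

lemma smooth_on_const: "smooth_on S (\<lambda>x. c)"
  by (simp add: smooth_on_def Ck_on_const)

lemma smooth_on_add:
  "open S \<Longrightarrow> smooth_on S f \<Longrightarrow> smooth_on S g \<Longrightarrow> smooth_on S (\<lambda>x. f x + g x)"
  by (simp add: smooth_on_def Ck_on_add)

lemma smooth_on_bounded_linear:
  "open S \<Longrightarrow> bounded_linear h \<Longrightarrow> smooth_on S f \<Longrightarrow> smooth_on S (\<lambda>x. h (f x))"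
  by (simp add: smooth_on_def Ck_on_bounded_linear)

lemma smooth_on_bounded_bilinear:
  "bounded_bilinear b \<Longrightarrow> open S \<Longrightarrow> smooth_on S f \<Longrightarrow> smooth_on S g \<Longrightarrow> smooth_on S (\<lambda>x. b (f x) (g x))"
  by (simp add: smooth_on_def Ck_on_bounded_bilinear)

lemma smooth_on_compose_linear:
  fixes h :: "'c::euclidean_space \<Rightarrow> 'a::euclidean_space"
  shows "bounded_linear h \<Longrightarrow> open S \<Longrightarrow> smooth_on S f \<Longrightarrow> open T \<Longrightarrow> h ` T \<subseteq> S \<Longrightarrow>
    smooth_on T (\<lambda>x. f (h x))"
  by (simp add: smooth_on_def Ck_on_compose_linear)

lemma smooth_on_ident: "open S \<Longrightarrow> smooth_on S (\<lambda>x. x)"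
proof -
  have "Ck_on k S (\<lambda>x. x)" for k
    by (cases k) (auto simp: Ck_on_const continuous_on_id)
  then show ?thesis by (simp add: smooth_on_def)
qed

lemma smooth_on_minus: "open S \<Longrightarrow> smooth_on S f \<Longrightarrow> smooth_on S (\<lambda>x. - f x)"
  by (rule smooth_on_bounded_linear) (auto intro: bounded_linear_minus bounded_linear_ident)

lemma smooth_on_diff:
  "open S \<Longrightarrow> smooth_on S f \<Longrightarrow> smooth_on S g \<Longrightarrow> smooth_on S (\<lambda>x. f x - g x)"
  using smooth_on_add[of S f "\<lambda>x. - g x"] smooth_on_minus[of S g] by simp

lemma smooth_on_scaleR:
  "open S \<Longrightarrow> smooth_on S f \<Longrightarrow> smooth_on S g \<Longrightarrow> smooth_on S (\<lambda>x. f x *\<^sub>R g x)"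
  using smooth_on_bounded_bilinear[OF bounded_bilinear_scaleR] .

lemma smooth_on_inner:
  "open S \<Longrightarrow> smooth_on S f \<Longrightarrow> smooth_on S (\<lambda>x. f x \<bullet> c)"
  by (rule smooth_on_bounded_linear[OF _ bounded_linear_inner_left])

lemma smooth_on_Pair:
  assumes "open S" "smooth_on S f" "smooth_on S g"
  shows "smooth_on S (\<lambda>x. (f x, g x))"
proof -
  have "smooth_on S (\<lambda>x. (f x, 0) + (0, g x))"
    by (intro smooth_on_add smooth_on_bounded_linear[OF assms(1), where h = "\<lambda>y. (y, 0)"]
        smooth_on_bounded_linear[OF assms(1), where h = "\<lambda>y. (0, y)"] assms)
      (auto intro: bounded_linear_Pair bounded_linear_ident bounded_linear_zero)
  then show ?thesis by simp
qed

lemma smooth_on_fst: "open S \<Longrightarrow> smooth_on S f \<Longrightarrow> smooth_on S (\<lambda>x. fst (f x))"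
  by (rule smooth_on_bounded_linear[OF _ bounded_linear_fst])

lemma smooth_on_snd: "open S \<Longrightarrow> smooth_on S f \<Longrightarrow> smooth_on S (\<lambda>x. snd (f x))"
  by (rule smooth_on_bounded_linear[OF _ bounded_linear_snd])

lemma smooth_on_linear_family:
  fixes h :: "'a::euclidean_space \<Rightarrow> 'b::euclidean_space \<Rightarrow> 'c::real_normed_vector"
  shows "open S \<Longrightarrow> (\<And>x. x \<in> S \<Longrightarrow> linear (h x)) \<Longrightarrow> (\<And>v. smooth_on S (\<lambda>x. h x v)) \<Longrightarrow>
    smooth_on S f \<Longrightarrow> smooth_on S (\<lambda>x. h x (f x))"
  by (simp add: smooth_on_def Ck_on_linear_family)

lemma has_derivative_linear_family:
  fixes h :: "'a::real_normed_vector \<Rightarrow> 'b::euclidean_space \<Rightarrow> 'c::real_normed_vector"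
  assumes S: "open S" "x \<in> S" and lin: "\<And>x. x \<in> S \<Longrightarrow> linear (h x)"
    and h: "\<And>v. ((\<lambda>x. h x v) has_derivative h' v) (at x)" and f: "(f has_derivative f') (at x)"
  shows "((\<lambda>x. h x (f x)) has_derivative (\<lambda>k. h' (f x) k + h x (f' k))) (at x)"
proof -
  \<comment> \<open>Uniqueness of derivatives forces \<open>h'\<close> to be linear in
    \<open>v\<close>, so that it can be expanded in the basis as well.\<close>
  have h': "h' v k = (\<Sum>b\<in>Basis. (v \<bullet> b) *\<^sub>R h' b k)" for v k
  proof -
    have "((\<lambda>y. \<Sum>b\<in>Basis. (v \<bullet> b) *\<^sub>R h y b) has_derivative (\<lambda>k. \<Sum>b\<in>Basis. (v \<bullet> b) *\<^sub>R h' b k)) (at x)"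
      by (auto intro!: derivative_eq_intros h)
    then have "((\<lambda>y. h y v) has_derivative (\<lambda>k. \<Sum>b\<in>Basis. (v \<bullet> b) *\<^sub>R h' b k)) (at x)"
      by (rule has_derivative_transform_within_open[OF _ S]) (simp add: linear_expand[OF lin, symmetric])
    from has_derivative_unique[OF this h] show ?thesis by metis
  qed
  have "((\<lambda>y. \<Sum>b\<in>Basis. (f y \<bullet> b) *\<^sub>R h y b) has_derivative
      (\<lambda>k. \<Sum>b\<in>Basis. (f x \<bullet> b) *\<^sub>R h' b k + (f' k \<bullet> b) *\<^sub>R h x b)) (at x)"
    by (auto intro!: derivative_eq_intros h f)
  also have "(\<lambda>k. \<Sum>b\<in>Basis. (f x \<bullet> b) *\<^sub>R h' b k + (f' k \<bullet> b) *\<^sub>R h x b) =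
      (\<lambda>k. h' (f x) k + h x (f' k))"
    unfolding h'[of "f x"] linear_expand[OF lin[OF S(2)], of "f' _"] by (simp add: sum.distrib)
  finally show ?thesis
    by (rule has_derivative_transform_within_open[OF _ S]) (simp add: linear_expand[OF lin, symmetric])
qed

lemma smooth_on_linear_fd: "smooth_on S f \<Longrightarrow> x \<in> S \<Longrightarrow> linear (fd f x)"
  using linear_frechet_derivative smooth_on_differentiable by blast

lemma smooth_on_fd_field:
  assumes "open S" "smooth_on S f" "smooth_on S A"
  shows "smooth_on S (\<lambda>x. fd f x (A x))"
  by (rule smooth_on_linear_family) (use assms in \<open>auto intro: smooth_on_linear_fd smooth_on_fd\<close>)

text \<open>The second derivative of \<open>f\<close> appears as the derivative of
  \<open>fd f y v\<close> with the direction \<open>v = A x\<close> frozen. This is the shape in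
  which the symmetry of second derivatives is stated.\<close>

lemma has_derivative_fd_field:
  assumes "open S" "x \<in> S" "smooth_on S f" "(A has_derivative A') (at x)"
  shows "((\<lambda>x. fd f x (A x)) has_derivative (\<lambda>k. fd (\<lambda>y. fd f y (A x)) x k + fd f x (A' k))) (at x)"
  by (rule has_derivative_linear_family[OF assms(1,2) smooth_on_linear_fd[OF assms(3)] _ assms(4),
        where h' = "\<lambda>v. fd (\<lambda>x. fd f x v) x"])
    (auto intro: smooth_on_has_derivative[OF smooth_on_fd[OF assms(3)] assms(2)])

lemma fd_fd_field:
  assumes "open S" "x \<in> S" "smooth_on S f" "A differentiable (at x)"
  shows "fd (\<lambda>x. fd f x (A x)) x k = fd (\<lambda>y. fd f y (A x)) x k + fd f x (fd A x k)"
  by (subst fd_eqI[OF has_derivative_fd_field[OF assms(1-3) fd_works[OF assms(4)]]]) auto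

section \<open>Symmetry of second derivatives\<close>

lemma second_difference_mean_value:
  fixes f :: "'a::euclidean_space \<Rightarrow> real"
  assumes f: "\<And>y. y \<in> S \<Longrightarrow> f differentiable (at y)"
      "\<And>y. y \<in> S \<Longrightarrow> (\<lambda>y. fd f y v) differentiable (at y)"
    and h: "0 < h" and S: "\<And>s t. 0 \<le> s \<Longrightarrow> s \<le> h \<Longrightarrow> 0 \<le> t \<Longrightarrow> t \<le> h \<Longrightarrow> x + s *\<^sub>R v + t *\<^sub>R w \<in> S"
  obtains s t where "0 \<le> s" "s \<le> h" "0 \<le> t" "t \<le> h"
    "f (x + h *\<^sub>R v + h *\<^sub>R w) - f (x + h *\<^sub>R v) - f (x + h *\<^sub>R w) + f x
      = h * h * fd (\<lambda>y. fd f y v) (x + s *\<^sub>R v + t *\<^sub>R w) w"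
proof -
  have 1: "((\<lambda>s. f (x + s *\<^sub>R v + t *\<^sub>R w)) has_real_derivative fd f (x + s *\<^sub>R v + t *\<^sub>R w) v) (at s)"
    if "0 \<le> s" "s \<le> h" "0 \<le> t" "t \<le> h" for s t
  proof -
    have "((\<lambda>s. f (x + s *\<^sub>R v + t *\<^sub>R w)) has_derivative (\<lambda>k. fd f (x + s *\<^sub>R v + t *\<^sub>R w) (k *\<^sub>R v))) (at s)"
      by (rule has_derivative_compose[of "\<lambda>s. x + s *\<^sub>R v + t *\<^sub>R w", OF _ fd_works[OF f(1)[OF S[OF that]]]])
        (auto intro!: derivative_eq_intros)
    then show ?thesis
      unfolding has_field_derivative_def
      by (simp add: linear_scale[OF linear_frechet_derivative[OF f(1)[OF S[OF that]]]] mult_commute_abs)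
  qed
  have 2: "((\<lambda>t. fd f (x + s *\<^sub>R v + t *\<^sub>R w) v) has_real_derivative
      fd (\<lambda>y. fd f y v) (x + s *\<^sub>R v + t *\<^sub>R w) w) (at t)"
    if "0 \<le> s" "s \<le> h" "0 \<le> t" "t \<le> h" for s t
  proof -
    have "((\<lambda>t. fd f (x + s *\<^sub>R v + t *\<^sub>R w) v) has_derivative
        (\<lambda>k. fd (\<lambda>y. fd f y v) (x + s *\<^sub>R v + t *\<^sub>R w) (k *\<^sub>R w))) (at t)"
      by (rule has_derivative_compose[of "\<lambda>t. x + s *\<^sub>R v + t *\<^sub>R w" _ _ _ "\<lambda>y. fd f y v", OF _ fd_works[OF f(2)[OF S[OF that]]]])
        (auto intro!: derivative_eq_intros)
    then show ?thesis
      unfolding has_field_derivative_def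
      by (simp add: linear_scale[OF linear_frechet_derivative[OF f(2)[OF S[OF that]]]] mult_commute_abs)
  qed
  have d1: "((\<lambda>s. f (x + s *\<^sub>R v + h *\<^sub>R w) - f (x + s *\<^sub>R v + 0 *\<^sub>R w)) has_real_derivative
      (fd f (x + s *\<^sub>R v + h *\<^sub>R w) v - fd f (x + s *\<^sub>R v + 0 *\<^sub>R w) v)) (at s)"
    if "0 \<le> s" "s \<le> h" for s
    by (rule DERIV_diff; rule 1) (use that h in auto)
  \<comment> \<open>Mean value theorem along \<open>v\<close>, applied to the increment of
    \<open>f\<close> in direction \<open>h *\<^sub>R w\<close>. The remaining increment of the first
    derivative is treated in the same way along \<open>w\<close>.\<close>
  obtain s where s: "0 < s" "s < h"
    "(f (x + h *\<^sub>R v + h *\<^sub>R w) - f (x + h *\<^sub>R v + 0 *\<^sub>R w)) - (f (x + 0 *\<^sub>R v + h *\<^sub>R w) - f (x + 0 *\<^sub>R v + 0 *\<^sub>R w))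
      = (h - 0) * (fd f (x + s *\<^sub>R v + h *\<^sub>R w) v - fd f (x + s *\<^sub>R v + 0 *\<^sub>R w) v)"
    using MVT2[OF h d1] by blast
  have d2: "((\<lambda>t. fd f (x + s *\<^sub>R v + t *\<^sub>R w) v) has_real_derivative
      fd (\<lambda>y. fd f y v) (x + s *\<^sub>R v + t *\<^sub>R w) w) (at t)" if "0 \<le> t" "t \<le> h" for t
    by (rule 2) (use that s in auto)
  obtain t where t: "0 < t" "t < h"
    "fd f (x + s *\<^sub>R v + h *\<^sub>R w) v - fd f (x + s *\<^sub>R v + 0 *\<^sub>R w) v
      = (h - 0) * fd (\<lambda>y. fd f y v) (x + s *\<^sub>R v + t *\<^sub>R w) w"
    using MVT2[OF h d2] by blast
  show ?thesis
    by (rule that[of s t]) (use s t in \<open>auto simp: algebra_simps\<close>)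
qed

text \<open>The second difference of \<open>f\<close> over a small parallelogram is symmetric in
  \<open>v\<close> and \<open>w\<close>. By the mean value theorem it is a multiple of either mixed
  derivative at some point nearby, so by continuity the two cannot differ at
  \<open>x\<close>.\<close>

lemma symmetric_second_derivative_real:
  fixes f :: "'a::euclidean_space \<Rightarrow> real"
  assumes S: "open S" "x \<in> S" and f: "smooth_on S f"
  shows "fd (\<lambda>y. fd f y v) x w = fd (\<lambda>y. fd f y w) x v"
proof (rule ccontr)
  let ?F = "\<lambda>y. fd (\<lambda>y. fd f y v) y w" and ?G = "\<lambda>y. fd (\<lambda>y. fd f y w) y v"
  assume ne: "?F x \<noteq> ?G x"
  \<comment> \<open>Half of the supposed gap: two errors below \<open>e\<close> cannot add up to
    it.\<close>
  define e where "e = \<bar>?F x - ?G x\<bar> / 2"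
  have e: "0 < e" using ne by (simp add: e_def)
  have "continuous_on S ?F" "continuous_on S ?G"
    by (auto intro!: smooth_on_imp_continuous_on smooth_on_fd f)
  then have "isCont ?F x" "isCont ?G x"
    using S continuous_on_eq_continuous_at by blast+
  then obtain d1 d2 where d12: "0 < d1" "\<And>y. dist y x < d1 \<Longrightarrow> \<bar>?F y - ?F x\<bar> < e"
    "0 < d2" "\<And>y. dist y x < d2 \<Longrightarrow> \<bar>?G y - ?G x\<bar> < e"
    using e unfolding continuous_at_eps_delta dist_real_def by metis
  obtain d3 where d3: "0 < d3" "ball x d3 \<subseteq> S"
    using S openE by blast
  define d where "d = min d1 (min d2 d3)"
  \<comment> \<open>Keeps the whole parallelogram within distance \<open>d / 2\<close> of
    \<open>x\<close>; the summand 1 keeps the denominator positive if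
    \<open>v = w = 0\<close>.\<close>
  define h where "h = d / (2 * (norm v + norm w + 1))"
  have d: "0 < d" using d12 d3 by (simp add: d_def)
  have h: "0 < h" using d by (simp add: h_def add_nonneg_pos)
  have near: "dist (x + s *\<^sub>R v + t *\<^sub>R w) x < d" if "0 \<le> s" "s \<le> h" "0 \<le> t" "t \<le> h" for s t
  proof -
    have "norm (s *\<^sub>R v + t *\<^sub>R w) \<le> s * norm v + t * norm w"
      using that norm_triangle_ineq[of "s *\<^sub>R v" "t *\<^sub>R w"] by simp
    also have "\<dots> \<le> h * norm v + h * norm w"
      using that by (intro add_mono mult_right_mono) auto
    also have "\<dots> \<le> h * (norm v + norm w + 1)"
      using h by (simp add: algebra_simps)
    also have "\<dots> = d / 2"
    proof -
      have "norm v + norm w + 1 > 0" by (simp add: add_nonneg_pos)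
      then show ?thesis by (simp add: h_def field_simps)
    qed
    also have "\<dots> < d" using d by simp
    finally show ?thesis by (simp add: dist_norm add.assoc)
  qed
  have swap: "x + s *\<^sub>R w + t *\<^sub>R v = x + t *\<^sub>R v + s *\<^sub>R w" for s t
    by simp
  have "ball x d \<subseteq> S"
    using d3(2) by (auto simp: d_def)
  then have inS: "x + s *\<^sub>R v + t *\<^sub>R w \<in> S" "x + s *\<^sub>R w + t *\<^sub>R v \<in> S"
    if "0 \<le> s" "s \<le> h" "0 \<le> t" "t \<le> h" for s t
    unfolding swap using near[OF that] near[OF that(3,4,1,2)]
    by (metis dist_commute mem_ball subsetD)+
  note df = smooth_on_differentiable[OF f] smooth_on_differentiable[OF smooth_on_fd[OF f]]
  obtain s t where st: "0 \<le> s" "s \<le> h" "0 \<le> t" "t \<le> h"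
    "f (x + h *\<^sub>R v + h *\<^sub>R w) - f (x + h *\<^sub>R v) - f (x + h *\<^sub>R w) + f x = h * h * ?F (x + s *\<^sub>R v + t *\<^sub>R w)"
    by (rule second_difference_mean_value[OF df h, where x = x and v = v and w = w]) (use inS in auto)
  obtain s' t' where st': "0 \<le> s'" "s' \<le> h" "0 \<le> t'" "t' \<le> h"
    "f (x + h *\<^sub>R w + h *\<^sub>R v) - f (x + h *\<^sub>R w) - f (x + h *\<^sub>R v) + f x = h * h * ?G (x + s' *\<^sub>R w + t' *\<^sub>R v)"
    by (rule second_difference_mean_value[OF df h, where x = x and v = w and w = v]) (use inS in auto)
  have "h * h * ?F (x + s *\<^sub>R v + t *\<^sub>R w) = h * h * ?G (x + s' *\<^sub>R w + t' *\<^sub>R v)"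
    using st(5) st'(5) unfolding swap by linarith
  then have eq: "?F (x + s *\<^sub>R v + t *\<^sub>R w) = ?G (x + s' *\<^sub>R w + t' *\<^sub>R v)"
    using h by simp
  have "\<bar>?F (x + s *\<^sub>R v + t *\<^sub>R w) - ?F x\<bar> < e"
    using near[OF st(1-4)] by (intro d12) (simp add: d_def)
  moreover have "\<bar>?G (x + s' *\<^sub>R w + t' *\<^sub>R v) - ?G x\<bar> < e"
    unfolding swap using near[OF st'(3,4,1,2)] by (intro d12) (simp add: d_def)
  ultimately have "\<bar>?F x - ?G x\<bar> < e + e"
    using eq unfolding abs_less_iff by linarith
  then show False by (simp add: e_def)
qed

text \<open>Reduced to the real case by pairing with every vector \<open>c\<close>.\<close>

lemma symmetric_second_derivative:
  fixes f :: "'a::euclidean_space \<Rightarrow> 'b::real_inner"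
  assumes S: "open S" "x \<in> S" and f: "smooth_on S f"
  shows "fd (\<lambda>y. fd f y v) x w = fd (\<lambda>y. fd f y w) x v"
proof -
  have 1: "fd (\<lambda>y. h y \<bullet> c) y k = fd h y k \<bullet> c" if "smooth_on S h" "y \<in> S" for h :: "'a \<Rightarrow> 'b" and c y k
    by (subst fd_eqI[OF bounded_linear.has_derivative[OF bounded_linear_inner_left smooth_on_has_derivative[OF that]]]) simp
  have 2: "fd (\<lambda>y. fd (\<lambda>y. f y \<bullet> c) y v) x w = fd (\<lambda>y. fd f y v) x w \<bullet> c" for c v w
  proof -
    have "fd (\<lambda>y. fd (\<lambda>y. f y \<bullet> c) y v) x = fd (\<lambda>y. fd f y v \<bullet> c) x"
      by (rule fd_cong[OF S]) (simp add: 1[OF f])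
    then show ?thesis by (simp add: 1[OF smooth_on_fd[OF f] S(2)])
  qed
  have "fd (\<lambda>y. fd f y v) x w \<bullet> c = fd (\<lambda>y. fd f y w) x v \<bullet> c" for c
    using symmetric_second_derivative_real[OF S smooth_on_inner[OF S(1) f], of c v w] by (simp add: 2)
  then show ?thesis using vector_eq_rdot by blast
qed


section \<open>Tangent vectors and Lie brackets on a smooth atlas\<close>

lemma scaleR_fun_apply [simp]: "(r *\<^sub>R f) x = r *\<^sub>R f x"
  by (simp add: scaleR_fun_def)

text \<open>The chart \<open>c\<close> in which a field is read and the index \<open>d\<close> of
  its component are kept apart: a section of the pullback bundle is read in a lifted chart, but its
  component belongs to a chart of the base.\<close>

abbreviation (input) vcomp :: "('m, 'e) chart \<Rightarrow> ('m \<Rightarrow> ('n \<Rightarrow> 'b)) \<Rightarrow> 'n \<Rightarrow> 'e \<Rightarrow> 'b" where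
  "vcomp c A d \<equiv> \<lambda>x. A (chart_inv c x) d"

text \<open>Charts enter the calculus through injectivity and through smooth transitions on open
  overlaps. In this form the notion passes to the slit tangent bundle, so one treatment of vector
  fields and brackets serves both manifolds.\<close>

locale smooth_atlas =
  fixes \<A> :: "('m, 'e::euclidean_space) chart set"
  assumes inj_chart: "c \<in> \<A> \<Longrightarrow> inj_on (snd c) (fst c)"
    and open_overlap: "c \<in> \<A> \<Longrightarrow> d \<in> \<A> \<Longrightarrow> open (snd c ` (fst c \<inter> fst d))"
    and smooth_transition: "c \<in> \<A> \<Longrightarrow> d \<in> \<A> \<Longrightarrow>
      smooth_on (snd c ` (fst c \<inter> fst d)) (snd d \<circ> chart_inv c)"
begin

abbreviation jac :: "('m, 'e) chart \<Rightarrow> ('m, 'e) chart \<Rightarrow> 'm \<Rightarrow> 'e \<Rightarrow> 'e" where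
  "jac c d p \<equiv> fd (snd d \<circ> chart_inv c) (snd c p)"

lemma charts_atD: "c \<in> charts_at \<A> p \<Longrightarrow> c \<in> \<A>" "c \<in> charts_at \<A> p \<Longrightarrow> p \<in> fst c"
  by (auto simp: charts_at_def)

lemma charts_atI: "c \<in> \<A> \<Longrightarrow> p \<in> fst c \<Longrightarrow> c \<in> charts_at \<A> p"
  by (auto simp: charts_at_def)

lemma chart_inv_map: "c \<in> charts_at \<A> p \<Longrightarrow> chart_inv c (snd c p) = p"
  by (simp add: charts_at_def chart_inv_def inj_chart)

lemma map_chart_inv: "x \<in> img c \<Longrightarrow> snd c (chart_inv c x) = x"
  by (simp add: img_def chart_inv_def f_inv_into_f)

lemma chart_inv_charts_at: "c \<in> \<A> \<Longrightarrow> x \<in> img c \<Longrightarrow> c \<in> charts_at \<A> (chart_inv c x)"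
  by (simp add: img_def chart_inv_def charts_at_def inv_into_into)

lemma open_img: "c \<in> \<A> \<Longrightarrow> open (img c)"
  using open_overlap[of c c] by (simp add: img_def)

lemma map_in_img: "c \<in> charts_at \<A> p \<Longrightarrow> snd c p \<in> img c"
  by (simp add: charts_at_def img_def)

lemma map_in_overlap: "c \<in> charts_at \<A> p \<Longrightarrow> d \<in> charts_at \<A> p \<Longrightarrow> snd c p \<in> snd c ` (fst c \<inter> fst d)"
  by (simp add: charts_at_def)

lemma overlapE:
  assumes "x \<in> snd c ` (fst c \<inter> fst d)" "c \<in> \<A>" "d \<in> \<A>"
  obtains q where "x = snd c q" "chart_inv c x = q" "c \<in> charts_at \<A> q" "d \<in> charts_at \<A> q"
  using assms that chart_inv_map charts_atI by blast

lemma transition_has_derivative: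
  assumes "c \<in> charts_at \<A> p" "d \<in> charts_at \<A> p"
  shows "((snd d \<circ> chart_inv c) has_derivative jac c d p) (at (snd c p))"
  using smooth_on_has_derivative[OF smooth_transition map_in_overlap[OF assms]] assms charts_atD by blast

lemma linear_jac: "c \<in> charts_at \<A> p \<Longrightarrow> d \<in> charts_at \<A> p \<Longrightarrow> linear (jac c d p)"
  using transition_has_derivative has_derivative_linear by blast

lemma has_derivative_change_chart:
  assumes cd: "c \<in> charts_at \<A> p" "d \<in> charts_at \<A> p"
    and f: "((\<lambda>x. f (chart_inv d x)) has_derivative f') (at (snd d p))"
  shows "((\<lambda>x. f (chart_inv c x)) has_derivative (\<lambda>v. f' (jac c d p v))) (at (snd c p))"
proof -
  note cd' = charts_atD(1)[OF cd(1)] charts_atD(1)[OF cd(2)]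
  have "((\<lambda>x. f (chart_inv d ((snd d \<circ> chart_inv c) x))) has_derivative (\<lambda>v. f' (jac c d p v))) (at (snd c p))"
    by (rule has_derivative_compose[OF transition_has_derivative[OF cd]]) (simp add: chart_inv_map cd f)
  then show ?thesis
    by (rule has_derivative_transform_within_open[OF _ open_overlap[OF cd'] map_in_overlap[OF cd]])
      (auto elim!: overlapE[OF _ cd'] simp: chart_inv_map)
qed

text \<open>Cocycle rule: the map \<open>snd e\<close>, differentiated in the chart \<open>d\<close>
  and carried to \<open>c\<close> by the chain rule, is the transition from \<open>c\<close> to
  \<open>e\<close>, and derivatives are unique.\<close>

lemma jac_compose:
  assumes "c \<in> charts_at \<A> p" "d \<in> charts_at \<A> p" "e \<in> charts_at \<A> p"
  shows "jac d e p (jac c d p v) = jac c e p v"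
proof -
  have "((snd e \<circ> chart_inv c) has_derivative (\<lambda>v. jac d e p (jac c d p v))) (at (snd c p))"
    using has_derivative_change_chart[OF assms(1,2), of "snd e"] transition_has_derivative[OF assms(2,3)]
    by (simp add: comp_def)
  from fun_cong[OF has_derivative_unique[OF this transition_has_derivative[OF assms(1,3)]], of v]
  show ?thesis .
qed

lemma jac_refl:
  assumes "c \<in> charts_at \<A> p" shows "jac c c p v = v"
proof -
  have "jac c c p = fd (\<lambda>x. x) (snd c p)"
    by (rule fd_cong[OF open_img[OF charts_atD(1)[OF assms]] map_in_img[OF assms]]) (simp add: map_chart_inv)
  then show ?thesis by simp
qed

lemma tangent_space_transform:
  "a \<in> tangent_space \<A> p \<Longrightarrow> c \<in> charts_at \<A> p \<Longrightarrow> d \<in> charts_at \<A> p \<Longrightarrow> jac c d p (a c) = a d"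
  unfolding tangent_space_def by (rule sym) blast

lemma tangent_space_off: "a \<in> tangent_space \<A> p \<Longrightarrow> c \<notin> charts_at \<A> p \<Longrightarrow> a c = 0"
  unfolding tangent_space_def by blast

text \<open>By the cocycle rule, compatibility with one chart implies compatibility of all pairs of
  charts.\<close>

lemma tangent_spaceI:
  assumes c: "c \<in> charts_at \<A> p" and "\<And>d. d \<notin> charts_at \<A> p \<Longrightarrow> a d = 0"
    and a: "\<And>d. d \<in> charts_at \<A> p \<Longrightarrow> a d = jac c d p (a c)"
  shows "a \<in> tangent_space \<A> p"
proof -
  have "a e = jac d e p (a d)" if "d \<in> charts_at \<A> p" "e \<in> charts_at \<A> p" for d e
    using a[OF that(1)] a[OF that(2)] jac_compose[OF c that] by simp
  then show ?thesis
    unfolding tangent_space_def using assms(2) by blast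
qed

lemma tangent_eqI:
  assumes "a \<in> tangent_space \<A> p" "b \<in> tangent_space \<A> p" "c \<in> charts_at \<A> p" "a c = b c"
  shows "a = b"
  by (rule ext) (metis assms tangent_space_transform tangent_space_off)

lemma subspace_tangent_space: "subspace (tangent_space \<A> p)"
proof (rule subspaceI)
  show "0 \<in> tangent_space \<A> p"
    by (auto simp: tangent_space_def linear_0[OF linear_jac])
next
  fix v w assume vw: "v \<in> tangent_space \<A> p" "w \<in> tangent_space \<A> p"
  show "v + w \<in> tangent_space \<A> p"
    unfolding tangent_space_def mem_Collect_eq
    by (intro conjI allI ballI impI)
      (simp_all add: vw tangent_space_off[OF vw(1)] tangent_space_off[OF vw(2)] linear_add[OF linear_jac] tangent_space_transform)
next
  fix r v assume v: "v \<in> tangent_space \<A> p"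
  show "r *\<^sub>R v \<in> tangent_space \<A> p"
    unfolding tangent_space_def mem_Collect_eq
    by (intro conjI allI ballI impI)
      (simp_all add: v tangent_space_off[OF v] linear_scale[OF linear_jac] tangent_space_transform)
qed

lemmas tangent_space_closed = subspace_add[OF subspace_tangent_space] subspace_diff[OF subspace_tangent_space]
  subspace_scale[OF subspace_tangent_space] subspace_neg[OF subspace_tangent_space]
  subspace_0[OF subspace_tangent_space]

lemma coord_vec_apply: "d \<in> charts_at \<A> p \<Longrightarrow> coord_vec \<A> c \<xi> p d = jac c d p \<xi>"
  by (simp add: coord_vec_def)

lemma coord_vec_self: "c \<in> charts_at \<A> p \<Longrightarrow> coord_vec \<A> c \<xi> p c = \<xi>"
  by (simp add: coord_vec_apply jac_refl)

lemma coord_vec_tangent: "c \<in> charts_at \<A> p \<Longrightarrow> coord_vec \<A> c \<xi> p \<in> tangent_space \<A> p"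
  by (rule tangent_spaceI) (auto simp: coord_vec_apply coord_vec_self jac_refl, simp add: coord_vec_def)

lemma coord_vec_eq: "a \<in> tangent_space \<A> p \<Longrightarrow> c \<in> charts_at \<A> p \<Longrightarrow> coord_vec \<A> c (a c) p = a"
  by (rule tangent_eqI[OF coord_vec_tangent]) (auto simp: coord_vec_self)

lemma some_chart_charts_at: "c \<in> charts_at \<A> p \<Longrightarrow> some_chart \<A> p \<in> charts_at \<A> p"
  unfolding some_chart_def by (rule someI)

text \<open>The Jacobian that the chain rule produces is absorbed by the transformation rule of
  \<open>a\<close>. Both \<open>dir_deriv\<close> and \<open>rho\<close> can thereby be evaluated in
  any convenient chart.\<close>

lemma fd_some_chart:
  assumes c: "c \<in> charts_at \<A> p" and a: "a \<in> tangent_space \<A> p"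
    and f: "(\<lambda>x. f (chart_inv c x)) differentiable (at (snd c p))"
  shows "fd (\<lambda>x. f (chart_inv (some_chart \<A> p) x)) (snd (some_chart \<A> p) p) (a (some_chart \<A> p))
    = fd (\<lambda>x. f (chart_inv c x)) (snd c p) (a c)"
  using fd_eqI[OF has_derivative_change_chart[OF some_chart_charts_at[OF c] c fd_works[OF f]]]
    tangent_space_transform[OF a some_chart_charts_at[OF c] c] by simp

lemma dir_deriv_chart:
  assumes "c \<in> charts_at \<A> p" "a \<in> tangent_space \<A> p"
    and "(\<lambda>x. f (chart_inv c x)) differentiable (at (snd c p))"
  shows "dir_deriv \<A> p a f = fd (\<lambda>x. f (chart_inv c x)) (snd c p) (a c)"
  using fd_some_chart[of c p a f] assms by (simp add: dir_deriv_def Let_def comp_def)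

text \<open>Membership is required at every \<open>p\<close>. Where no chart is defined the tangent
  space is \<open>{0}\<close>, so fields vanish there and equality of fields is equality of
  functions. \<open>fns\<close> and \<open>der\<close> are normalised in the same way.\<close>

definition vfields :: "('m \<Rightarrow> ('m, 'e) tvec) set" where
  "vfields = {A. (\<forall>p. A p \<in> tangent_space \<A> p) \<and> (\<forall>c\<in>\<A>. smooth_on (img c) (vcomp c A c))}"

definition fns :: "('m \<Rightarrow> real) set" where
  "fns = {f. smooth_fun \<A> f \<and> (\<forall>p. charts_at \<A> p = {} \<longrightarrow> f p = 0)}"

definition der :: "('m \<Rightarrow> ('m, 'e) tvec) \<Rightarrow> ('m \<Rightarrow> real) \<Rightarrow> 'm \<Rightarrow> real" where
  "der A f p = (if charts_at \<A> p = {} then 0 else dir_deriv \<A> p (A p) f)"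

lemma vfields_tangent: "A \<in> vfields \<Longrightarrow> A p \<in> tangent_space \<A> p"
  by (simp add: vfields_def)

lemma vfields_smooth: "A \<in> vfields \<Longrightarrow> c \<in> \<A> \<Longrightarrow> smooth_on (img c) (vcomp c A c)"
  by (simp add: vfields_def)

lemma vfields_differentiable:
  "A \<in> vfields \<Longrightarrow> c \<in> charts_at \<A> p \<Longrightarrow> vcomp c A c differentiable (at (snd c p))"
  using vfields_smooth smooth_on_differentiable map_in_img charts_atD by blast

lemma subspace_vfields: "subspace vfields"
  unfolding vfields_def
  by (rule subspaceI)
    (auto intro!: tangent_space_closed smooth_on_const smooth_on_add smooth_on_scaleR open_img)

lemma fns_smooth: "f \<in> fns \<Longrightarrow> c \<in> \<A> \<Longrightarrow> smooth_on (img c) (\<lambda>x. f (chart_inv c x))"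
  by (simp add: fns_def smooth_fun_def comp_def)

lemma fns_differentiable:
  "f \<in> fns \<Longrightarrow> c \<in> charts_at \<A> p \<Longrightarrow> (\<lambda>x. f (chart_inv c x)) differentiable (at (snd c p))"
  using fns_smooth smooth_on_differentiable map_in_img charts_atD by blast

lemma subspace_fns: "subspace fns"
  unfolding fns_def smooth_fun_def
  by (rule subspaceI)
    (auto simp: comp_def simp flip: real_scaleR_def intro!: smooth_on_const smooth_on_add smooth_on_scaleR open_img)

lemma der_chart:
  assumes "c \<in> charts_at \<A> p" "A \<in> vfields" "f \<in> fns"
  shows "der A f p = fd (\<lambda>x. f (chart_inv c x)) (snd c p) (A p c)"
  using assms dir_deriv_chart[OF assms(1) vfields_tangent[OF assms(2)] fns_differentiable[OF assms(3,1)]]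
  by (auto simp: der_def)

lemma der_vcomp:
  assumes "c \<in> \<A>" "A \<in> vfields" "f \<in> fns" "x \<in> img c"
  shows "der A f (chart_inv c x) = fd (\<lambda>x. f (chart_inv c x)) x (vcomp c A c x)"
  using der_chart[OF chart_inv_charts_at[OF assms(1,4)] assms(2,3)] by (simp add: map_chart_inv assms)

lemma der_fns:
  assumes "A \<in> vfields" "f \<in> fns" shows "der A f \<in> fns"
proof -
  have "smooth_on (img c) (\<lambda>x. der A f (chart_inv c x))" if "c \<in> \<A>" for c
    by (rule smooth_on_cong[OF open_img[OF that] smooth_on_fd_field[OF open_img[OF that]
            fns_smooth[OF assms(2) that] vfields_smooth[OF assms(1) that]]])
      (simp add: der_vcomp[OF that assms])
  then show ?thesis
    by (auto simp: fns_def smooth_fun_def comp_def der_def)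
qed

lemma der_add:
  assumes "A \<in> vfields" "f \<in> fns" "h \<in> fns" shows "der A (f + h) = der A f + der A h"
proof (rule ext)
  fix p
  show "der A (f + h) p = (der A f + der A h) p"
  proof (cases "charts_at \<A> p = {}")
    case False
    then obtain c where c: "c \<in> charts_at \<A> p" by blast
    have "fd (\<lambda>x. (f + h) (chart_inv c x)) (snd c p) =
        (\<lambda>v. fd (\<lambda>x. f (chart_inv c x)) (snd c p) v + fd (\<lambda>x. h (chart_inv c x)) (snd c p) v)"
      using fd_eqI[OF has_derivative_add[OF fd_works fd_works], OF fns_differentiable fns_differentiable] c assms
      by simp
    then show ?thesis
      by (simp add: der_chart[OF c] assms subspace_add[OF subspace_fns])
  qed (simp add: der_def)
qed

section \<open>Lie brackets\<close>

lemma lie_bracket_apply: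
  "c \<in> charts_at \<A> p \<Longrightarrow> lie_bracket \<A> A B p c =
    fd (vcomp c B c) (snd c p) (A p c) - fd (vcomp c A c) (snd c p) (B p c)"
  by (simp add: lie_bracket_def)

lemma lie_bracket_vcomp:
  "c \<in> \<A> \<Longrightarrow> x \<in> img c \<Longrightarrow> vcomp c (lie_bracket \<A> A B) c x =
    fd (vcomp c B c) x (vcomp c A c x) - fd (vcomp c A c) x (vcomp c B c x)"
  by (simp add: lie_bracket_apply[OF chart_inv_charts_at] map_chart_inv)

lemma lie_bracket_off: "c \<notin> charts_at \<A> p \<Longrightarrow> lie_bracket \<A> A B p c = 0"
  by (simp add: lie_bracket_def)

text \<open>Obtained by differentiating the transformation rule of \<open>B\<close> on the overlap.
  The first summand, a second derivative of the transition map, is the defect from being a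
  tensor.\<close>

lemma fd_vcomp_transform:
  assumes cd: "c \<in> charts_at \<A> p" "d \<in> charts_at \<A> p" and B: "B \<in> vfields"
  shows "fd (vcomp d B d) (snd d p) (jac c d p v)
    = fd (\<lambda>y. fd (snd d \<circ> chart_inv c) y (B p c)) (snd c p) v + jac c d p (fd (vcomp c B c) (snd c p) v)"
proof -
  note cd' = charts_atD(1)[OF cd(1)] charts_atD(1)[OF cd(2)]
  let ?\<phi> = "snd d \<circ> chart_inv c" and ?S = "snd c ` (fst c \<inter> fst d)"
  have "fd (\<lambda>x. B (chart_inv c x) d) (snd c p) v = fd (vcomp d B d) (snd d p) (jac c d p v)"
    using fd_eqI[OF has_derivative_change_chart[OF cd, of "\<lambda>q. B q d", OF fd_works[OF vfields_differentiable[OF B cd(2)]]]]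
    by simp
  moreover have "fd (\<lambda>x. B (chart_inv c x) d) (snd c p) = fd (\<lambda>x. fd ?\<phi> x (vcomp c B c x)) (snd c p)"
  proof (rule fd_cong[OF open_overlap[OF cd'] map_in_overlap[OF cd]])
    fix y assume "y \<in> ?S"
    then obtain q where "y = snd c q" "chart_inv c y = q" "c \<in> charts_at \<A> q" "d \<in> charts_at \<A> q"
      by (rule overlapE[OF _ cd'])
    then show "B (chart_inv c y) d = fd ?\<phi> y (vcomp c B c y)"
      using tangent_space_transform[OF vfields_tangent[OF B]] by metis
  qed
  moreover have "fd (\<lambda>x. fd ?\<phi> x (vcomp c B c x)) (snd c p) v =
      fd (\<lambda>y. fd ?\<phi> y (B p c)) (snd c p) v + jac c d p (fd (vcomp c B c) (snd c p) v)"
    using fd_fd_field[OF open_overlap[OF cd'] map_in_overlap[OF cd] smooth_transition[OF cd'] vfields_differentiable[OF B cd(1)]]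
    by (simp add: chart_inv_map[OF cd(1)])
  ultimately show ?thesis by simp
qed

lemma lie_bracket_vfields:
  assumes A: "A \<in> vfields" and B: "B \<in> vfields"
  shows "lie_bracket \<A> A B \<in> vfields"
proof -
  have "smooth_on (img c) (vcomp c (lie_bracket \<A> A B) c)" if c: "c \<in> \<A>" for c
    by (rule smooth_on_cong[OF open_img[OF c] smooth_on_diff[OF open_img[OF c]
        smooth_on_fd_field[OF open_img[OF c] vfields_smooth[OF B c] vfields_smooth[OF A c]]
        smooth_on_fd_field[OF open_img[OF c] vfields_smooth[OF A c] vfields_smooth[OF B c]]]])
      (simp add: lie_bracket_vcomp[OF c])
  moreover have "lie_bracket \<A> A B p \<in> tangent_space \<A> p" for p
  proof (cases "charts_at \<A> p = {}")
    case False
    then obtain c where c: "c \<in> charts_at \<A> p" by blast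
    show ?thesis
    proof (rule tangent_spaceI[OF c])
      fix d assume d: "d \<in> charts_at \<A> p"
      note cd' = charts_atD(1)[OF c] charts_atD(1)[OF d]
      have "A p d = jac c d p (A p c)" "B p d = jac c d p (B p c)"
        using tangent_space_transform[OF vfields_tangent c d] A B by simp_all
      \<comment> \<open>The second derivatives of the transition in the directions
        \<open>A p c\<close> and \<open>B p c\<close> occur once with each sign and cancel by
        symmetry.\<close>
      then show "lie_bracket \<A> A B p d = jac c d p (lie_bracket \<A> A B p c)"
        using symmetric_second_derivative[OF open_overlap[OF cd'] map_in_overlap[OF c d] smooth_transition[OF cd'],
            of "A p c" "B p c"]
        by (simp add: lie_bracket_apply c d linear_diff[OF linear_jac[OF c d]]
            fd_vcomp_transform[OF c d A] fd_vcomp_transform[OF c d B])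
    qed (simp add: lie_bracket_off)
  next
    case True
    then have "lie_bracket \<A> A B p = 0" by (auto simp: lie_bracket_off)
    then show ?thesis by (simp add: tangent_space_closed)
  qed
  ultimately show ?thesis by (simp add: vfields_def)
qed

lemma vfields_eqI:
  assumes "A \<in> vfields" "B \<in> vfields" "\<And>p c. c \<in> charts_at \<A> p \<Longrightarrow> A p c = B p c"
  shows "A = B"
  by (intro ext) (metis assms tangent_space_off vfields_tangent)

lemma lie_bracket_antisym: "lie_bracket \<A> A B = - lie_bracket \<A> B A"
  by (intro ext) (auto simp: lie_bracket_def)

lemma lie_bracket_add_right:
  assumes "A \<in> vfields" "B \<in> vfields" "C \<in> vfields"
  shows "lie_bracket \<A> A (B + C) = lie_bracket \<A> A B + lie_bracket \<A> A C"
proof (intro ext)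
  fix p c
  show "lie_bracket \<A> A (B + C) p c = (lie_bracket \<A> A B + lie_bracket \<A> A C) p c"
  proof (cases "c \<in> charts_at \<A> p")
    case c: True
    have "fd (vcomp c (B + C) c) (snd c p) = (\<lambda>v. fd (vcomp c B c) (snd c p) v + fd (vcomp c C c) (snd c p) v)"
      using fd_eqI[OF has_derivative_add[OF fd_works[OF vfields_differentiable] fd_works[OF vfields_differentiable]]] c assms
      by simp
    moreover have "linear (fd (vcomp c A c) (snd c p))"
      using linear_frechet_derivative vfields_differentiable assms c by blast
    ultimately show ?thesis
      by (simp add: lie_bracket_apply[OF c] linear_add)
  qed (simp add: lie_bracket_off)
qed

lemma fd_vcomp_lie_bracket:
  assumes c: "c \<in> charts_at \<A> p" and B: "B \<in> vfields" and C: "C \<in> vfields"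
  shows "fd (vcomp c (lie_bracket \<A> B C) c) (snd c p) v =
     fd (\<lambda>y. fd (vcomp c C c) y (B p c)) (snd c p) v + fd (vcomp c C c) (snd c p) (fd (vcomp c B c) (snd c p) v)
     - (fd (\<lambda>y. fd (vcomp c B c) y (C p c)) (snd c p) v + fd (vcomp c B c) (snd c p) (fd (vcomp c C c) (snd c p) v))"
proof -
  note c' = charts_atD(1)[OF c]
  note S = open_img[OF c'] map_in_img[OF c]
  have "fd (vcomp c (lie_bracket \<A> B C) c) (snd c p) =
      fd (\<lambda>x. fd (vcomp c C c) x (vcomp c B c x) - fd (vcomp c B c) x (vcomp c C c x)) (snd c p)"
    by (rule fd_cong[OF S]) (simp add: lie_bracket_vcomp[OF c'])
  also have "\<dots> = (\<lambda>v. fd (\<lambda>y. fd (vcomp c C c) y (vcomp c B c (snd c p))) (snd c p) v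
        + fd (vcomp c C c) (snd c p) (fd (vcomp c B c) (snd c p) v)
      - (fd (\<lambda>y. fd (vcomp c B c) y (vcomp c C c (snd c p))) (snd c p) v
        + fd (vcomp c B c) (snd c p) (fd (vcomp c C c) (snd c p) v)))"
    by (rule fd_eqI[OF has_derivative_diff[OF
      has_derivative_fd_field[OF S vfields_smooth[OF C c'] fd_works[OF vfields_differentiable[OF B c]]]
      has_derivative_fd_field[OF S vfields_smooth[OF B c'] fd_works[OF vfields_differentiable[OF C c]]]]])
  finally show ?thesis by (simp add: chart_inv_map[OF c])
qed

text \<open>In a chart each field contributes two second derivatives with opposite signs and
  exchanged directions, which cancel by symmetry. The compositions of first derivatives cancel in
  pairs.\<close>

lemma jacobi:
  assumes A: "A \<in> vfields" and B: "B \<in> vfields" and C: "C \<in> vfields"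
  shows "lie_bracket \<A> A (lie_bracket \<A> B C) + lie_bracket \<A> B (lie_bracket \<A> C A)
    + lie_bracket \<A> C (lie_bracket \<A> A B) = 0"
proof (intro ext)
  fix p c
  show "(lie_bracket \<A> A (lie_bracket \<A> B C) + lie_bracket \<A> B (lie_bracket \<A> C A)
    + lie_bracket \<A> C (lie_bracket \<A> A B)) p c = 0 p c"
  proof (cases "c \<in> charts_at \<A> p")
    case c: True
    note c' = charts_atD(1)[OF c]
    note sym = symmetric_second_derivative[OF open_img[OF c'] map_in_img[OF c] vfields_smooth[OF _ c']]
    have lin: "linear (fd (vcomp c F c) (snd c p))" if "F \<in> vfields" for F
      using linear_frechet_derivative vfields_differentiable that c by blast
    show ?thesis
      by (simp add: lie_bracket_apply[OF c] fd_vcomp_lie_bracket[OF c] A B C linear_diff[OF lin]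
          sym[OF A, of "B p c" "C p c"] sym[OF B, of "C p c" "A p c"] sym[OF C, of "A p c" "B p c"])
  qed (simp add: lie_bracket_off)
qed

text \<open>The second derivatives of \<open>f\<close> cancel by symmetry; what is left is
  \<open>f\<close> differentiated along the components of the bracket.\<close>

lemma der_lie_bracket:
  assumes A: "A \<in> vfields" and B: "B \<in> vfields" and f: "f \<in> fns"
  shows "der (lie_bracket \<A> A B) f = der A (der B f) - der B (der A f)"
proof (rule ext)
  fix p
  show "der (lie_bracket \<A> A B) f p = (der A (der B f) - der B (der A f)) p"
  proof (cases "charts_at \<A> p = {}")
    case False
    then obtain c where c: "c \<in> charts_at \<A> p" by blast
    note c' = charts_atD(1)[OF c]
    note S = open_img[OF c'] map_in_img[OF c]
    let ?f = "\<lambda>x. f (chart_inv c x)"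
    have 2: "fd (\<lambda>x. der F f (chart_inv c x)) (snd c p) v = fd (\<lambda>y. fd ?f y (F p c)) (snd c p) v
        + fd ?f (snd c p) (fd (vcomp c F c) (snd c p) v)" if F: "F \<in> vfields" for F v
    proof -
      have "fd (\<lambda>x. der F f (chart_inv c x)) (snd c p) = fd (\<lambda>x. fd ?f x (vcomp c F c x)) (snd c p)"
        by (rule fd_cong[OF S]) (simp add: der_vcomp[OF c' F f])
      then show ?thesis
        using fd_fd_field[OF S fns_smooth[OF f c'] vfields_differentiable[OF F c]]
        by (simp add: chart_inv_map[OF c])
    qed
    show ?thesis
      using symmetric_second_derivative[OF S fns_smooth[OF f c'], of "A p c" "B p c"]
      by (simp add: der_chart[OF c] A B f lie_bracket_vfields der_fns 2 lie_bracket_apply[OF c]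
        linear_diff[OF linear_frechet_derivative[OF fns_differentiable[OF f c]]])
  qed (simp add: der_def)
qed

end


section \<open>The slit tangent bundle\<close>

lemma smooth_manifold_smooth_atlas:
  assumes "smooth_manifold M \<A>" shows "smooth_atlas \<A>"
proof
  fix c assume c: "c \<in> \<A>"
  then have hom: "homeomorphic_map (subtopology M (fst c)) (top_of_set (img c)) (snd c)"
    and opn: "openin M (fst c)" "open (img c)" using assms by (auto simp: smooth_manifold_def)
  have top: "topspace (subtopology M (fst c)) = fst c"
    using opn(1) openin_subset by auto
  show "inj_on (snd c) (fst c)"
    using homeomorphic_imp_injective_map[OF hom] top by simp
  fix d assume d: "d \<in> \<A>"
  then have "openin (subtopology M (fst c)) (fst c \<inter> fst d)"
    using assms by (auto simp: smooth_manifold_def openin_subtopology_Int2)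
  then have "openin (top_of_set (img c)) (snd c ` (fst c \<inter> fst d))"
    using hom homeomorphic_imp_open_map open_map_def by blast
  then show "open (snd c ` (fst c \<inter> fst d))"
    using opn(2) openin_open_eq by blast
  show "smooth_on (snd c ` (fst c \<inter> fst d)) (snd d \<circ> chart_inv c)"
    using assms c d by (auto simp: smooth_manifold_def)
qed

context smooth_atlas
begin

abbreviation lc :: "('m, 'e) chart \<Rightarrow> (('m, 'e) tpoint, 'e \<times> 'e) chart" where
  "lc \<equiv> lift_chart \<A>"

lemma slit_iff:
  "u \<in> slit \<A> \<longleftrightarrow> charts_at \<A> (fst u) \<noteq> {} \<and> snd u \<in> tangent_space \<A> (fst u) \<and> snd u \<noteq> 0"
  by (cases u) (force simp: slit_def tangent_bundle_def charts_at_def)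

lemma slit_tangent: "u \<in> slit \<A> \<Longrightarrow> snd u \<in> tangent_space \<A> (fst u)"
  by (simp add: slit_iff)

lemma slitE:
  assumes "u \<in> slit \<A>" obtains c where "c \<in> charts_at \<A> (fst u)"
  using assms by (auto simp: slit_iff)

lemma slit_nonzero: "u \<in> slit \<A> \<Longrightarrow> c \<in> charts_at \<A> (fst u) \<Longrightarrow> snd u c \<noteq> 0"
  using tangent_eqI[of "snd u" "fst u" 0 c] by (auto simp: slit_iff tangent_space_closed)

lemma lc_apply: "snd (lc c) u = (snd c (fst u), snd u c)"
  by (simp add: lift_chart_def)

lemma lc_dom: "u \<in> fst (lc c) \<longleftrightarrow> u \<in> slit \<A> \<and> fst u \<in> fst c"
  by (simp add: lift_chart_def)

lemma lc_inverse_slit: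
  assumes c: "c \<in> \<A>" and x: "x \<in> img c" "y \<noteq> 0"
  defines "u \<equiv> (chart_inv c x, coord_vec \<A> c y (chart_inv c x))"
  shows "u \<in> fst (lc c)" "snd (lc c) u = (x, y)"
proof -
  note cat = chart_inv_charts_at[OF c x(1)]
  show "snd (lc c) u = (x, y)"
    by (simp add: lc_apply u_def map_chart_inv x coord_vec_self[OF cat])
  have "snd u c = y" by (simp add: u_def coord_vec_self[OF cat])
  then have "snd u \<noteq> 0" using x(2) by auto
  then show "u \<in> fst (lc c)"
    using cat charts_atD[OF cat] coord_vec_tangent[OF cat] by (auto simp only: lc_dom slit_iff u_def fst_conv snd_conv)
qed

lemma inj_lc: assumes c: "c \<in> \<A>" shows "inj_on (snd (lc c)) (fst (lc c))"
proof (rule inj_onI)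
  fix u w assume u: "u \<in> fst (lc c)" and w: "w \<in> fst (lc c)" and eq: "snd (lc c) u = snd (lc c) w"
  have "fst u = fst w"
    using inj_onD[OF inj_chart[OF c]] eq u w by (simp add: lc_apply lc_dom)
  moreover from this have "snd u = snd w"
    using tangent_eqI[of "snd u" "fst u" "snd w" c] eq u w slit_tangent[of u] slit_tangent[of w] c
    by (simp add: lc_apply lc_dom charts_at_def)
  ultimately show "u = w" by (simp add: prod_eq_iff)
qed

text \<open>Exhibits the image as an open overlap of the base times the punctured model space,
  whence its openness.\<close>

lemma lc_overlap:
  assumes c: "c \<in> \<A>" and d: "d \<in> \<A>"
  shows "snd (lc c) ` (fst (lc c) \<inter> fst (lc d)) = {z. fst z \<in> snd c ` (fst c \<inter> fst d) \<and> snd z \<noteq> 0}"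
proof (intro set_eqI iffI)
  fix z assume "z \<in> snd (lc c) ` (fst (lc c) \<inter> fst (lc d))"
  then obtain u where "z = snd (lc c) u" "u \<in> slit \<A>" "fst u \<in> fst c" "fst u \<in> fst d"
    by (auto simp only: lc_dom)
  then show "z \<in> {z. fst z \<in> snd c ` (fst c \<inter> fst d) \<and> snd z \<noteq> 0}"
    using slit_nonzero charts_atI[OF c] by (simp add: lc_apply)
next
  fix z :: "'e \<times> 'e" assume "z \<in> {z. fst z \<in> snd c ` (fst c \<inter> fst d) \<and> snd z \<noteq> 0}"
  then have z: "fst z \<in> snd c ` (fst c \<inter> fst d)" "snd z \<noteq> 0" by auto
  then have x: "fst z \<in> img c" by (auto simp: img_def)
  obtain q where q: "chart_inv c (fst z) = q" "d \<in> charts_at \<A> q"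
    using overlapE[OF z(1) c d] by metis
  note u = lc_inverse_slit[OF c x z(2)]
  have "(chart_inv c (fst z), coord_vec \<A> c (snd z) (chart_inv c (fst z))) \<in> fst (lc c) \<inter> fst (lc d)"
    using u(1) q charts_atD(2) by (simp add: lc_dom)
  from imageI[OF this, of "snd (lc c)"] show "z \<in> snd (lc c) ` (fst (lc c) \<inter> fst (lc d))"
    by (simp only: u(2) prod.collapse)
qed

lemma img_lc: "c \<in> \<A> \<Longrightarrow> img (lc c) = {z. fst z \<in> img c \<and> snd z \<noteq> 0}"
  using lc_overlap[of c c] by (simp add: img_def)

lemma chart_inv_lc:
  assumes c: "c \<in> \<A>" and z: "z \<in> img (lc c)"
  shows "chart_inv (lc c) z = (chart_inv c (fst z), coord_vec \<A> c (snd z) (chart_inv c (fst z)))"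
  using inv_into_f_eq[OF inj_lc[OF c] lc_inverse_slit[OF c, of "fst z" "snd z"]] z
  by (simp add: chart_inv_def[of "lc c"] img_lc[OF c])

lemma lc_transition:
  assumes c: "c \<in> \<A>" and d: "d \<in> \<A>" and z: "z \<in> snd (lc c) ` (fst (lc c) \<inter> fst (lc d))"
  shows "(snd (lc d) \<circ> chart_inv (lc c)) z =
    ((snd d \<circ> chart_inv c) (fst z), fd (snd d \<circ> chart_inv c) (fst z) (snd z))"
proof -
  have z': "fst z \<in> snd c ` (fst c \<inter> fst d)" "z \<in> img (lc c)"
    using z unfolding lc_overlap[OF c d] img_lc[OF c] by (auto simp: img_def)
  then obtain q where q: "fst z = snd c q" "chart_inv c (fst z) = q" "c \<in> charts_at \<A> q" "d \<in> charts_at \<A> q"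
    using overlapE c d by metis
  then show ?thesis
    by (simp add: chart_inv_lc[OF c z'(2)] lc_apply coord_vec_apply)
qed

lemma open_lc_overlap:
  assumes c: "c \<in> \<A>" and d: "d \<in> \<A>"
  shows "open (snd (lc c) ` (fst (lc c) \<inter> fst (lc d)))"
proof -
  have "{z. fst z \<in> snd c ` (fst c \<inter> fst d) \<and> snd z \<noteq> (0::'e)} = (snd c ` (fst c \<inter> fst d)) \<times> (- {0})"
    by auto
  then show ?thesis
    unfolding lc_overlap[OF c d] by (auto intro!: open_Times open_overlap c d)
qed

text \<open>With \<open>\<psi>\<close> the transition of the base, the lifted one sends
  \<open>(x, y)\<close> to \<open>(\<psi> x, fd \<psi> x y)\<close>: a linear projection followed by
  a smooth map, paired with a smooth family of linear maps applied to \<open>y\<close>.\<close>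

lemma smooth_atlas_slit: "smooth_atlas (slit_atlas \<A>)"
proof
  fix c' assume "c' \<in> slit_atlas \<A>"
  then obtain c where c: "c \<in> \<A>" "c' = lc c" by (auto simp: slit_atlas_def)
  show "inj_on (snd c') (fst c')" by (simp add: c inj_lc)
  fix d' assume "d' \<in> slit_atlas \<A>"
  then obtain d where d: "d \<in> \<A>" "d' = lc d" by (auto simp: slit_atlas_def)
  let ?S = "snd (lc c) ` (fst (lc c) \<inter> fst (lc d))" and ?U = "snd c ` (fst c \<inter> fst d)"
  let ?\<psi> = "snd d \<circ> chart_inv c"
  have S: "open ?S" by (rule open_lc_overlap[OF c(1) d(1)])
  then show "open (snd c' ` (fst c' \<inter> fst d'))" by (simp add: c d)
  have fstS: "fst ` ?S \<subseteq> ?U" unfolding lc_overlap[OF c(1) d(1)] by blast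
  have \<psi>: "smooth_on ?U ?\<psi>" "open ?U" using smooth_transition open_overlap c d by auto
  have "smooth_on ?S (\<lambda>z. (?\<psi> (fst z), fd ?\<psi> (fst z) (snd z)))"
  proof (rule smooth_on_Pair[OF S])
    show "smooth_on ?S (\<lambda>z. ?\<psi> (fst z))"
      by (rule smooth_on_compose_linear[OF bounded_linear_fst \<psi>(2,1) S fstS])
    show "smooth_on ?S (\<lambda>z. fd ?\<psi> (fst z) (snd z))"
    proof (rule smooth_on_linear_family[where h = "\<lambda>z. fd ?\<psi> (fst z)", OF S])
      show "linear (fd ?\<psi> (fst x))" if "x \<in> ?S" for x
        using smooth_on_linear_fd[OF \<psi>(1)] fstS that by blast
      show "smooth_on ?S (\<lambda>z. fd ?\<psi> (fst z) v)" for v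
        by (rule smooth_on_compose_linear[OF bounded_linear_fst \<psi>(2) smooth_on_fd[OF \<psi>(1)] S fstS])
    qed (rule smooth_on_snd[OF S smooth_on_ident[OF S]])
  qed
  then show "smooth_on (snd c' ` (fst c' \<inter> fst d')) (snd d' \<circ> chart_inv c')"
    unfolding c d by (rule smooth_on_cong[OF S]) (simp only: lc_transition[OF c(1) d(1)])
qed

end

text \<open>A copy of \<open>smooth_atlas\<close>: interpreting \<open>smooth_atlas\<close> for the
  lifted atlas inside itself would generate iterated tangent bundles without end.\<close>

locale slit_bundle = smooth_atlas \<A> for \<A> :: "('m, 'e::euclidean_space) chart set"

sublocale slit_bundle \<subseteq> slit: smooth_atlas "slit_atlas \<A>"
  by (rule smooth_atlas_slit)

context slit_bundle
begin

lemma lc_charts_at: "c \<in> charts_at \<A> (fst u) \<Longrightarrow> u \<in> slit \<A> \<Longrightarrow> lc c \<in> charts_at (slit_atlas \<A>) u"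
  by (auto simp: charts_at_def slit_atlas_def lc_dom)

lemma slit_charts_atE:
  assumes "c' \<in> charts_at (slit_atlas \<A>) u"
  obtains c where "c' = lc c" "c \<in> charts_at \<A> (fst u)" "u \<in> slit \<A>"
  using assms by (auto simp: charts_at_def slit_atlas_def lc_dom)

lemma slit_charts_at_empty_iff: "charts_at (slit_atlas \<A>) u = {} \<longleftrightarrow> u \<notin> slit \<A>"
  by (metis slit_charts_atE lc_charts_at slitE empty_iff ex_in_conv)

lemma lc_in_slit_atlas: "c \<in> \<A> \<Longrightarrow> lc c \<in> slit_atlas \<A>"
  by (simp add: slit_atlas_def)

lemma img_lcD:
  assumes "c \<in> \<A>" "x \<in> img (lc c)"
  shows "chart_inv (lc c) x \<in> slit \<A>" "c \<in> charts_at \<A> (fst (chart_inv (lc c) x))"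
    "snd (lc c) (chart_inv (lc c) x) = x"
  using slit.chart_inv_charts_at[OF lc_in_slit_atlas[OF assms(1)] assms(2)] assms
  by (auto simp: charts_at_def lc_dom slit.map_chart_inv)

lemma open_img_lc: "c \<in> \<A> \<Longrightarrow> open (img (lc c))"
  by (rule slit.open_img[OF lc_in_slit_atlas])

lemma lc_inv: "c \<in> charts_at \<A> (fst u) \<Longrightarrow> u \<in> slit \<A> \<Longrightarrow> chart_inv (lc c) (snd (lc c) u) = u"
  by (rule slit.chart_inv_map[OF lc_charts_at])

lemma lc_in_img: "c \<in> charts_at \<A> (fst u) \<Longrightarrow> u \<in> slit \<A> \<Longrightarrow> snd (lc c) u \<in> img (lc c)"
  by (rule slit.map_in_img[OF lc_charts_at])

text \<open>Block triangular, with the second derivative of the base transition below the diagonal.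
  Hence the first component of a tangent vector transforms like a vector of the base, and so does
  \<open>v\<close> in a vertical vector \<open>(0, v)\<close>; this is the chart independence of
  \<open>rho\<close> and \<open>gamma\<close>.\<close>

lemma jac_lc:
  assumes c: "c \<in> charts_at \<A> (fst u)" and d: "d \<in> charts_at \<A> (fst u)" and u: "u \<in> slit \<A>"
  shows "slit.jac (lc c) (lc d) u k = (jac c d (fst u) (fst k),
    fd (\<lambda>y. fd (snd d \<circ> chart_inv c) y (snd u c)) (snd c (fst u)) (fst k) + jac c d (fst u) (snd k))"
proof -
  note cd = charts_atD(1)[OF c] charts_atD(1)[OF d]
  let ?\<psi> = "snd d \<circ> chart_inv c" and ?U = "snd c ` (fst c \<inter> fst d)" and ?S = "snd (lc c) ` (fst (lc c) \<inter> fst (lc d))"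
  let ?x = "snd c (fst u)" and ?y = "snd u c"
  have S: "open ?S" "snd (lc c) u \<in> ?S"
    using open_lc_overlap[OF cd] c d u by (auto simp: lc_dom charts_at_def)
  have U: "open ?U" "?x \<in> ?U" by (rule open_overlap[OF cd], rule map_in_overlap[OF c d])
  note \<psi> = smooth_transition[OF cd]
  have fstS: "fst z \<in> ?U" if "z \<in> ?S" for z using that unfolding lc_overlap[OF cd] by blast
  have 1: "((\<lambda>z. ?\<psi> (fst z)) has_derivative (\<lambda>k. jac c d (fst u) (fst k))) (at (?x, ?y))"
    using has_derivative_compose[OF has_derivative_fst[OF has_derivative_ident], of ?\<psi> _ "(?x, ?y)" UNIV]
      smooth_on_has_derivative[OF \<psi> U(2)] by simp
  have "((\<lambda>z. fd ?\<psi> (fst z) v) has_derivative (\<lambda>k. fd (\<lambda>y. fd ?\<psi> y v) ?x (fst k))) (at (?x, ?y))" for v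
    using has_derivative_compose[OF has_derivative_fst[OF has_derivative_ident], of "\<lambda>y. fd ?\<psi> y v" _ "(?x, ?y)" UNIV]
      smooth_on_has_derivative[OF smooth_on_fd[OF \<psi>] U(2)] by simp
  then have 2: "((\<lambda>z. fd ?\<psi> (fst z) (snd z)) has_derivative
      (\<lambda>k. fd (\<lambda>y. fd ?\<psi> y (snd (?x, ?y))) ?x (fst k) + fd ?\<psi> (fst (?x, ?y)) (snd k))) (at (?x, ?y))"
    by (intro has_derivative_linear_family[where h = "\<lambda>z. fd ?\<psi> (fst z)" and h' = "\<lambda>v k. fd (\<lambda>y. fd ?\<psi> y v) ?x (fst k)"])
      (use S smooth_on_linear_fd[OF \<psi> fstS] in \<open>auto simp: lc_apply intro!: derivative_eq_intros\<close>)
  have 3: "((snd (lc d) \<circ> chart_inv (lc c)) has_derivative (\<lambda>k. (jac c d (fst u) (fst k),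
    fd (\<lambda>y. fd ?\<psi> y ?y) ?x (fst k) + jac c d (fst u) (snd k)))) (at (snd (lc c) u))"
  proof (rule has_derivative_transform_within_open[OF _ S])
    show "((\<lambda>z. (?\<psi> (fst z), fd ?\<psi> (fst z) (snd z))) has_derivative (\<lambda>k. (jac c d (fst u) (fst k),
      fd (\<lambda>y. fd ?\<psi> y ?y) ?x (fst k) + jac c d (fst u) (snd k)))) (at (snd (lc c) u))"
      unfolding lc_apply using has_derivative_Pair[OF 1 2] by simp
  qed (simp only: lc_transition[OF cd])
  show ?thesis using fd_eqI[OF 3] by simp
qed

section \<open>The maps \<open>rho\<close> and \<open>gamma\<close> in lifted charts\<close>

lemma rho_apply:
  assumes "a \<in> tspace2 \<A> u" "u \<in> slit \<A>" "c \<in> charts_at \<A> (fst u)"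
  shows "rho \<A> u a c = fst (a (lc c))"
proof -
  have 1: "((\<lambda>x. snd c (fst (chart_inv (lc c) x))) has_derivative fst) (at (snd (lc c) u))"
  proof (rule has_derivative_transform_within_open[OF has_derivative_fst[OF has_derivative_ident]])
    show "open (img (lc c))" "snd (lc c) u \<in> img (lc c)"
      using open_img_lc lc_in_img assms charts_atD by auto
    show "fst x = snd c (fst (chart_inv (lc c) x))" if "x \<in> img (lc c)" for x
      using img_lcD(3)[of c x] that assms(3) by (metis charts_atD(1) fst_conv lc_apply)
  qed
  have "rho \<A> u a c = fd (\<lambda>x. snd c (fst (chart_inv (lc c) x))) (snd (lc c) u) (a (lc c))"
    using slit.fd_some_chart[OF lc_charts_at[OF assms(3,2)] assms(1), of "\<lambda>w. snd c (fst w)"]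
      1 assms(3)
    by (auto simp: rho_def differential_def Let_def comp_def differentiable_def)
  then show ?thesis by (simp add: fd_eqI[OF 1])
qed

lemma rho_off: "c \<notin> charts_at \<A> (fst u) \<Longrightarrow> rho \<A> u a c = 0"
  by (simp add: rho_def differential_def)

lemma rho_tangent:
  assumes a: "a \<in> tspace2 \<A> u" and u: "u \<in> slit \<A>"
  shows "rho \<A> u a \<in> tangent_space \<A> (fst u)"
proof -
  obtain c where c: "c \<in> charts_at \<A> (fst u)" using u by (rule slitE)
  show ?thesis
  proof (rule tangent_spaceI[OF c])
    fix d assume d: "d \<in> charts_at \<A> (fst u)"
    have "a (lc d) = slit.jac (lc c) (lc d) u (a (lc c))"
      using slit.tangent_space_transform[OF a] lc_charts_at c d u by metis
    then show "rho \<A> u a d = jac c d (fst u) (rho \<A> u a c)"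
      by (simp add: rho_apply a u c d jac_lc)
  qed (simp add: rho_off)
qed

lemma gamma_apply:
  assumes "c \<in> charts_at \<A> (fst u)" "u \<in> slit \<A>"
  shows "gamma \<A> u v (lc c) = (0, v c)"
proof -
  have "((\<lambda>t. (snd c (fst u), snd u c + t *\<^sub>R v c)) has_vector_derivative (0, v c)) (at 0)"
    by (auto intro!: derivative_eq_intros)
  then have "vector_derivative (\<lambda>t. (snd c (fst u), snd u c + t *\<^sub>R v c)) (at 0) = (0, v c)"
    by (rule vector_derivative_at)
  then show ?thesis
    using lc_charts_at[OF assms] by (simp add: gamma_def velocity_def comp_def lc_apply)
qed

lemma gamma_off: "c \<notin> charts_at (slit_atlas \<A>) u \<Longrightarrow> gamma \<A> u v c = 0"
  by (simp add: gamma_def velocity_def)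

lemma gamma_tangent:
  assumes v: "v \<in> tangent_space \<A> (fst u)" and u: "u \<in> slit \<A>"
  shows "gamma \<A> u v \<in> tspace2 \<A> u"
proof -
  obtain c where c: "c \<in> charts_at \<A> (fst u)" using u by (rule slitE)
  show ?thesis
  proof (rule slit.tangent_spaceI[OF lc_charts_at[OF c u]])
    fix d' assume "d' \<in> charts_at (slit_atlas \<A>) u"
    then obtain d where d: "d' = lc d" "d \<in> charts_at \<A> (fst u)" by (rule slit_charts_atE)
    have "linear (fd (\<lambda>y. fd (snd d \<circ> chart_inv c) y (snd u c)) (snd c (fst u)))"
      using smooth_on_linear_fd[OF smooth_on_fd[OF smooth_transition] map_in_overlap] c d charts_atD by blast
    from linear_0[OF this] show "gamma \<A> u v d' = slit.jac (lc c) d' u (gamma \<A> u v (lc c))"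
      using tangent_space_transform[OF v c d(2)] linear_0[OF linear_jac[OF c d(2)]]
      by (simp add: d gamma_apply c u jac_lc[OF c d(2) u])
  qed (simp add: gamma_off)
qed

lemma gamma_zero:
  assumes "u \<notin> slit \<A>" shows "gamma \<A> u v = 0"
proof (rule ext)
  fix c show "gamma \<A> u v c = 0 c"
    using slit_charts_at_empty_iff[of u] assms by (simp add: gamma_off)
qed

lemma tspace2_off:
  assumes "a \<in> tspace2 \<A> u" "u \<notin> slit \<A>" shows "a = 0"
proof (rule ext)
  fix c show "a c = 0 c"
    using slit.tangent_space_off[OF assms(1), of c] slit_charts_at_empty_iff[of u] assms(2) by simp
qed

lemma rho_gamma:
  assumes "v \<in> tangent_space \<A> (fst u)" "u \<in> slit \<A>" shows "rho \<A> u (gamma \<A> u v) = 0"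
proof (rule ext)
  fix c show "rho \<A> u (gamma \<A> u v) c = 0 c"
    by (cases "c \<in> charts_at \<A> (fst u)")
      (simp_all add: rho_off rho_apply[OF gamma_tangent[OF assms] assms(2)] gamma_apply assms)
qed

lemma rho_add:
  assumes "a \<in> tspace2 \<A> u" "b \<in> tspace2 \<A> u" "u \<in> slit \<A>"
  shows "rho \<A> u (a + b) = rho \<A> u a + rho \<A> u b"
proof (rule ext)
  fix c show "rho \<A> u (a + b) c = (rho \<A> u a + rho \<A> u b) c"
    by (cases "c \<in> charts_at \<A> (fst u)")
      (simp_all add: rho_off rho_apply slit.tangent_space_closed(1) assms)
qed

lemma rho_diff:
  assumes "a \<in> tspace2 \<A> u" "b \<in> tspace2 \<A> u" "u \<in> slit \<A>"
  shows "rho \<A> u (a - b) = rho \<A> u a - rho \<A> u b"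
proof (rule ext)
  fix c show "rho \<A> u (a - b) c = (rho \<A> u a - rho \<A> u b) c"
    by (cases "c \<in> charts_at \<A> (fst u)")
      (simp_all add: rho_off rho_apply slit.tangent_space_closed(2) assms)
qed

lemma gamma_add: "gamma \<A> u (v + w) = gamma \<A> u v + gamma \<A> u w"
proof (rule ext)
  fix c'
  show "gamma \<A> u (v + w) c' = (gamma \<A> u v + gamma \<A> u w) c'"
  proof (cases "c' \<in> charts_at (slit_atlas \<A>) u")
    case True
    then show ?thesis by (auto elim!: slit_charts_atE simp: gamma_apply)
  qed (simp add: gamma_off)
qed

text \<open>Sections of the pullback bundle, normalised to vanish off the slit tangent bundle, so that
  equality of sections is equality of functions.\<close>

definition secs :: "('m, 'e) pi_section set" where
  "secs = {X. pi_field \<A> X \<and> (\<forall>u. u \<notin> slit \<A> \<longrightarrow> X u = 0)}"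

text \<open>Passes from the operators of the theorem, whose values off the slit tangent bundle are
  arbitrary, to normalised ones. It is polymorphic, so that it covers sections, vector fields and
  functions alike.\<close>

definition res :: "(('m, 'e) tpoint \<Rightarrow> 'b::zero) \<Rightarrow> ('m, 'e) tpoint \<Rightarrow> 'b" where
  "res F u = (if u \<in> slit \<A> then F u else 0)"

lemma res_on [simp]: "u \<in> slit \<A> \<Longrightarrow> res F u = F u"
  by (simp add: res_def)

lemma res_off [simp]: "u \<notin> slit \<A> \<Longrightarrow> res F u = 0"
  by (simp add: res_def)

lemma pi_field_tangent: "pi_field \<A> X \<Longrightarrow> u \<in> slit \<A> \<Longrightarrow> X u \<in> tangent_space \<A> (fst u)"
  by (simp add: pi_field_def)

lemma pi_field_smooth: "pi_field \<A> X \<Longrightarrow> c \<in> \<A> \<Longrightarrow> smooth_on (img (lc c)) (vcomp (lc c) X c)"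
  by (simp add: pi_field_def)

lemma pi_field_cong:
  assumes X: "pi_field \<A> X" and eq: "\<And>u. u \<in> slit \<A> \<Longrightarrow> X u = Y u"
  shows "pi_field \<A> Y"
proof -
  have "smooth_on (img (lc c)) (vcomp (lc c) Y c)" if c: "c \<in> \<A>" for c
    by (rule smooth_on_cong[OF open_img_lc[OF c] pi_field_smooth[OF X c]]) (simp add: eq img_lcD[OF c])
  then show ?thesis
    using X eq by (simp add: pi_field_def)
qed

lemma pi_field_res: "pi_field \<A> X \<Longrightarrow> pi_field \<A> (res X)"
  by (erule pi_field_cong) simp

lemma res_secs: "pi_field \<A> X \<Longrightarrow> res X \<in> secs"
  by (simp add: secs_def pi_field_res)

lemma secs_pi_field: "X \<in> secs \<Longrightarrow> pi_field \<A> X"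
  by (simp add: secs_def)

lemma res_secs_eq: "X \<in> secs \<Longrightarrow> res X = X"
  by (auto simp: secs_def res_def fun_eq_iff)

lemma res_vfields_eq:
  assumes "A \<in> slit.vfields" shows "res A = A"
proof (rule ext)
  fix u show "res A u = A u"
    using tspace2_off[OF slit.vfields_tangent[OF assms], of u] by (cases "u \<in> slit \<A>") simp_all
qed

lemma secs_eqI:
  assumes "X \<in> secs" "Y \<in> secs" "\<And>u. u \<in> slit \<A> \<Longrightarrow> X u = Y u" shows "X = Y"
  using assms by (metis ext res_on res_off res_secs_eq)

lemma pi_field_differentiable:
  "pi_field \<A> X \<Longrightarrow> c \<in> charts_at \<A> (fst u) \<Longrightarrow> u \<in> slit \<A> \<Longrightarrow>
    vcomp (lc c) X c differentiable (at (snd (lc c) u))"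
  using smooth_on_differentiable[OF pi_field_smooth lc_in_img] charts_atD by blast

lemma subspace_secs: "subspace secs"
  unfolding secs_def pi_field_def
  by (rule subspaceI)
    (auto intro!: tangent_space_closed smooth_on_const smooth_on_add smooth_on_scaleR open_img_lc)

lemma eta_pi_field: "pi_field \<A> eta"
proof -
  have "smooth_on (img (lc c)) (vcomp (lc c) eta c)" if c: "c \<in> \<A>" for c
  proof (rule smooth_on_cong[OF open_img_lc[OF c] smooth_on_snd[OF open_img_lc[OF c] smooth_on_ident[OF open_img_lc[OF c]]]])
    show "snd x = vcomp (lc c) eta c x" if "x \<in> img (lc c)" for x
      using img_lcD(3)[OF c that] by (metis eta_def lc_apply snd_conv)
  qed
  then show ?thesis by (simp add: pi_field_def eta_def slit_tangent)
qed

lemma pi_fieldI_tangent_comp: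
  assumes "\<And>u. u \<in> slit \<A> \<Longrightarrow> X u \<in> tangent_space \<A> (fst u)"
    and "\<And>c. c \<in> \<A> \<Longrightarrow> smooth_on (img (lc c)) (F c)"
    and "\<And>c x. c \<in> \<A> \<Longrightarrow> x \<in> img (lc c) \<Longrightarrow> X (chart_inv (lc c) x) c = F c x"
  shows "pi_field \<A> X"
  unfolding pi_field_def using assms smooth_on_cong[OF open_img_lc assms(2)] by auto

lemma slit_vfieldsI:
  assumes "\<And>u. u \<in> slit \<A> \<Longrightarrow> A u \<in> tspace2 \<A> u" "\<And>u. u \<notin> slit \<A> \<Longrightarrow> A u = 0"
    and "\<And>c. c \<in> \<A> \<Longrightarrow> smooth_on (img (lc c)) (F c)"
    and "\<And>c x. c \<in> \<A> \<Longrightarrow> x \<in> img (lc c) \<Longrightarrow> A (chart_inv (lc c) x) (lc c) = F c x"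
  shows "A \<in> slit.vfields"
proof -
  have "A u \<in> tspace2 \<A> u" for u
    using assms(1)[of u] assms(2)[of u] slit.tangent_space_closed(5)[of u] by fastforce
  moreover have "smooth_on (img c') (vcomp c' A c')" if c': "c' \<in> slit_atlas \<A>" for c'
  proof -
    obtain c where c: "c' = lc c" "c \<in> \<A>" using c' by (auto simp: slit_atlas_def)
    show ?thesis
      unfolding c(1) by (rule smooth_on_cong[OF open_img_lc[OF c(2)] assms(3)[OF c(2)]]) (simp add: assms(4) c)
  qed
  ultimately show ?thesis by (simp add: slit.vfields_def)
qed

lemma vfields_lc_smooth: "A \<in> slit.vfields \<Longrightarrow> c \<in> \<A> \<Longrightarrow> smooth_on (img (lc c)) (vcomp (lc c) A (lc c))"
  by (rule slit.vfields_smooth[OF _ lc_in_slit_atlas])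

lemma rho_field_pi_field:
  assumes A: "A \<in> slit.vfields" shows "pi_field \<A> (rho_field \<A> A)"
  by (rule pi_fieldI_tangent_comp[where F = "\<lambda>c x. fst (vcomp (lc c) A (lc c) x)"])
    (auto simp: rho_field_def rho_tangent rho_apply slit.vfields_tangent[OF A] img_lcD
      intro!: smooth_on_fst open_img_lc vfields_lc_smooth[OF A])

lemma gamma_field_vfields:
  assumes X: "pi_field \<A> X" shows "gamma_field \<A> X \<in> slit.vfields"
  by (rule slit_vfieldsI[where F = "\<lambda>c x. (0, vcomp (lc c) X c x)"])
    (auto simp: gamma_field_def gamma_tangent gamma_zero gamma_apply pi_field_tangent[OF X] img_lcD
      intro!: smooth_on_Pair smooth_on_const open_img_lc pi_field_smooth[OF X])

lemma gamma_field_apply: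
  "c \<in> charts_at \<A> (fst u) \<Longrightarrow> u \<in> slit \<A> \<Longrightarrow> gamma_field \<A> X u (lc c) = (0, X u c)"
  by (simp add: gamma_field_def gamma_apply)

text \<open>Not chart invariant.\<close>

definition fibre_deriv :: "('m, 'e) chart \<Rightarrow> ('m, 'e) pi_section \<Rightarrow> ('m, 'e) pi_section \<Rightarrow> ('m, 'e) tpoint \<Rightarrow> 'e" where
  "fibre_deriv c X Y u = fd (vcomp (lc c) Y c) (snd (lc c) u) (0, X u c)"

lemma gamma_field_vcomp:
  assumes c: "c \<in> charts_at \<A> (fst u)" and u: "u \<in> slit \<A>" and X: "pi_field \<A> X"
  shows "(vcomp (lc c) (gamma_field \<A> X) (lc c) has_derivative
    (\<lambda>k. (0, fd (vcomp (lc c) X c) (snd (lc c) u) k))) (at (snd (lc c) u))"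
proof (rule has_derivative_transform_within_open[OF has_derivative_Pair[OF has_derivative_const
      fd_works[OF pi_field_differentiable[OF X c u]]]])
  note c' = charts_atD(1)[OF c]
  show "open (img (lc c))" "snd (lc c) u \<in> img (lc c)" by (rule open_img_lc[OF c'], rule lc_in_img[OF c u])
  show "(0, vcomp (lc c) X c x) = vcomp (lc c) (gamma_field \<A> X) (lc c) x" if "x \<in> img (lc c)" for x
    using img_lcD[OF c' that] by (simp add: gamma_field_apply)
qed

text \<open>The first component of a vertical lift is constantly \<open>0\<close>, so
  differentiating it contributes nothing. For a horizontal lift \<open>B\<close> this means that its
  vertical component, which carries the connection, does not enter.\<close>

lemma lie_bracket_gamma_apply:
  assumes c: "c \<in> charts_at \<A> (fst u)" and u: "u \<in> slit \<A>" and X: "pi_field \<A> X"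
    and B: "vcomp (lc c) B (lc c) differentiable (at (snd (lc c) u))"
    and Y: "\<And>w. w \<in> slit \<A> \<Longrightarrow> c \<in> charts_at \<A> (fst w) \<Longrightarrow> fst (B w (lc c)) = Y w c"
  shows "fst (lie_bracket (slit_atlas \<A>) (gamma_field \<A> X) B u (lc c)) = fibre_deriv c X Y u"
proof -
  note c' = charts_atD(1)[OF c]
  have "fd (\<lambda>x. fst (vcomp (lc c) B (lc c) x)) (snd (lc c) u) = fd (vcomp (lc c) Y c) (snd (lc c) u)"
    by (rule fd_cong[OF open_img_lc[OF c'] lc_in_img[OF c u]]) (simp add: Y img_lcD[OF c'])
  moreover have "fd (\<lambda>x. fst (vcomp (lc c) B (lc c) x)) (snd (lc c) u) = (\<lambda>k. fst (fd (vcomp (lc c) B (lc c)) (snd (lc c) u) k))"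
    by (rule fd_eqI[OF has_derivative_fst[OF fd_works[OF B]]])
  ultimately show ?thesis
    by (simp add: slit.lie_bracket_apply[OF lc_charts_at[OF c u]] fd_eqI[OF gamma_field_vcomp[OF c u X]]
      gamma_field_apply c u fibre_deriv_def fun_eq_iff)
qed

lemma lie_bracket_gamma_gamma_apply:
  assumes c: "c \<in> charts_at \<A> (fst u)" and u: "u \<in> slit \<A>" and X: "pi_field \<A> X" and Y: "pi_field \<A> Y"
  shows "lie_bracket (slit_atlas \<A>) (gamma_field \<A> X) (gamma_field \<A> Y) u (lc c) =
    (0, fibre_deriv c X Y u - fibre_deriv c Y X u)"
  by (simp add: slit.lie_bracket_apply[OF lc_charts_at[OF c u]] fd_eqI[OF gamma_field_vcomp[OF c u X]]
      fd_eqI[OF gamma_field_vcomp[OF c u Y]] gamma_field_apply c u fibre_deriv_def)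

end


section \<open>The Finsler metric and its fibre derivative\<close>

lemma has_derivative_bilinear_family:
  fixes G :: "'a::real_normed_vector \<Rightarrow> 'b::euclidean_space \<Rightarrow> 'c::euclidean_space \<Rightarrow> 'd::real_normed_vector"
  assumes S: "open S" "x \<in> S"
    and lin: "\<And>x w. x \<in> S \<Longrightarrow> linear (\<lambda>v. G x v w)" "\<And>x v. x \<in> S \<Longrightarrow> linear (G x v)"
    and G: "\<And>v w. ((\<lambda>x. G x v w) has_derivative G' v w) (at x)"
    and Y: "(Y has_derivative Y') (at x)" and Z: "(Z has_derivative Z') (at x)"
  shows "((\<lambda>x. G x (Y x) (Z x)) has_derivative
    (\<lambda>k. G' (Y x) (Z x) k + G x (Y x) (Z' k) + G x (Y' k) (Z x))) (at x)"
proof (rule has_derivative_linear_family[where h = "\<lambda>x v. G x v (Z x)" and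
      h' = "\<lambda>v k. G' v (Z x) k + G x v (Z' k)", OF S lin(1) _ Y])
  show "((\<lambda>x. G x v (Z x)) has_derivative (\<lambda>k. G' v (Z x) k + G x v (Z' k))) (at x)" for v
    by (rule has_derivative_linear_family[where h = "\<lambda>x. G x v", OF S lin(2) G Z])
qed

lemma has_real_derivative_line:
  fixes F :: "'a::real_normed_vector \<Rightarrow> real"
  assumes "F differentiable (at z)"
  shows "((\<lambda>t. F (z + t *\<^sub>R k)) has_real_derivative fd F z k) (at 0)"
proof -
  have "((\<lambda>t. F (z + t *\<^sub>R k)) has_derivative (\<lambda>t. fd F z (t *\<^sub>R k))) (at 0)"
    by (rule has_derivative_compose[of "\<lambda>t. z + t *\<^sub>R k" _ _ _ F])
      (auto intro!: derivative_eq_intros fd_works assms)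
  then show ?thesis
    unfolding has_field_derivative_def
    by (simp add: linear_scale[OF linear_frechet_derivative[OF assms]] mult_commute_abs)
qed

lemma deriv_cong_open:
  assumes "open S" "x \<in> S" "\<And>y. y \<in> S \<Longrightarrow> f y = g y"
  shows "deriv f x = deriv g x"
  using assms by (intro deriv_cong_ev eventually_nhds[THEN iffD2]) auto

locale finsler = slit_bundle \<A> for \<A> :: "('m, 'e::euclidean_space) chart set" +
  fixes M :: "'m topology" and L :: "('m, 'e) tpoint \<Rightarrow> real"
  assumes finsler: "finsler_manifold M \<A> L"
begin

definition energy :: "('m, 'e) chart \<Rightarrow> 'e \<times> 'e \<Rightarrow> real" where
  "energy c z = (1/2) * (L (chart_inv (lc c) z))\<^sup>2"

abbreviation g :: "('m, 'e) tpoint \<Rightarrow> ('m, 'e) tvec \<Rightarrow> ('m, 'e) tvec \<Rightarrow> real" where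
  "g \<equiv> finsler_metric L"

text \<open>Differentiated along \<open>w\<close> first and along \<open>v\<close> second, which is
  the nesting of \<open>deriv\<close> in \<open>finsler_metric\<close>.\<close>

definition hess :: "('m, 'e) chart \<Rightarrow> 'e \<times> 'e \<Rightarrow> 'e \<Rightarrow> 'e \<Rightarrow> real" where
  "hess c z v w = fd (\<lambda>z. fd (energy c) z (0, w)) z (0, v)"

text \<open>The third fibre derivative of the energy, which is twice the classical Cartan
  tensor.\<close>

definition cartan_tensor :: "('m, 'e) chart \<Rightarrow> 'e \<times> 'e \<Rightarrow> 'e \<Rightarrow> 'e \<Rightarrow> 'e \<Rightarrow> real" where
  "cartan_tensor c z a v w = fd (\<lambda>z. hess c z v w) z (0, a)"

lemma smooth_energy:
  assumes c: "c \<in> \<A>" shows "smooth_on (img (lc c)) (energy c)"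
proof -
  have "smooth_on (img (lc c)) (\<lambda>z. L (chart_inv (lc c) z))"
    using finsler c by (auto simp: finsler_manifold_def smooth_fun_def slit_atlas_def comp_def)
  then show ?thesis
    unfolding energy_def power2_eq_square
    by (intro smooth_on_bounded_bilinear[OF bounded_bilinear_mult] open_img_lc[OF c] smooth_on_const)
qed

lemma chart_inv_lc_fibre:
  assumes c: "c \<in> charts_at \<A> (fst u)" and v: "v \<in> tangent_space \<A> (fst u)" "v c \<noteq> 0"
  shows "(fst u, v) \<in> slit \<A>" "chart_inv (lc c) (snd c (fst u), v c) = (fst u, v)"
proof -
  show s: "(fst u, v) \<in> slit \<A>" using c v by (auto simp: slit_iff simp del: split_paired_Ex)
  show "chart_inv (lc c) (snd c (fst u), v c) = (fst u, v)"
    using lc_inv[of c "(fst u, v)"] s c by (simp add: lc_apply)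
qed

text \<open>The line through \<open>snd u\<close> may hit the zero vector, where no lifted chart is
  defined. The iterated \<open>deriv\<close> and the derivative in the chart are therefore compared
  on the open set of parameters with nonzero vector only.\<close>

lemma metric_apply:
  assumes c: "c \<in> charts_at \<A> (fst u)" and u: "u \<in> slit \<A>"
    and v: "v \<in> tangent_space \<A> (fst u)" and w: "w \<in> tangent_space \<A> (fst u)"
  shows "g u v w = hess c (snd (lc c) u) (v c) (w c)"
proof -
  note c' = charts_atD(1)[OF c]
  note E = smooth_energy[OF c']
  let ?y = "snd u c" and ?z = "snd (lc c) u"
  have img: "(snd c (fst u), y) \<in> img (lc c) \<longleftrightarrow> y \<noteq> 0" for y
    by (simp add: img_lc[OF c'] map_in_img[OF c])
  have en: "(1/2) * (L (fst u, snd u + s *\<^sub>R v + t *\<^sub>R w))\<^sup>2 = energy c (?z + s *\<^sub>R (0, v c) + t *\<^sub>R (0, w c))"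
    if "?y + s *\<^sub>R v c + t *\<^sub>R w c \<noteq> 0" for s t
    using chart_inv_lc_fibre(2)[OF c, of "snd u + s *\<^sub>R v + t *\<^sub>R w"] that
    by (simp add: energy_def lc_apply tangent_space_closed slit_tangent u v w)
  have inner: "deriv (\<lambda>t. (1/2) * (L (fst u, snd u + s *\<^sub>R v + t *\<^sub>R w))\<^sup>2) 0 = fd (energy c) (?z + s *\<^sub>R (0, v c)) (0, w c)"
    if "?y + s *\<^sub>R v c \<noteq> 0" for s
  proof -
    have "deriv (\<lambda>t. (1/2) * (L (fst u, snd u + s *\<^sub>R v + t *\<^sub>R w))\<^sup>2) 0 =
        deriv (\<lambda>t. energy c (?z + s *\<^sub>R (0, v c) + t *\<^sub>R (0, w c))) 0"
    proof (rule deriv_cong_open[OF _ _ en])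
      show "open {t. ?y + s *\<^sub>R v c + t *\<^sub>R w c \<noteq> 0}"
        by (intro open_Collect_neq continuous_intros)
    qed (use that in auto)
    also have "\<dots> = fd (energy c) (?z + s *\<^sub>R (0, v c)) (0, w c)"
      by (rule DERIV_imp_deriv[OF has_real_derivative_line[OF smooth_on_differentiable[OF E]]])
        (use that img in \<open>simp add: lc_apply\<close>)
    finally show ?thesis .
  qed
  have "g u v w = deriv (\<lambda>s. fd (energy c) (?z + s *\<^sub>R (0, v c)) (0, w c)) 0"
    unfolding finsler_metric_def
  proof (rule deriv_cong_open[OF _ _ inner])
    show "open {s. ?y + s *\<^sub>R v c \<noteq> 0}"
      by (intro open_Collect_neq continuous_intros)
  qed (use slit_nonzero[OF u c] in auto)
  also have "\<dots> = hess c ?z (v c) (w c)"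
    unfolding hess_def
    by (rule DERIV_imp_deriv[OF has_real_derivative_line[OF smooth_on_differentiable[OF smooth_on_fd[OF E]]]])
      (rule lc_in_img[OF c u])
  finally show ?thesis .
qed

lemma hess_sym: "c \<in> \<A> \<Longrightarrow> z \<in> img (lc c) \<Longrightarrow> hess c z v w = hess c z w v"
  unfolding hess_def using symmetric_second_derivative[OF open_img_lc _ smooth_energy] by blast

lemma linear_hess_left:
  assumes "c \<in> \<A>" "z \<in> img (lc c)" shows "linear (\<lambda>v. hess c z v w)"
proof -
  have l: "linear (fd (\<lambda>z. fd (energy c) z (0, w)) z)"
    by (rule smooth_on_linear_fd[OF smooth_on_fd[OF smooth_energy] assms(2)]) fact
  have "linear (\<lambda>v::'e. (0::'e, v))"
    by (intro linearI) auto
  from linear_compose[OF this l] show ?thesis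
    by (simp add: hess_def comp_def)
qed

lemma linear_hess_right:
  assumes "c \<in> \<A>" "z \<in> img (lc c)" shows "linear (hess c z v)"
  using linear_hess_left[OF assms, of v] hess_sym[OF assms] by (metis (no_types, lifting) ext)

lemma smooth_hess: "c \<in> \<A> \<Longrightarrow> smooth_on (img (lc c)) (\<lambda>z. hess c z v w)"
  unfolding hess_def by (intro smooth_on_fd smooth_energy)

text \<open>Symmetry of second derivatives for the smooth function
  \<open>\<lambda>z. fd (energy c) z (0, w)\<close>.\<close>

lemma cartan_tensor_sym12: "c \<in> \<A> \<Longrightarrow> z \<in> img (lc c) \<Longrightarrow> cartan_tensor c z a v w = cartan_tensor c z v a w"
  unfolding cartan_tensor_def hess_def
  using symmetric_second_derivative[OF open_img_lc _ smooth_on_fd[OF smooth_energy]] by blast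

section \<open>Euler relations for the homogeneous energy\<close>

lemma energy_homogeneous:
  assumes c: "c \<in> \<A>" and z: "z \<in> img (lc c)" and r: "r > 0"
  shows "energy c (fst z, r *\<^sub>R snd z) = r\<^sup>2 * energy c z"
proof -
  let ?u = "chart_inv (lc c) z"
  note u = img_lcD[OF c z]
  have y: "z = (snd c (fst ?u), snd ?u c)" using u(3) by (simp add: lc_apply)
  have "chart_inv (lc c) (fst z, r *\<^sub>R snd z) = (fst ?u, r *\<^sub>R snd ?u)"
    using chart_inv_lc_fibre(2)[OF u(2), of "r *\<^sub>R snd ?u"] slit_nonzero[OF u(1,2)] r
    by (subst y, subst y) (simp add: tangent_space_closed slit_tangent[OF u(1)])
  moreover have "L (fst ?u, r *\<^sub>R snd ?u) = r * L ?u"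
    using finsler u(1) r by (auto simp: finsler_manifold_def slit_def)
  ultimately show ?thesis by (simp add: energy_def power_mult_distrib)
qed

lemma energy_euler:
  assumes c: "c \<in> \<A>" and z: "z \<in> img (lc c)"
  shows "fd (energy c) z (0, snd z) = 2 * energy c z"
proof -
  have "deriv (\<lambda>t. energy c (z + t *\<^sub>R (0, snd z))) 0 = deriv (\<lambda>t. (1 + t)\<^sup>2 * energy c z) 0"
  \<comment> \<open>For \<open>t > -1\<close> the factor \<open>1 + t\<close> is positive, as
    positive homogeneity requires.\<close>
  proof (rule deriv_cong_open[of "{-1<..}"])
    fix t :: real assume "t \<in> {-1<..}"
    then show "energy c (z + t *\<^sub>R (0, snd z)) = (1 + t)\<^sup>2 * energy c z"
      using energy_homogeneous[OF c z, of "1 + t"]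
      by (cases z) (simp add: scaleR_add_left)
  qed auto
  moreover have "deriv (\<lambda>t. energy c (z + t *\<^sub>R (0, snd z))) 0 = fd (energy c) z (0, snd z)"
    by (rule DERIV_imp_deriv[OF has_real_derivative_line[OF smooth_on_differentiable[OF smooth_energy[OF c] z]]])
  moreover have "deriv (\<lambda>t. (1 + t)\<^sup>2 * energy c z) 0 = 2 * energy c z"
    by (rule DERIV_imp_deriv) (auto intro!: derivative_eq_intros)
  ultimately show ?thesis by simp
qed

lemma smooth_on_vertical: "open S \<Longrightarrow> smooth_on S (\<lambda>z::'e \<times> 'e. (0::'e, snd z))"
  by (intro smooth_on_Pair smooth_on_const smooth_on_snd smooth_on_ident)

lemma fd_vertical: "fd (\<lambda>z::'e \<times> 'e. (0::'e, snd z)) z k = (0, snd k)"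
  by (subst fd_eqI[OF has_derivative_Pair[OF has_derivative_const has_derivative_snd[OF has_derivative_ident]]]) simp

text \<open>Differentiating the Euler relation of the energy along \<open>v\<close> yields the left
  side plus one copy of the right side, equal to two copies of the right side.\<close>

lemma hess_euler:
  assumes c: "c \<in> \<A>" and z: "z \<in> img (lc c)"
  shows "fd (\<lambda>z. fd (energy c) z (0, v)) z (0, snd z) = fd (energy c) z (0, v)"
proof -
  note S = open_img_lc[OF c]
  have "fd (\<lambda>z. fd (energy c) z (0, snd z)) z (0, v) = fd (\<lambda>z. 2 * energy c z) z (0, v)"
    using fd_cong[OF S z energy_euler[OF c]] by simp
  also have "\<dots> = 2 * fd (energy c) z (0, v)"
    by (subst fd_eqI[OF has_derivative_mult_right[OF smooth_on_has_derivative[OF smooth_energy[OF c] z]]]) simp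
  finally show ?thesis
    using fd_fd_field[OF S z smooth_energy[OF c] smooth_on_differentiable[OF smooth_on_vertical[OF S] z], of "(0, v)"]
      symmetric_second_derivative[OF S z smooth_energy[OF c], of "(0, v)" "(0, snd z)"]
    by (simp add: fd_vertical)
qed

text \<open>Differentiating \<open>hess_euler\<close> along \<open>a\<close>: the derivative falling
  on the argument \<open>snd z\<close> reproduces \<open>hess c z a w\<close>, which is the whole
  right side.\<close>

lemma cartan_tensor_euler:
  assumes c: "c \<in> \<A>" and z: "z \<in> img (lc c)"
  shows "cartan_tensor c z a (snd z) w = 0"
proof -
  note S = open_img_lc[OF c]
  note F = smooth_on_fd[OF smooth_energy[OF c], of "(0, w)"]
  have "fd (\<lambda>z. fd (\<lambda>z. fd (energy c) z (0, w)) z (0, snd z)) z (0, a) = fd (\<lambda>z. fd (energy c) z (0, w)) z (0, a)"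
    using fd_cong[OF S z hess_euler[OF c]] by simp
  then show ?thesis
    using fd_fd_field[OF S z F smooth_on_differentiable[OF smooth_on_vertical[OF S] z], of "(0, a)"]
    by (simp add: fd_vertical cartan_tensor_def hess_def)
qed

section \<open>The metric on smooth sections\<close>

lemma metric_vcomp:
  assumes c: "c \<in> \<A>" and x: "x \<in> img (lc c)" and X: "pi_field \<A> X" and Y: "pi_field \<A> Y"
  shows "g (chart_inv (lc c) x) (X (chart_inv (lc c) x)) (Y (chart_inv (lc c) x))
    = hess c x (vcomp (lc c) X c x) (vcomp (lc c) Y c x)"
  using metric_apply[OF img_lcD(2,1)[OF c x]] pi_field_tangent X Y img_lcD[OF c x] by simp

lemma smooth_metric:
  assumes c: "c \<in> \<A>" and X: "pi_field \<A> X" and Y: "pi_field \<A> Y"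
  shows "smooth_on (img (lc c)) (\<lambda>x. g (chart_inv (lc c) x) (X (chart_inv (lc c) x)) (Y (chart_inv (lc c) x)))"
proof (rule smooth_on_cong[OF open_img_lc[OF c]])
  note S = open_img_lc[OF c]
  show "smooth_on (img (lc c)) (\<lambda>x. hess c x (vcomp (lc c) X c x) (vcomp (lc c) Y c x))"
  proof (rule smooth_on_linear_family[OF S linear_hess_right[OF c] _ pi_field_smooth[OF Y c]])
    show "smooth_on (img (lc c)) (\<lambda>x. hess c x (vcomp (lc c) X c x) w)" for w
      by (rule smooth_on_linear_family[where h = "\<lambda>x v. hess c x v w", OF S linear_hess_left[OF c] smooth_hess[OF c] pi_field_smooth[OF X c]])
  qed
qed (simp add: metric_vcomp[OF c _ X Y])

lemma metric_fns:
  assumes X: "pi_field \<A> X" and Y: "pi_field \<A> Y"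
  shows "res (\<lambda>u. g u (X u) (Y u)) \<in> slit.fns"
proof -
  have "smooth_on (img (lc c)) (\<lambda>x. res (\<lambda>u. g u (X u) (Y u)) (chart_inv (lc c) x))" if c: "c \<in> \<A>" for c
    by (rule smooth_on_cong[OF open_img_lc[OF c] smooth_metric[OF c X Y]]) (simp add: img_lcD[OF c])
  moreover have "\<exists>c\<in>\<A>. c' = lc c" if "c' \<in> slit_atlas \<A>" for c'
    using that by (auto simp only: slit_atlas_def)
  ultimately show ?thesis
    unfolding slit.fns_def smooth_fun_def comp_def slit_charts_at_empty_iff by fastforce
qed

lemma metric_sym:
  assumes "u \<in> slit \<A>" "v \<in> tangent_space \<A> (fst u)" "w \<in> tangent_space \<A> (fst u)"
  shows "g u v w = g u w v"
proof -
  obtain c where c: "c \<in> charts_at \<A> (fst u)" using assms(1) by (rule slitE)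
  show ?thesis
    using hess_sym[OF charts_atD(1)[OF c] lc_in_img[OF c assms(1)]] by (simp add: metric_apply[OF c] assms)
qed

lemma metric_add_left:
  assumes "u \<in> slit \<A>" "v \<in> tangent_space \<A> (fst u)" "v' \<in> tangent_space \<A> (fst u)" "w \<in> tangent_space \<A> (fst u)"
  shows "g u (v + v') w = g u v w + g u v' w"
proof -
  obtain c where c: "c \<in> charts_at \<A> (fst u)" using assms(1) by (rule slitE)
  show ?thesis
    using linear_add[OF linear_hess_left[OF charts_atD(1)[OF c] lc_in_img[OF c assms(1)]]]
    by (simp add: metric_apply[OF c] assms tangent_space_closed)
qed

lemma metric_zero_iff:
  "u \<in> slit \<A> \<Longrightarrow> v \<in> tangent_space \<A> (fst u) \<Longrightarrow> g u v v = 0 \<Longrightarrow> v = 0"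
  using finsler unfolding finsler_manifold_def by (metis less_irrefl)

text \<open>Product rule in the lifted chart. The direction \<open>(0, X u c)\<close> is tangent to
  the fibre, so the coefficients contribute exactly the Cartan tensor.\<close>

lemma dir_deriv_metric_gamma:
  assumes c: "c \<in> charts_at \<A> (fst u)" and u: "u \<in> slit \<A>"
    and X: "pi_field \<A> X" and Y: "pi_field \<A> Y" and Z: "pi_field \<A> Z"
  shows "dir_deriv (slit_atlas \<A>) u (gamma \<A> u (X u)) (\<lambda>w. g w (Y w) (Z w)) =
    cartan_tensor c (snd (lc c) u) (X u c) (Y u c) (Z u c)
    + hess c (snd (lc c) u) (fibre_deriv c X Y u) (Z u c) + hess c (snd (lc c) u) (Y u c) (fibre_deriv c X Z u)"
proof -
  note c' = charts_atD(1)[OF c]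
  note S = open_img_lc[OF c'] lc_in_img[OF c u]
  let ?F = "\<lambda>x. g (chart_inv (lc c) x) (Y (chart_inv (lc c) x)) (Z (chart_inv (lc c) x))"
  have "dir_deriv (slit_atlas \<A>) u (gamma \<A> u (X u)) (\<lambda>w. g w (Y w) (Z w)) = fd ?F (snd (lc c) u) (0, X u c)"
    using slit.dir_deriv_chart[OF lc_charts_at[OF c u] gamma_tangent[OF pi_field_tangent[OF X u] u],
      of "\<lambda>w. g w (Y w) (Z w)"]
      smooth_on_differentiable[OF smooth_metric[OF c' Y Z] S(2)] by (simp add: gamma_apply[OF c u])
  also have "fd ?F (snd (lc c) u) = fd (\<lambda>x. hess c x (vcomp (lc c) Y c x) (vcomp (lc c) Z c x)) (snd (lc c) u)"
    by (rule fd_cong[OF S]) (rule metric_vcomp[OF c' _ Y Z])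
  also have "\<dots> = (\<lambda>k. fd (\<lambda>x. hess c x (Y u c) (Z u c)) (snd (lc c) u) k
      + hess c (snd (lc c) u) (Y u c) (fd (vcomp (lc c) Z c) (snd (lc c) u) k)
      + hess c (snd (lc c) u) (fd (vcomp (lc c) Y c) (snd (lc c) u) k) (Z u c))"
    using fd_eqI[OF has_derivative_bilinear_family[where G = "hess c" and G' = "\<lambda>v w. fd (\<lambda>x. hess c x v w) (snd (lc c) u)",
      OF S linear_hess_left[OF c'] linear_hess_right[OF c'] smooth_on_has_derivative[OF smooth_hess[OF c'] S(2)]
      fd_works[OF pi_field_differentiable[OF Y c u]] fd_works[OF pi_field_differentiable[OF Z c u]]]]
    by (simp add: lc_inv[OF c u])
  finally show ?thesis
    by (simp add: cartan_tensor_def fibre_deriv_def)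
qed

end


section \<open>The Bianchi calculus\<close>

text \<open>The operators of the calculus are controlled on subspaces of total types, as additive
  maps. Their rules for zero, negation and differences are derived from additivity once and for
  all.\<close>

lemma additive_on_subspace:
  fixes f :: "'a::real_vector \<Rightarrow> 'b::real_vector"
  assumes S: "subspace S" and f: "\<And>x y. x \<in> S \<Longrightarrow> y \<in> S \<Longrightarrow> f (x + y) = f x + f y"
  shows "f 0 = 0" "x \<in> S \<Longrightarrow> f (- x) = - f x" "x \<in> S \<Longrightarrow> y \<in> S \<Longrightarrow> f (x - y) = f x - f y"
proof -
  show 0: "f 0 = 0" using f[of 0 0] subspace_0[OF S] by simp
  have m: "f (- x) = - f x" if "x \<in> S" for x
    using f[OF that subspace_neg[OF S that]] 0 by (simp add: eq_neg_iff_add_eq_0 add.commute)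
  show "x \<in> S \<Longrightarrow> f (- x) = - f x" by (rule m)
  show "x \<in> S \<Longrightarrow> y \<in> S \<Longrightarrow> f (x - y) = f x - f y"
    using f[of x "- y"] m[of y] subspace_neg[OF S, of y] by simp
qed

text \<open>Global sections, vector fields and functions become subspaces of vector spaces with
  additive operations, so that the Bianchi algebra is done by rewriting, without points or charts.
  The three \<open>torsion\<close> assumptions state symmetry, vanishing on \<open>et\<close> and
  the metric exchange rule for \<open>T\<close>, in expanded form because \<open>T\<close> is
  defined only below.\<close>

locale cartan_calculus =
  fixes sec :: "'s::real_vector set" and vf :: "'v::real_vector set" and fn :: "'f::real_vector set"
    and cv :: "'v \<Rightarrow> 's \<Rightarrow> 's" and br :: "'v \<Rightarrow> 'v \<Rightarrow> 'v" and rh :: "'v \<Rightarrow> 's" and be ga :: "'s \<Rightarrow> 'v"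
    and gm :: "'s \<Rightarrow> 's \<Rightarrow> 'f" and der :: "'v \<Rightarrow> 'f \<Rightarrow> 'f" and et :: 's
  assumes subspaces: "subspace sec" "subspace vf" "subspace fn"
    and cv_sec [simp]: "A \<in> vf \<Longrightarrow> X \<in> sec \<Longrightarrow> cv A X \<in> sec"
    and br_vf [simp]: "A \<in> vf \<Longrightarrow> B \<in> vf \<Longrightarrow> br A B \<in> vf"
    and rh_sec [simp]: "A \<in> vf \<Longrightarrow> rh A \<in> sec"
    and be_vf [simp]: "X \<in> sec \<Longrightarrow> be X \<in> vf"
    and ga_vf [simp]: "X \<in> sec \<Longrightarrow> ga X \<in> vf"
    and gm_fn [simp]: "X \<in> sec \<Longrightarrow> Y \<in> sec \<Longrightarrow> gm X Y \<in> fn"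
    and der_fn [simp]: "A \<in> vf \<Longrightarrow> f \<in> fn \<Longrightarrow> der A f \<in> fn"
    and et_sec [simp]: "et \<in> sec"
    and cv_add_left: "X \<in> sec \<Longrightarrow> A \<in> vf \<Longrightarrow> B \<in> vf \<Longrightarrow> cv (A + B) X = cv A X + cv B X"
    and cv_add_right: "A \<in> vf \<Longrightarrow> X \<in> sec \<Longrightarrow> Y \<in> sec \<Longrightarrow> cv A (X + Y) = cv A X + cv A Y"
    and br_add: "A \<in> vf \<Longrightarrow> B \<in> vf \<Longrightarrow> C \<in> vf \<Longrightarrow> br A (B + C) = br A B + br A C"
    and br_antisym: "A \<in> vf \<Longrightarrow> B \<in> vf \<Longrightarrow> br A B = - br B A"
    and br_jacobi: "A \<in> vf \<Longrightarrow> B \<in> vf \<Longrightarrow> C \<in> vf \<Longrightarrow> br A (br B C) + br B (br C A) + br C (br A B) = 0"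
    and rh_add: "A \<in> vf \<Longrightarrow> B \<in> vf \<Longrightarrow> rh (A + B) = rh A + rh B"
    and be_add: "X \<in> sec \<Longrightarrow> Y \<in> sec \<Longrightarrow> be (X + Y) = be X + be Y"
    and ga_add: "X \<in> sec \<Longrightarrow> Y \<in> sec \<Longrightarrow> ga (X + Y) = ga X + ga Y"
    and gm_add: "Z \<in> sec \<Longrightarrow> X \<in> sec \<Longrightarrow> Y \<in> sec \<Longrightarrow> gm (X + Y) Z = gm X Z + gm Y Z"
    and gm_sym: "X \<in> sec \<Longrightarrow> Y \<in> sec \<Longrightarrow> gm X Y = gm Y X"
    and gm_nondegenerate: "X \<in> sec \<Longrightarrow> gm X X = 0 \<Longrightarrow> X = 0"
    and der_add: "A \<in> vf \<Longrightarrow> f \<in> fn \<Longrightarrow> h \<in> fn \<Longrightarrow> der A (f + h) = der A f + der A h"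
    and der_br: "A \<in> vf \<Longrightarrow> B \<in> vf \<Longrightarrow> f \<in> fn \<Longrightarrow> der (br A B) f = der A (der B f) - der B (der A f)"
    and der_gm: "A \<in> vf \<Longrightarrow> X \<in> sec \<Longrightarrow> Y \<in> sec \<Longrightarrow> der A (gm X Y) = gm (cv A X) Y + gm X (cv A Y)"
    and rh_be [simp]: "X \<in> sec \<Longrightarrow> rh (be X) = X"
    and rh_ga [simp]: "X \<in> sec \<Longrightarrow> rh (ga X) = 0"
    and cv_be_et [simp]: "X \<in> sec \<Longrightarrow> cv (be X) et = 0"
    and cv_ga_et [simp]: "X \<in> sec \<Longrightarrow> cv (ga X) et = X"
    and vf_decomp: "A \<in> vf \<Longrightarrow> A = be (rh A) + ga (cv A et)"
    and be_torsion_free: "X \<in> sec \<Longrightarrow> Y \<in> sec \<Longrightarrow> cv (be X) Y - cv (be Y) X - rh (br (be X) (be Y)) = 0"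
    and br_ga_ga: "X \<in> sec \<Longrightarrow> Y \<in> sec \<Longrightarrow> br (ga X) (ga Y) = ga (cv (ga X) Y - cv (ga Y) X)"
    and torsion_sym: "X \<in> sec \<Longrightarrow> Y \<in> sec \<Longrightarrow>
      cv (ga X) Y - rh (br (ga X) (be Y)) = cv (ga Y) X - rh (br (ga Y) (be X))"
    and torsion_et: "X \<in> sec \<Longrightarrow> cv (ga X) et - rh (br (ga X) (be et)) = 0"
    and torsion_gm: "X \<in> sec \<Longrightarrow> Y \<in> sec \<Longrightarrow> Z \<in> sec \<Longrightarrow>
      gm (cv (ga X) Y - rh (br (ga X) (be Y))) Z = gm (cv (ga X) Z - rh (br (ga X) (be Z))) Y"
begin

lemmas [simp] = subspace_0[OF subspaces(1)] subspace_add[OF subspaces(1)] subspace_diff[OF subspaces(1)]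
  subspace_neg[OF subspaces(1)] subspace_0[OF subspaces(2)] subspace_add[OF subspaces(2)]
  subspace_diff[OF subspaces(2)] subspace_neg[OF subspaces(2)] subspace_0[OF subspaces(3)]
  subspace_add[OF subspaces(3)] subspace_diff[OF subspaces(3)] subspace_neg[OF subspaces(3)]

lemma br_add_left: "C \<in> vf \<Longrightarrow> A \<in> vf \<Longrightarrow> B \<in> vf \<Longrightarrow> br (A + B) C = br A C + br B C"
  using br_antisym[of "A + B" C] br_antisym[of A C] br_antisym[of B C] br_add[of C A B] by simp

lemma gm_add_right: "Z \<in> sec \<Longrightarrow> X \<in> sec \<Longrightarrow> Y \<in> sec \<Longrightarrow> gm Z (X + Y) = gm Z X + gm Z Y"
  using gm_sym[of Z "X + Y"] gm_sym[of Z X] gm_sym[of Z Y] gm_add[of Z X Y] by simp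

lemmas cv_left = cv_add_left additive_on_subspace[OF subspaces(2), of "\<lambda>A. cv A X" for X, OF cv_add_left]
lemmas cv_right = cv_add_right additive_on_subspace[OF subspaces(1), of "cv A" for A, OF cv_add_right]
lemmas br_right = br_add additive_on_subspace[OF subspaces(2), of "br A" for A, OF br_add]
lemmas br_left = br_add_left additive_on_subspace[OF subspaces(2), of "\<lambda>A. br A C" for C, OF br_add_left]
lemmas rh_linear = rh_add additive_on_subspace[OF subspaces(2), of rh, OF rh_add]
lemmas be_linear = be_add additive_on_subspace[OF subspaces(1), of be, OF be_add]
lemmas ga_linear = ga_add additive_on_subspace[OF subspaces(1), of ga, OF ga_add]
lemmas gm_left = gm_add additive_on_subspace[OF subspaces(1), of "\<lambda>X. gm X Z" for Z, OF gm_add]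
lemmas gm_right = gm_add_right additive_on_subspace[OF subspaces(1), of "gm Z" for Z, OF gm_add_right]
lemmas der_linear = der_add additive_on_subspace[OF subspaces(3), of "der A" for A, OF der_add]

lemmas additive = cv_left cv_right br_right br_left rh_linear be_linear ga_linear gm_left gm_right der_linear

text \<open>Test section \<open>Z = X - Y\<close> and definiteness of the metric.\<close>

lemma sec_eqI:
  assumes "X \<in> sec" "Y \<in> sec" "\<And>Z. Z \<in> sec \<Longrightarrow> gm X Z = gm Y Z" shows "X = Y"
proof -
  have "gm (X - Y) (X - Y) = 0" using assms by (simp add: additive)
  then have "X - Y = 0" using assms by (intro gm_nondegenerate) simp_all
  then show ?thesis by simp
qed

definition K :: "'v \<Rightarrow> 'v \<Rightarrow> 's \<Rightarrow> 's" where
  "K A B Z = - cv A (cv B Z) + cv B (cv A Z) + cv (br A B) Z"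

definition tor :: "'v \<Rightarrow> 'v \<Rightarrow> 's" where
  "tor A B = cv A (rh B) - cv B (rh A) - rh (br A B)"

definition T :: "'s \<Rightarrow> 's \<Rightarrow> 's" where "T X Y = tor (ga X) (be Y)"
definition S :: "'s \<Rightarrow> 's \<Rightarrow> 's \<Rightarrow> 's" where "S X Y = K (ga X) (ga Y)"
definition P :: "'s \<Rightarrow> 's \<Rightarrow> 's \<Rightarrow> 's" where "P X Y = K (be X) (ga Y)"
definition Ph :: "'s \<Rightarrow> 's \<Rightarrow> 's" where "Ph X Y = P X Y et"
definition cT :: "'v \<Rightarrow> 's \<Rightarrow> 's \<Rightarrow> 's" where
  "cT A X Y = cv A (T X Y) - T (cv A X) Y - T X (cv A Y)"

lemma K_sec [simp]: "A \<in> vf \<Longrightarrow> B \<in> vf \<Longrightarrow> Z \<in> sec \<Longrightarrow> K A B Z \<in> sec"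
  by (simp add: K_def)

lemma tor_sec [simp]: "A \<in> vf \<Longrightarrow> B \<in> vf \<Longrightarrow> tor A B \<in> sec"
  by (simp add: tor_def)

lemma T_sec [simp]: "X \<in> sec \<Longrightarrow> Y \<in> sec \<Longrightarrow> T X Y \<in> sec"
  by (simp add: T_def)

lemma P_sec [simp]: "X \<in> sec \<Longrightarrow> Y \<in> sec \<Longrightarrow> Z \<in> sec \<Longrightarrow> P X Y Z \<in> sec"
  by (simp add: P_def)

lemma S_sec [simp]: "X \<in> sec \<Longrightarrow> Y \<in> sec \<Longrightarrow> Z \<in> sec \<Longrightarrow> S X Y Z \<in> sec"
  by (simp add: S_def)

lemma Ph_sec [simp]: "X \<in> sec \<Longrightarrow> Y \<in> sec \<Longrightarrow> Ph X Y \<in> sec"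
  by (simp add: Ph_def)

lemma cT_sec [simp]: "A \<in> vf \<Longrightarrow> X \<in> sec \<Longrightarrow> Y \<in> sec \<Longrightarrow> cT A X Y \<in> sec"
  by (simp add: cT_def)

lemma K_antisym: "A \<in> vf \<Longrightarrow> B \<in> vf \<Longrightarrow> Z \<in> sec \<Longrightarrow> K A B Z = - K B A Z"
  using br_antisym[of A B] by (simp add: K_def additive)

lemma tor_antisym: "A \<in> vf \<Longrightarrow> B \<in> vf \<Longrightarrow> tor A B = - tor B A"
  using br_antisym[of A B] by (simp add: tor_def additive)

lemma K_add_left: "C \<in> vf \<Longrightarrow> Z \<in> sec \<Longrightarrow> A \<in> vf \<Longrightarrow> B \<in> vf \<Longrightarrow> K (A + B) C Z = K A C Z + K B C Z"
  by (simp add: K_def additive)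

lemma K_add_mid: "C \<in> vf \<Longrightarrow> Z \<in> sec \<Longrightarrow> A \<in> vf \<Longrightarrow> B \<in> vf \<Longrightarrow> K C (A + B) Z = K C A Z + K C B Z"
  by (simp add: K_def additive)

lemma tor_add_left: "C \<in> vf \<Longrightarrow> A \<in> vf \<Longrightarrow> B \<in> vf \<Longrightarrow> tor (A + B) C = tor A C + tor B C"
  by (simp add: tor_def additive)

lemma tor_add_right: "C \<in> vf \<Longrightarrow> A \<in> vf \<Longrightarrow> B \<in> vf \<Longrightarrow> tor C (A + B) = tor C A + tor C B"
  by (simp add: tor_def additive)

lemmas K_left = K_add_left additive_on_subspace[OF subspaces(2), of "\<lambda>A. K A C Z" for C Z, OF K_add_left]
lemmas K_mid = K_add_mid additive_on_subspace[OF subspaces(2), of "\<lambda>A. K C A Z" for C Z, OF K_add_mid]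
lemmas tor_left = tor_add_left additive_on_subspace[OF subspaces(2), of "\<lambda>A. tor A C" for C, OF tor_add_left]
lemmas tor_right = tor_add_right additive_on_subspace[OF subspaces(2), of "tor C" for C, OF tor_add_right]

lemma T_add_left: "Z \<in> sec \<Longrightarrow> X \<in> sec \<Longrightarrow> Y \<in> sec \<Longrightarrow> T (X + Y) Z = T X Z + T Y Z"
  by (simp add: T_def ga_linear tor_left)

lemma T_add_right: "Z \<in> sec \<Longrightarrow> X \<in> sec \<Longrightarrow> Y \<in> sec \<Longrightarrow> T Z (X + Y) = T Z X + T Z Y"
  by (simp add: T_def be_linear tor_right)

lemmas T_linear = T_add_left T_add_right
  additive_on_subspace[OF subspaces(1), of "\<lambda>X. T X Z" for Z, OF T_add_left]
  additive_on_subspace[OF subspaces(1), of "T Z" for Z, OF T_add_right]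

section \<open>Bianchi identities and skewness of the curvature\<close>

lemma br_jacobi_left:
  assumes [simp]: "A \<in> vf" "B \<in> vf" "C \<in> vf"
  shows "br (br A B) C + br (br B C) A + br (br C A) B = 0"
proof -
  have "br (br A B) C + br (br B C) A + br (br C A) B = - (br A (br B C) + br B (br C A) + br C (br A B))"
    by (simp add: br_antisym[of "br A B" C] br_antisym[of "br B C" A] br_antisym[of "br C A" B])
  then show ?thesis by (simp add: br_jacobi)
qed

text \<open>First Bianchi identity, with \<open>rh\<close> in the place of the identity on tangent
  vectors. After expansion the iterated covariant derivatives cancel and \<open>rh\<close> of the
  Jacobi identity remains.\<close>

lemma bianchi_torsion:
  assumes [simp]: "A \<in> vf" "B \<in> vf" "C \<in> vf"
  shows "K A B (rh C) + K B C (rh A) + K C A (rh B) =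
    tor (br A B) C + tor (br B C) A + tor (br C A) B
    - (cv A (tor B C) + cv B (tor C A) + cv C (tor A B))"
proof -
  from br_jacobi_left[OF assms(1-3)] have "rh (br (br A B) C) + rh (br (br B C) A) + rh (br (br C A) B) = 0"
    by (simp flip: rh_add) (simp add: additive)
  \<comment> \<open>Solved for one of its terms, the Jacobi identity becomes a rewrite rule.\<close>
  then have j: "rh (br (br A B) C) = - (rh (br (br B C) A) + rh (br (br C A) B))"
    unfolding eq_neg_iff_add_eq_0 by (simp only: add.assoc)
  show ?thesis
    by (simp add: K_def tor_def additive j algebra_simps)
qed

text \<open>Second Bianchi identity. As operators, \<open>K A B\<close> is
  \<open>cv (br A B)\<close> minus the commutator of \<open>cv A\<close> and \<open>cv B\<close>;
  the triple commutators cancel and the nested brackets do so by Jacobi.\<close>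

lemma bianchi_curvature:
  assumes [simp]: "A \<in> vf" "B \<in> vf" "C \<in> vf" "Z \<in> sec"
  shows "cv A (K B C Z) - K B C (cv A Z) + (cv B (K C A Z) - K C A (cv B Z)) + (cv C (K A B Z) - K A B (cv C Z))
    = K (br A B) C Z + K (br B C) A Z + K (br C A) B Z"
proof -
  from br_jacobi_left[OF assms(1-3)] have "cv (br (br A B) C) Z + cv (br (br B C) A) Z + cv (br (br C A) B) Z = 0"
    by (simp flip: cv_add_left) (simp add: additive)
  then have j: "cv (br (br A B) C) Z = - (cv (br (br B C) A) Z + cv (br (br C A) B) Z)"
    unfolding eq_neg_iff_add_eq_0 by (simp only: add.assoc)
  show ?thesis
    by (simp add: K_def additive j algebra_simps)
qed

text \<open>On the function \<open>gm Z W\<close> the bracket acts as the commutator of derivatives.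
  Expanding by metricity, the terms with one derivative on each factor cancel.\<close>

lemma K_skew:
  assumes [simp]: "A \<in> vf" "B \<in> vf" "Z \<in> sec" "W \<in> sec"
  shows "gm (K A B Z) W = - gm (K A B W) Z"
proof -
  have "gm (cv (br A B) Z) W + gm Z (cv (br A B) W) = der A (der B (gm Z W)) - der B (der A (gm Z W))"
    using der_br[of A B "gm Z W"] der_gm[of "br A B" Z W] by simp
  also have "\<dots> = gm (cv A (cv B Z)) W + gm Z (cv A (cv B W)) - gm (cv B (cv A Z)) W - gm Z (cv B (cv A W))"
    by (simp add: der_gm der_add algebra_simps)
  finally have "gm (cv (br A B) Z) W = gm (cv A (cv B Z)) W + gm Z (cv A (cv B W)) - gm (cv B (cv A Z)) W
      - gm Z (cv B (cv A W)) - gm Z (cv (br A B) W)"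
    by (simp add: algebra_simps)
  then have "gm (K A B Z) W = - gm Z (K A B W)"
    by (simp add: K_def additive algebra_simps)
  then show ?thesis by (simp add: gm_sym[of Z])
qed

section \<open>Symmetries of the torsion \<open>T\<close> and of its covariant derivative\<close>

lemma T_alt: "X \<in> sec \<Longrightarrow> Y \<in> sec \<Longrightarrow> T X Y = cv (ga X) Y - rh (br (ga X) (be Y))"
  by (simp add: T_def tor_def additive)

lemma T_sym: "X \<in> sec \<Longrightarrow> Y \<in> sec \<Longrightarrow> T X Y = T Y X"
  using torsion_sym by (simp add: T_alt)

lemma T_et_right [simp]: "X \<in> sec \<Longrightarrow> T X et = 0"
  using torsion_et T_alt et_sec by presburger

lemma T_et_left [simp]: "X \<in> sec \<Longrightarrow> T et X = 0"
  by (simp add: T_sym[of et])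

lemma T_gm: "X \<in> sec \<Longrightarrow> Y \<in> sec \<Longrightarrow> Z \<in> sec \<Longrightarrow> gm (T X Y) Z = gm (T X Z) Y"
  using torsion_gm by (simp add: T_alt)

lemma cT_sym: "A \<in> vf \<Longrightarrow> X \<in> sec \<Longrightarrow> Y \<in> sec \<Longrightarrow> cT A X Y = cT A Y X"
  by (simp add: cT_def T_sym[of X Y] T_sym[of "cv A X"] T_sym[of _ "cv A Y"])

text \<open>The exchange rule for \<open>T\<close>, differentiated along \<open>A\<close> with a
  metric connection. Together with \<open>cT_sym\<close> it makes \<open>gm (cT A X Y) Z\<close>
  totally symmetric.\<close>

lemma cT_gm:
  assumes [simp]: "A \<in> vf" "X \<in> sec" "Y \<in> sec" "Z \<in> sec"
  shows "gm (cT A X Y) Z = gm (cT A X Z) Y"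
proof -
  have "der A (gm (T X Y) Z) = der A (gm (T X Z) Y)" by (simp add: T_gm[of X Y Z])
  then have "gm (cv A (T X Y)) Z + gm (T X Y) (cv A Z) = gm (cv A (T X Z)) Y + gm (T X Z) (cv A Y)"
    by (simp add: der_gm)
  moreover have "gm (T X Y) (cv A Z) = gm (T X (cv A Z)) Y" "gm (T X Z) (cv A Y) = gm (T X (cv A Y)) Z"
    "gm (T (cv A X) Y) Z = gm (T (cv A X) Z) Y"
    by (simp_all add: T_gm)
  ultimately show ?thesis
    by (simp add: cT_def additive algebra_simps)
qed

section \<open>Torsion and brackets of horizontal and vertical lifts\<close>

lemma tor_be_be: "X \<in> sec \<Longrightarrow> Y \<in> sec \<Longrightarrow> tor (be X) (be Y) = 0"
  by (simp add: tor_def be_torsion_free)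

lemma tor_ga_ga: "X \<in> sec \<Longrightarrow> Y \<in> sec \<Longrightarrow> tor (ga X) (ga Y) = 0"
  by (simp add: tor_def br_ga_ga additive)

lemma tor_be_ga: "X \<in> sec \<Longrightarrow> Y \<in> sec \<Longrightarrow> tor (be X) (ga Y) = - T Y X"
  by (simp add: T_def tor_antisym[of "be X"])

lemmas tor_simps = tor_be_be tor_ga_ga tor_be_ga T_def[symmetric]

lemma rh_br_be_be: "X \<in> sec \<Longrightarrow> Y \<in> sec \<Longrightarrow> rh (br (be X) (be Y)) = cv (be X) Y - cv (be Y) X"
  using be_torsion_free[of X Y] by simp

text \<open>By \<open>vf_decomp\<close> it suffices to know \<open>rh\<close> and
  \<open>cv _ et\<close> of the bracket. The former is read off from the definition of
  \<open>T\<close>, the latter from that of \<open>P\<close> at \<open>et\<close>, where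
  \<open>cv (ga Y) et = Y\<close> and \<open>cv (be X) et = 0\<close>.\<close>

lemma br_be_ga:
  assumes [simp]: "X \<in> sec" "Y \<in> sec"
  shows "br (be X) (ga Y) = be (T Y X - cv (ga Y) X) + ga (Ph X Y + cv (be X) Y)"
proof -
  have "rh (br (be X) (ga Y)) = T Y X - cv (ga Y) X"
    using br_antisym[of "be X" "ga Y"] by (simp add: T_alt additive)
  moreover have "cv (br (be X) (ga Y)) et = Ph X Y + cv (be X) Y"
    by (simp add: Ph_def P_def K_def additive)
  ultimately show ?thesis
    using vf_decomp[of "br (be X) (ga Y)"] by simp
qed

lemma br_ga_be: "X \<in> sec \<Longrightarrow> Y \<in> sec \<Longrightarrow>
    br (ga Y) (be X) = - be (T Y X - cv (ga Y) X) - ga (Ph X Y + cv (be X) Y)"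
  using br_antisym[of "ga Y" "be X"] by (simp add: br_be_ga)

section \<open>The hv-curvature\<close>

lemma P_skew: "X \<in> sec \<Longrightarrow> Y \<in> sec \<Longrightarrow> Z \<in> sec \<Longrightarrow> W \<in> sec \<Longrightarrow> gm (P X Y Z) W = - gm (P X Y W) Z"
  unfolding P_def by (rule K_skew) simp_all

text \<open>First Bianchi identity for \<open>be X\<close>, \<open>ga Y\<close>,
  \<open>be Z\<close>. The covariant derivatives that the brackets bring in complete those of
  \<open>T\<close> to \<open>cT\<close>.\<close>

lemma P_exchange:
  assumes [simp]: "X \<in> sec" "Y \<in> sec" "Z \<in> sec"
  shows "P X Y Z - P Z Y X = cT (be Z) Y X - cT (be X) Y Z - T (Ph Z Y) X + T (Ph X Y) Z"
proof -
  have t1: "tor (br (be X) (ga Y)) (be Z) = T (Ph X Y) Z + T (cv (be X) Y) Z"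
    by (simp add: br_be_ga tor_left tor_simps T_linear)
  have t2: "tor (br (ga Y) (be Z)) (be X) = - T (Ph Z Y) X - T (cv (be Z) Y) X"
    by (simp add: br_ga_be tor_left tor_simps T_linear)
  \<comment> \<open>The vertical part of this bracket, which contains the h-curvature, drops out
    because torsion vanishes on two vertical fields.\<close>
  have t3: "tor (br (be Z) (be X)) (ga Y) = - T Y (cv (be Z) X) + T Y (cv (be X) Z)"
    by (subst vf_decomp[of "br (be Z) (be X)"]) (simp_all add: tor_left tor_simps rh_br_be_be T_linear)
  \<comment> \<open>The third curvature term acts on \<open>rh (ga Y) = 0\<close>.\<close>
  have "P X Y Z - P Z Y X = K (be X) (ga Y) (rh (be Z)) + K (ga Y) (be Z) (rh (be X)) + K (be Z) (be X) (rh (ga Y))"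
    using K_antisym[of "ga Y" "be Z" X] by (simp add: P_def K_def[of "be Z" "be X" 0] additive)
  also have "\<dots> = T (Ph X Y) Z + T (cv (be X) Y) Z - T (Ph Z Y) X - T (cv (be Z) Y) X
      - T Y (cv (be Z) X) + T Y (cv (be X) Z) - cv (be X) (T Y Z) + cv (be Z) (T Y X)"
    by (subst bianchi_torsion) (simp_all add: t1 t2 t3 tor_simps additive)
  finally show ?thesis
    by (simp add: cT_def algebra_simps)
qed

text \<open>Solving the exchange relation together with skewness in the last two arguments, as for the
  Christoffel symbols.\<close>

lemma P_formula:
  assumes [simp]: "X \<in> sec" "Y \<in> sec" "Z \<in> sec" "W \<in> sec"
  shows "gm (P X Y Z) W = gm (cT (be Z) X Y) W - gm (cT (be W) X Y) Z
    + gm (T X Z) (Ph W Y) - gm (T X W) (Ph Z Y)"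
proof -
  have F: "gm (cT A Y B) C = gm (cT A Y C) B" if "A \<in> vf" "B \<in> sec" "C \<in> sec" for A B C
    using cT_gm that by simp
  have C: "gm (T (Ph A Y) B) C = gm (T B C) (Ph A Y)" "gm (T B C) (Ph A Y) = gm (T C B) (Ph A Y)"
    if "A \<in> sec" "B \<in> sec" "C \<in> sec" for A B C
    using T_gm[of B "Ph A Y" C] T_sym[of "Ph A Y" B] T_sym[of B C] that by simp_all
  have q: "gm (P A Y B) E - gm (P B Y A) E = gm (cT (be B) Y A) E - gm (cT (be A) Y B) E
      - gm (T A E) (Ph B Y) + gm (T B E) (Ph A Y)" if [simp]: "A \<in> sec" "B \<in> sec" "E \<in> sec" for A B E
    using arg_cong[OF P_exchange[of A Y B], of "\<lambda>V. gm V E"] C by (simp add: additive)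
  have "gm (P X Y Z) W + gm (P X Y Z) W = (gm (P X Y Z) W - gm (P Z Y X) W)
      + (gm (P W Y X) Z - gm (P X Y W) Z) - (gm (P Z Y W) X - gm (P W Y Z) X)"
    by (simp add: P_skew[of Z Y X W] P_skew[of W Y X Z] P_skew[of X Y W Z])
  also have "\<dots> = 2 *\<^sub>R (gm (cT (be Z) Y X) W - gm (cT (be W) Y X) Z
      + gm (T X Z) (Ph W Y) - gm (T X W) (Ph Z Y))"
    \<comment> \<open>By total symmetry the terms with \<open>be X\<close> and those with
      \<open>Ph X Y\<close> cancel, and all others occur twice.\<close>
    unfolding q[OF assms(1,3,4)] q[OF assms(4,1,3)] q[OF assms(3,4,1)]
    by (simp add: F[of "be Z" X W] F[of "be W" X Z] F[of "be X" Z W] C(2)[of X Z W] C(2)[of Z W X] C(2)[of W X Z]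
        scaleR_2 algebra_simps)
  finally have "2 *\<^sub>R gm (P X Y Z) W = 2 *\<^sub>R (gm (cT (be Z) Y X) W - gm (cT (be W) Y X) Z
      + gm (T X Z) (Ph W Y) - gm (T X W) (Ph Z Y))"
    by (simp only: scaleR_2)
  then show ?thesis
    by (simp add: cT_sym[of _ X Y])
qed

text \<open>All three terms of \<open>cT\<close> contain \<open>T\<close> with \<open>et\<close> or
  with its derivative \<open>0\<close>. Applied to horizontal \<open>A\<close>, along which
  \<open>et\<close> is parallel.\<close>

lemma cT_et: "A \<in> vf \<Longrightarrow> cv A et = 0 \<Longrightarrow> X \<in> sec \<Longrightarrow> cT A et X = 0"
  by (simp add: cT_def additive T_linear)

lemma cT_et': "A \<in> vf \<Longrightarrow> cv A et = 0 \<Longrightarrow> X \<in> sec \<Longrightarrow> cT A X et = 0"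
  by (simp add: cT_sym[of A X] cT_et)

text \<open>\<open>P_formula\<close> at \<open>Z = et\<close>: by symmetry the second derivative
  term has \<open>et\<close> in a slot of \<open>cT (be W)\<close> and vanishes, and
  \<open>T X et = 0\<close> removes another term.\<close>

lemma Ph_gm:
  assumes [simp]: "X \<in> sec" "Y \<in> sec" "W \<in> sec"
  shows "gm (Ph X Y) W = gm (cT (be et) X Y) W - gm (T X W) (Ph et Y)"
  using P_formula[of X Y et W] cT_gm[of "be W" X Y et] cT_et'[of "be W" X]
  by (simp add: Ph_def gm_left)

text \<open>At \<open>X = et\<close> both terms of \<open>Ph_gm\<close> vanish. Reinserted there,
  this frees \<open>Ph X Y\<close> from its last unknown.\<close>

lemma Ph_et_left:
  assumes [simp]: "X \<in> sec" shows "Ph et X = 0"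
  by (rule sec_eqI) (simp_all add: Ph_gm cT_et gm_left)

lemma Ph_eq: "X \<in> sec \<Longrightarrow> Y \<in> sec \<Longrightarrow> Ph X Y = cT (be et) X Y"
  by (rule sec_eqI) (simp_all add: Ph_gm Ph_et_left gm_right)

lemma Ph_sym: "X \<in> sec \<Longrightarrow> Y \<in> sec \<Longrightarrow> Ph X Y = Ph Y X"
  by (simp add: Ph_eq cT_sym[of _ X])

lemma Ph_et_right: "X \<in> sec \<Longrightarrow> Ph X et = 0"
  by (simp add: Ph_sym[of X] Ph_et_left)

text \<open>At \<open>X = et\<close> every term of \<open>P_formula\<close> contains
  \<open>T\<close> or a horizontal \<open>cT\<close> with a slot \<open>et\<close>. For
  \<open>P_et_mid\<close> the vanishing of \<open>Ph\<close> at \<open>et\<close> in the second slot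
  is used as well.\<close>

lemma P_et_left: "X \<in> sec \<Longrightarrow> Y \<in> sec \<Longrightarrow> P et X Y = 0"
  by (rule sec_eqI) (simp_all add: P_formula cT_et gm_left)

lemma P_et_mid: "X \<in> sec \<Longrightarrow> Y \<in> sec \<Longrightarrow> P X et Y = 0"
  by (rule sec_eqI) (simp_all add: P_formula cT_et' Ph_et_right gm_left gm_right)

text \<open>The derivative terms in the Bianchi identity for \<open>S\<close> are symmetric and the remaining terms
  skew in the last two arguments, so the former cancel.\<close>

lemma S_formula:
  assumes [simp]: "X \<in> sec" "Y \<in> sec" "Z \<in> sec"
  shows "S X Y Z = T X (T Y Z) - T Y (T X Z)"
proof -
  have S: "S X Y V = cT (ga Y) X V - cT (ga X) Y V + T X (T Y V) - T Y (T X V)" if [simp]: "V \<in> sec" for V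
  proof -
    have t1: "tor (br (ga X) (ga Y)) (be V) = T (cv (ga X) Y) V - T (cv (ga Y) X) V"
      by (simp add: br_ga_ga tor_simps T_linear)
    have t2: "tor (br (ga Y) (be V)) (ga X) = T X (T Y V) - T X (cv (ga Y) V)"
      by (simp add: br_ga_be tor_left tor_simps T_linear)
    have t3: "tor (br (be V) (ga X)) (ga Y) = - T Y (T X V) + T Y (cv (ga X) V)"
      by (simp add: br_be_ga tor_left tor_simps T_linear)
    have "S X Y V = K (ga X) (ga Y) (rh (be V)) + K (ga Y) (be V) (rh (ga X)) + K (be V) (ga X) (rh (ga Y))"
      by (simp add: S_def K_def[of _ _ 0] additive)
    also have "\<dots> = T (cv (ga X) Y) V - T (cv (ga Y) X) V + T X (T Y V) - T X (cv (ga Y) V)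
        - T Y (T X V) + T Y (cv (ga X) V) - cv (ga X) (T Y V) + cv (ga Y) (T X V)"
      by (subst bianchi_torsion) (simp_all add: t1 t2 t3 tor_simps additive)
    finally show ?thesis by (simp add: cT_def algebra_simps)
  qed
  have "cT (ga Y) X Z - cT (ga X) Y Z = 0"
  proof (rule sec_eqI)
    fix W assume [simp]: "W \<in> sec"
    let ?s = "gm (cT (ga Y) X Z) W - gm (cT (ga X) Y Z) W"
    \<comment> \<open>\<open>T X\<close> and \<open>T Y\<close> are self-adjoint for
      \<open>gm\<close>, hence their commutator is skew.\<close>
    have "gm (T X (T Y Z)) W = gm (T Y (T X W)) Z" "gm (T X (T Y W)) Z = gm (T Y (T X Z)) W"
      using T_gm[of X "T Y Z" W] T_gm[of Y "T X W" Z] T_gm[of X "T Y W" Z] T_gm[of Y "T X Z" W]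
        gm_sym[of "T X W" "T Y Z"] gm_sym[of "T X Z" "T Y W"] by simp_all
    then have "2 *\<^sub>R ?s = 0"
      using K_skew[of "ga X" "ga Y" Z W] S[of Z] S[of W] cT_gm[of "ga Y" X Z W] cT_gm[of "ga X" Y Z W]
      by (simp add: S_def[symmetric] additive scaleR_2 algebra_simps)
    then show "gm (cT (ga Y) X Z - cT (ga X) Y Z) W = gm 0 W"
      by (simp add: additive)
  qed simp_all
  then show ?thesis using S[of Z] by simp
qed

section \<open>Consequences of the second Bianchi identity\<close>

lemma S_et: "X \<in> sec \<Longrightarrow> Z \<in> sec \<Longrightarrow> S X et Z = 0"
  by (simp add: S_formula T_linear)

lemma P_mid_diff: "X \<in> sec \<Longrightarrow> Y \<in> sec \<Longrightarrow> V \<in> sec \<Longrightarrow> Z \<in> sec \<Longrightarrow> P X (Y - V) Z = P X Y Z - P X V Z"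
  by (simp add: P_def ga_linear K_mid)

text \<open>Second Bianchi identity for \<open>ga et\<close>, \<open>be X\<close>,
  \<open>ga Y\<close>. Curvatures with an entry \<open>ga et\<close> vanish by \<open>S_et\<close>
  and \<open>P_et_mid\<close>, so only the derivative of \<open>P\<close> along \<open>ga et\<close>
  and the bracket terms survive.\<close>

lemma P_homogeneous:
  assumes [simp]: "X \<in> sec" "Y \<in> sec" "Z \<in> sec"
  shows "cv (ga et) (P X Y Z) - P (cv (ga et) X) Y Z - P X (cv (ga et) Y) Z - P X Y (cv (ga et) Z) = - P X Y Z"
proof -
  have S0: "K (ga V) (ga et) W = 0" if "V \<in> sec" "W \<in> sec" for V W
    using S_et that by (simp add: S_def)
  have P0: "K (be V) (ga et) W = 0" "K (ga et) (be V) W = 0" if "V \<in> sec" "W \<in> sec" for V W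
    using P_et_mid that K_antisym[of "ga et" "be V" W] by (simp_all add: P_def)
  have b1: "K (br (ga et) (be X)) (ga Y) Z = P (cv (ga et) X) Y Z"
    by (simp add: br_ga_be Ph_et_right additive K_left P_def)
  have b2: "K (br (be X) (ga Y)) (ga et) Z = 0"
    by (simp add: br_be_ga K_left S0 P0)
  \<comment> \<open>Origin of the undifferentiated term: since \<open>cv (ga Y) et = Y\<close>, the
    bracket of \<open>ga Y\<close> and \<open>ga et\<close> contains \<open>ga Y\<close>
    itself.\<close>
  have b3: "K (br (ga Y) (ga et)) (be X) Z = - P X Y Z + P X (cv (ga et) Y) Z"
    using K_antisym[of "ga (Y - cv (ga et) Y)" "be X" Z]
    by (simp add: br_ga_ga P_def[symmetric] P_mid_diff)
  show ?thesis
    using bianchi_curvature[of "ga et" "be X" "ga Y" Z]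
    by (simp add: b1 b2 b3 S0 P0 additive P_def[symmetric] algebra_simps)
qed

text \<open>Second Bianchi identity for \<open>be et\<close>, \<open>ga X\<close>,
  \<open>ga Y\<close>. Since \<open>cv (ga X) et = X\<close>, the horizontal part of the bracket of
  \<open>be et\<close> and \<open>ga X\<close> is \<open>- be X\<close>, which turns a curvature of
  brackets into \<open>P X Y\<close>; likewise \<open>P Y X\<close> arises from
  \<open>ga Y\<close>.\<close>

lemma P_commute:
  assumes [simp]: "X \<in> sec" "Y \<in> sec" "Z \<in> sec"
  shows "P X Y Z = P Y X Z - (cv (be et) (S X Y Z) - S (cv (be et) X) Y Z - S X (cv (be et) Y) Z - S X Y (cv (be et) Z))"
proof -
  have P0: "K (be et) (ga V) W = 0" "K (ga V) (be et) W = 0" if "V \<in> sec" "W \<in> sec" for V W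
    using P_et_left that K_antisym[of "ga V" "be et" W] by (simp_all add: P_def)
  have b1: "K (br (be et) (ga X)) (ga Y) Z = - P X Y Z + S (cv (be et) X) Y Z"
    by (simp add: br_be_ga Ph_et_left additive K_left P_def S_def)
  have b2: "K (br (ga X) (ga Y)) (be et) Z = 0"
    by (simp add: br_ga_ga P0)
  have b3: "K (br (ga Y) (be et)) (ga X) Z = P Y X Z + S X (cv (be et) Y) Z"
    using K_antisym[of "ga (cv (be et) Y)" "ga X" Z]
    by (simp add: br_ga_be Ph_et_left additive K_left P_def S_def)
  show ?thesis
    using bianchi_curvature[of "be et" "ga X" "ga Y" Z]
    by (simp add: b1 b2 b3 P0 additive S_def[symmetric] algebra_simps)
qed

end


section \<open>Smoothness of horizontal lifts\<close>

text \<open>Lets the derivative of a family of linear maps be treated as such a family again, as the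
  induction for \<open>Ck_on_linear_solve\<close> requires.\<close>

lemma linear_fd_family:
  fixes h :: "'a::euclidean_space \<Rightarrow> 'b::euclidean_space \<Rightarrow> 'c::real_normed_vector"
  assumes S: "open S" "x \<in> S" and lin: "\<And>x. x \<in> S \<Longrightarrow> linear (h x)" and h: "\<And>v. smooth_on S (\<lambda>x. h x v)"
  shows "linear (\<lambda>v. fd (\<lambda>y. h y v) x k)"
proof (rule linearI)
  note d = smooth_on_has_derivative[OF h S(2)]
  fix v w r
  have "fd (\<lambda>y. h y (v + w)) x = fd (\<lambda>y. h y v + h y w) x"
    by (rule fd_cong[OF S]) (simp add: linear_add[OF lin])
  then show "fd (\<lambda>y. h y (v + w)) x k = fd (\<lambda>y. h y v) x k + fd (\<lambda>y. h y w) x k"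
    using fd_eqI[OF has_derivative_add[OF d[of v] d[of w]]] by simp
  have "fd (\<lambda>y. h y (r *\<^sub>R v)) x = fd (\<lambda>y. r *\<^sub>R h y v) x"
    by (rule fd_cong[OF S]) (simp add: linear_scale[OF lin])
  then show "fd (\<lambda>y. h y (r *\<^sub>R v)) x k = r *\<^sub>R fd (\<lambda>y. h y v) x k"
    using fd_eqI[OF has_derivative_scaleR_right[OF d[of v]]] by simp
qed

text \<open>Rather than differentiating matrix inversion, apply the inverse function theorem to
  \<open>(x, w) \<mapsto> (x, h x w)\<close>.\<close>

lemma differentiable_linear_inverse:
  fixes h :: "'a::euclidean_space \<Rightarrow> 'b::euclidean_space \<Rightarrow> 'b"
  assumes S: "open S" "x \<in> S" and lin: "\<And>x. x \<in> S \<Longrightarrow> linear (h x)"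
    and inj: "\<And>x. x \<in> S \<Longrightarrow> inj (h x)" and h: "\<And>v. smooth_on S (\<lambda>x. h x v)"
  shows "(\<lambda>z. inv (h (fst z)) (snd z)) differentiable (at (x, y))"
proof -
  let ?F = "\<lambda>z. (fst z, h (fst z) (snd z))" and ?G = "\<lambda>z. (fst z, inv (h (fst z)) (snd z))"
  let ?U = "S \<times> (UNIV :: 'b set)"
  have U: "open ?U" using S by (simp add: open_Times)
  obtain w where w: "h x w = y"
    using linear_injective_imp_surjective[OF lin inj] S(2) by (metis surjD)
  have sm: "smooth_on ?U (\<lambda>z. h (fst z) v)" for v
    by (rule smooth_on_compose_linear[OF bounded_linear_fst S(1) h U]) auto
  have smF: "smooth_on ?U (\<lambda>z. h (fst z) (snd z))"
    by (rule smooth_on_linear_family[where h = "\<lambda>z. h (fst z)", OF U lin sm smooth_on_snd[OF U smooth_on_ident[OF U]]]) auto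
  have d: "((\<lambda>z. h (fst z) v) has_derivative (\<lambda>k. fd (\<lambda>x. h x v) x (fst k))) (at (x, w))" for v
    using has_derivative_compose[OF has_derivative_fst[OF has_derivative_ident], of "\<lambda>x. h x v" _ "(x, w)" UNIV]
      smooth_on_has_derivative[OF h S(2)] by simp
  let ?F' = "\<lambda>k. (fst k, fd (\<lambda>x. h x w) x (fst k) + h x (snd k))"
  \<comment> \<open>The inverse of the block triangular derivative \<open>?F'\<close>.\<close>
  let ?G' = "\<lambda>k. (fst k, inv (h x) (snd k - fd (\<lambda>x. h x w) x (fst k)))"
  have L: "linear (h (fst z))" if "z \<in> ?U" for z using that lin by auto
  have xw: "(x, w) \<in> ?U" using S by simp
  from has_derivative_linear_family[where h = "\<lambda>z. h (fst z)" and h' = "\<lambda>v k. fd (\<lambda>x. h x v) x (fst k)",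
      OF U xw L d has_derivative_snd[OF has_derivative_ident]]
  have "((\<lambda>z. h (fst z) (snd z)) has_derivative (\<lambda>k. fd (\<lambda>x. h x w) x (fst k) + h x (snd k))) (at (x, w))"
    by simp
  then have F: "(?F has_derivative ?F') (at (x, w))"
    by (intro has_derivative_Pair has_derivative_fst[OF has_derivative_ident])
  have "surj (h x)" using linear_injective_imp_surjective[OF lin inj] S(2) by blast
  then have FG: "?F' \<circ> ?G' = id"
    by (auto simp: fun_eq_iff surj_f_inv_f)
  have "(?G has_derivative ?G') (at (?F (x, w)))"
  proof (rule has_derivative_inverse_strong[where f = ?F and x = "(x, w)", OF U _ _ _ F FG])
    show "continuous_on ?U ?F"
      by (intro continuous_on_Pair smooth_on_imp_continuous_on smF smooth_on_fst smooth_on_ident U)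
    show "?G (?F z) = z" if "z \<in> ?U" for z
      using that inj by (auto simp: inv_f_f mem_Times_iff)
  qed (use S in auto)
  then have "((\<lambda>z. inv (h (fst z)) (snd z)) has_derivative (\<lambda>k. snd (?G' k))) (at (x, y))"
    using has_derivative_snd w by fastforce
  then show ?thesis by (rule differentiableI)
qed

text \<open>Bootstrap: once \<open>b\<close> is differentiable, \<open>fd b x v\<close> solves the
  system with the same coefficients \<open>h\<close> and the right side
  \<open>fd r x v - fd (\<lambda>y. h y (b x)) x v\<close>. The latter is of class \<open>k\<close>
  if \<open>b\<close> is, so the induction hypothesis is used first for \<open>b\<close> and then
  for its derivative.\<close>

lemma Ck_on_linear_solve:
  fixes h :: "'a::euclidean_space \<Rightarrow> 'b::euclidean_space \<Rightarrow> 'b"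
  assumes S: "open S" and lin: "\<And>x. x \<in> S \<Longrightarrow> linear (h x)"
    and inj: "\<And>x. x \<in> S \<Longrightarrow> inj (h x)" and h: "\<And>v. smooth_on S (\<lambda>x. h x v)"
    and b: "\<And>x. x \<in> S \<Longrightarrow> h x (b x) = r x" and r: "Ck_on k S r"
  shows "Ck_on k S b"
  using b r
proof (induction k arbitrary: b r)
  case 0
  have eq: "inv (h (fst (x, r x))) (snd (x, r x)) = b x" if "x \<in> S" for x
    using inv_f_f[OF inj[OF that], of "b x"] 0(1)[OF that] by simp
  have "isCont (\<lambda>x. inv (h (fst (x, r x))) (snd (x, r x))) x" if "x \<in> S" for x
  proof (rule isCont_o2[where f = "\<lambda>x. (x, r x)" and g = "\<lambda>z. inv (h (fst z)) (snd z)"])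
    show "isCont (\<lambda>x. (x, r x)) x"
      using 0(2) that continuous_on_eq_continuous_at[OF S] by (auto intro!: continuous_intros)
    show "isCont (\<lambda>z. inv (h (fst z)) (snd z)) (x, r x)"
      by (rule differentiable_imp_continuous_within[OF differentiable_linear_inverse[OF S that lin inj h]])
  qed
  then have "continuous_on S (\<lambda>x. inv (h (fst (x, r x))) (snd (x, r x)))"
    unfolding continuous_on_eq_continuous_at[OF S] by blast
  then show ?case
    using eq by (auto intro: continuous_on_eq)
next
  case (Suc k)
  have eq: "inv (h (fst (x, r x))) (snd (x, r x)) = b x" if "x \<in> S" for x
    using inv_f_f[OF inj[OF that], of "b x"] Suc.prems(1)[OF that] by simp
  have db: "b differentiable (at x)" if x: "x \<in> S" for x
  proof (rule differentiable_cong_open[OF S x eq])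
    have "(\<lambda>x. (x, r x)) differentiable (at x)"
      using Suc.prems(2) x by (simp add: differentiable_Pair)
    from differentiable_compose[OF differentiable_linear_inverse[OF S x lin inj h] this]
    show "(\<lambda>x. inv (h (fst (x, r x))) (snd (x, r x))) differentiable (at x)" .
  qed
  have bk: "Ck_on k S b"
    by (rule Suc.IH[OF Suc.prems(1)]) (use Suc.prems(2) Ck_on_Suc_imp in blast)+
  have "Ck_on k S (\<lambda>x. fd b x v)" for v
  proof (rule Suc.IH[where r = "\<lambda>x. fd r x v - fd (\<lambda>y. h y (b x)) x v"])
    fix x assume x: "x \<in> S"
    have "fd (\<lambda>x. h x (b x)) x = (\<lambda>k. fd (\<lambda>y. h y (b x)) x k + h x (fd b x k))"
      by (rule fd_eqI[OF has_derivative_linear_family[where h' = "\<lambda>v. fd (\<lambda>y. h y v) x", OF S x lin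
          smooth_on_has_derivative[OF h x] fd_works[OF db[OF x]]]])
    moreover have "fd (\<lambda>x. h x (b x)) x = fd r x"
      by (rule fd_cong[OF S x Suc.prems(1)])
    ultimately have "fd r x v = fd (\<lambda>y. h y (b x)) x v + h x (fd b x v)" by metis
    then show "h x (fd b x v) = fd r x v - fd (\<lambda>y. h y (b x)) x v"
      by simp
  next
    have "Ck_on k S (\<lambda>x. fd (\<lambda>y. h y (b x)) x v)"
      by (rule Ck_on_linear_family[where h = "\<lambda>x w. fd (\<lambda>y. h y w) x v", OF S linear_fd_family[OF S _ lin h] _ bk])
        (use smooth_on_fd[OF h] in \<open>auto simp: smooth_on_def\<close>)
    then have "Ck_on k S (\<lambda>x. fd r x v + - fd (\<lambda>y. h y (b x)) x v)"
      using Suc.prems(2) by (intro Ck_on_add S Ck_on_bounded_linear[OF S bounded_linear_minus[OF bounded_linear_ident]]) auto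
    then show "Ck_on k S (\<lambda>x. fd r x v - fd (\<lambda>y. h y (b x)) x v)"
      by simp
  qed
  then show ?case using db by simp
qed

lemma smooth_on_linear_solve:
  fixes h :: "'a::euclidean_space \<Rightarrow> 'b::euclidean_space \<Rightarrow> 'b"
  assumes "open S" "\<And>x. x \<in> S \<Longrightarrow> linear (h x)" "\<And>x. x \<in> S \<Longrightarrow> inj (h x)"
    "\<And>v. smooth_on S (\<lambda>x. h x v)" "\<And>x. x \<in> S \<Longrightarrow> h x (b x) = r x" "smooth_on S r"
  shows "smooth_on S b"
  unfolding smooth_on_def
  using Ck_on_linear_solve[OF assms(1-5)] assms(6) smooth_on_def by blast

locale regular = slit_bundle \<A> for \<A> :: "('m, 'e::euclidean_space) chart set" +
  fixes D :: "('m, 'e) connection"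
  assumes regular: "regular_connection \<A> D"
begin

lemmas linear_D = regular[unfolded regular_connection_def, THEN conjunct1, unfolded linear_connection_def]

section \<open>Regular connections pointwise and in lifted charts\<close>

lemma D_cong:
  "pi_field \<A> X \<Longrightarrow> pi_field \<A> Y \<Longrightarrow> (\<And>w. w \<in> slit \<A> \<Longrightarrow> X w = Y w) \<Longrightarrow> u \<in> slit \<A> \<Longrightarrow>
    a \<in> tspace2 \<A> u \<Longrightarrow> D X u a = D Y u a"
  using linear_D[THEN conjunct1] by blast

lemma D_tangent:
  "pi_field \<A> X \<Longrightarrow> u \<in> slit \<A> \<Longrightarrow> a \<in> tspace2 \<A> u \<Longrightarrow> D X u a \<in> tangent_space \<A> (fst u)"
  using linear_D[THEN conjunct2, THEN conjunct1] by blast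

lemma D_add_vec:
  "pi_field \<A> X \<Longrightarrow> u \<in> slit \<A> \<Longrightarrow> a \<in> tspace2 \<A> u \<Longrightarrow> b \<in> tspace2 \<A> u \<Longrightarrow>
    D X u (a + b) = D X u a + D X u b"
  using linear_D[THEN conjunct2, THEN conjunct1] by blast

lemma D_scale_vec:
  "pi_field \<A> X \<Longrightarrow> u \<in> slit \<A> \<Longrightarrow> a \<in> tspace2 \<A> u \<Longrightarrow> D X u (r *\<^sub>R a) = r *\<^sub>R D X u a"
  using linear_D[THEN conjunct2, THEN conjunct1] by blast

lemma D_add_sec:
  "pi_field \<A> X \<Longrightarrow> pi_field \<A> Y \<Longrightarrow> u \<in> slit \<A> \<Longrightarrow> a \<in> tspace2 \<A> u \<Longrightarrow>
    D (X + Y) u a = D X u a + D Y u a"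
  using linear_D[THEN conjunct2, THEN conjunct2, THEN conjunct1] by blast

text \<open>The connection in a lifted chart, as a function of the components \<open>\<xi>\<close>
  of the direction. It is linear in \<open>\<xi>\<close> and smooth in \<open>x\<close>, hence a
  smooth family of linear maps.\<close>

definition D_comp :: "('m, 'e) chart \<Rightarrow> ('m, 'e) pi_section \<Rightarrow> 'e \<times> 'e \<Rightarrow> 'e \<times> 'e \<Rightarrow> 'e" where
  "D_comp c X x \<xi> = (let u = chart_inv (lc c) x in D X u (coord_vec (slit_atlas \<A>) (lc c) \<xi> u) c)"

lemma D_comp_smooth:
  "pi_field \<A> X \<Longrightarrow> c \<in> \<A> \<Longrightarrow> smooth_on (img (lc c)) (\<lambda>x. D_comp c X x \<xi>)"
  using linear_D[THEN conjunct2, THEN conjunct1] unfolding D_comp_def by blast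

lemma D_sub_vec:
  assumes "pi_field \<A> X" "u \<in> slit \<A>" "a \<in> tspace2 \<A> u" "b \<in> tspace2 \<A> u"
  shows "D X u (a - b) = D X u a - D X u b"
  using D_add_vec[OF assms(1-3), of "(-1) *\<^sub>R b"] D_scale_vec[OF assms(1,2,4), of "-1"]
    slit.tangent_space_closed(3)[OF assms(4), of "-1"] by simp

lemma D_apply:
  assumes c: "c \<in> charts_at \<A> (fst u)" and u: "u \<in> slit \<A>" and a: "a \<in> tspace2 \<A> u"
  shows "D X u a c = D_comp c X (snd (lc c) u) (a (lc c))"
  using slit.coord_vec_eq[OF a lc_charts_at[OF c u]] by (simp add: D_comp_def Let_def lc_inv[OF c u])

lemma linear_D_comp:
  assumes X: "pi_field \<A> X" and c: "c \<in> \<A>" and x: "x \<in> img (lc c)"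
  shows "linear (D_comp c X x)"
proof -
  note u = img_lcD[OF c x]
  note t = slit.coord_vec_tangent[OF lc_charts_at[OF u(2,1)]]
  let ?u = "chart_inv (lc c) x"
  have D: "D_comp c X x (a (lc c)) = D X ?u a c" if "a \<in> tspace2 \<A> ?u" for a
    using D_apply[OF u(2,1) that] u(3) by simp
  show ?thesis
  proof (rule linearI)
    fix \<xi> \<zeta> r
    let ?v = "\<lambda>\<xi>. coord_vec (slit_atlas \<A>) (lc c) \<xi> ?u"
    note self = slit.coord_vec_self[OF lc_charts_at[OF u(2,1)]]
    have e: "D_comp c X x \<xi> = D X ?u (?v \<xi>) c" for \<xi>
      by (simp add: D_comp_def Let_def)
    have "D_comp c X x (\<xi> + \<zeta>) = D X ?u (?v \<xi> + ?v \<zeta>) c"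
      using D[OF slit.tangent_space_closed(1)[OF t t], of \<xi> \<zeta>] by (simp add: self)
    then show "D_comp c X x (\<xi> + \<zeta>) = D_comp c X x \<xi> + D_comp c X x \<zeta>"
      by (simp add: D_add_vec[OF X u(1) t t] e)
    have "D_comp c X x (r *\<^sub>R \<xi>) = D X ?u (r *\<^sub>R ?v \<xi>) c"
      using D[OF slit.tangent_space_closed(3)[OF t], of r \<xi>] by (simp add: self)
    then show "D_comp c X x (r *\<^sub>R \<xi>) = r *\<^sub>R D_comp c X x \<xi>"
      by (simp add: D_scale_vec[OF X u(1) t] e)
  qed
qed

lemma cov_pi_field:
  assumes A: "A \<in> slit.vfields" and X: "pi_field \<A> X"
  shows "pi_field \<A> (cov D A X)"
proof (rule pi_fieldI_tangent_comp)
  show "cov D A X u \<in> tangent_space \<A> (fst u)" if "u \<in> slit \<A>" for u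
    using D_tangent[OF X that slit.vfields_tangent[OF A]] by (simp add: cov_def)
  show "smooth_on (img (lc c)) (\<lambda>x. D_comp c X x (vcomp (lc c) A (lc c) x))" if c: "c \<in> \<A>" for c
    by (rule smooth_on_linear_family[where h = "D_comp c X", OF open_img_lc[OF c] linear_D_comp[OF X c]
        D_comp_smooth[OF X c] vfields_lc_smooth[OF A c]])
  show "cov D A X (chart_inv (lc c) x) c = D_comp c X x (vcomp (lc c) A (lc c) x)"
    if "c \<in> \<A>" "x \<in> img (lc c)" for c x
    using D_apply[OF img_lcD(2,1)[OF that] slit.vfields_tangent[OF A]] img_lcD(3)[OF that] by (simp add: cov_def)
qed

lemma D_zero_sec: "u \<in> slit \<A> \<Longrightarrow> a \<in> tspace2 \<A> u \<Longrightarrow> D 0 u a = 0"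
  using D_add_sec[of 0 0 u a] secs_pi_field[OF subspace_0[OF subspace_secs]] by simp

lemma horizontalD: "h \<in> horizontal \<A> D u \<Longrightarrow> h \<in> tspace2 \<A> u" "h \<in> horizontal \<A> D u \<Longrightarrow> D eta u h = 0"
  by (simp_all add: horizontal_def)

lemma vertical_horizontal:
  "a \<in> tspace2 \<A> u \<Longrightarrow> u \<in> slit \<A> \<Longrightarrow> rho \<A> u a = 0 \<Longrightarrow> D eta u a = 0 \<Longrightarrow> a = 0"
  using regular unfolding regular_connection_def vertical_def horizontal_def by blast

text \<open>The difference is both vertical and horizontal, hence \<open>0\<close> by regularity.
  All equalities of tangent vectors involving \<open>beta\<close> are reduced to this.\<close>

lemma tspace2_eq_iff_rho_D:
  assumes "a \<in> tspace2 \<A> u" "b \<in> tspace2 \<A> u" "u \<in> slit \<A>" "rho \<A> u a = rho \<A> u b" "D eta u a = D eta u b"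
  shows "a = b"
proof -
  have "a - b = 0"
    by (rule vertical_horizontal[of _ u])
      (simp_all add: assms rho_diff D_sub_vec[OF eta_pi_field] slit.tangent_space_closed)
  then show ?thesis by simp
qed

lemma inj_on_rho: "u \<in> slit \<A> \<Longrightarrow> inj_on (rho \<A> u) (horizontal \<A> D u)"
  by (rule inj_onI) (metis tspace2_eq_iff_rho_D horizontalD)

lemma beta_rho: "u \<in> slit \<A> \<Longrightarrow> h \<in> horizontal \<A> D u \<Longrightarrow> beta \<A> D u (rho \<A> u h) = h"
  unfolding beta_def by (rule the_inv_into_f_f[OF inj_on_rho])

text \<open>The coordinate vector with components \<open>(v c, 0)\<close> projects to
  \<open>v\<close>; discarding its vertical part does not change the projection.\<close>

lemma rho_horizontal_surj:
  assumes u: "u \<in> slit \<A>" and v: "v \<in> tangent_space \<A> (fst u)"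
  shows "v \<in> rho \<A> u ` horizontal \<A> D u"
proof -
  obtain c where c: "c \<in> charts_at \<A> (fst u)" using u by (rule slitE)
  note lcu = lc_charts_at[OF c u]
  let ?a = "coord_vec (slit_atlas \<A>) (lc c) (v c, 0) u"
  have a: "?a \<in> tspace2 \<A> u" by (rule slit.coord_vec_tangent[OF lcu])
  have "rho \<A> u ?a = v"
    by (rule tangent_eqI[OF rho_tangent[OF a u] v c]) (simp add: rho_apply[OF a u c] slit.coord_vec_self[OF lcu])
  moreover obtain w h where wh: "?a = w + h" "w \<in> vertical \<A> u" "h \<in> horizontal \<A> D u"
    using regular u a unfolding regular_connection_def by blast
  ultimately have "v = rho \<A> u h"
    using rho_add[of w u h] u by (simp add: vertical_def horizontalD(1)[OF wh(3)])
  then show ?thesis using wh(3) by blast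
qed

lemma beta_props:
  assumes "u \<in> slit \<A>" "v \<in> tangent_space \<A> (fst u)"
  shows "beta \<A> D u v \<in> tspace2 \<A> u" "rho \<A> u (beta \<A> D u v) = v" "D eta u (beta \<A> D u v) = 0"
proof -
  obtain h where h: "h \<in> horizontal \<A> D u" "v = rho \<A> u h"
    using rho_horizontal_surj[OF assms] by blast
  then have "beta \<A> D u v = h" by (simp add: beta_rho[OF assms(1)])
  then show "beta \<A> D u v \<in> tspace2 \<A> u" "rho \<A> u (beta \<A> D u v) = v" "D eta u (beta \<A> D u v) = 0"
    using h horizontalD by auto
qed

lemma beta_add:
  assumes "u \<in> slit \<A>" "v \<in> tangent_space \<A> (fst u)" "w \<in> tangent_space \<A> (fst u)"
  shows "beta \<A> D u (v + w) = beta \<A> D u v + beta \<A> D u w"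
  by (rule tspace2_eq_iff_rho_D[where u = u])
    (simp_all add: beta_props assms tangent_space_closed slit.tangent_space_closed rho_add D_add_vec[OF eta_pi_field])

text \<open>In a lifted chart the horizontal lift is \<open>(X, b)\<close> with \<open>b\<close>
  determined by \<open>D eta = 0\<close>. Splitting \<open>(X, b)\<close> as
  \<open>(X, 0) + (0, b)\<close> gives a linear system for \<open>b\<close> with smooth
  coefficients, to which \<open>smooth_on_linear_solve\<close> applies.\<close>

lemma beta_field_vfields:
  assumes X: "pi_field \<A> X" shows "res (beta_field \<A> D X) \<in> slit.vfields"
proof (rule slit_vfieldsI[where F = "\<lambda>c x. (vcomp (lc c) X c x, snd (vcomp (lc c) (res (beta_field \<A> D X)) (lc c) x))"])
  show "res (beta_field \<A> D X) u \<in> tspace2 \<A> u" if "u \<in> slit \<A>" for u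
    using that by (simp add: beta_field_def beta_props pi_field_tangent[OF X])
  show "res (beta_field \<A> D X) (chart_inv (lc c) x) (lc c) =
      (vcomp (lc c) X c x, snd (vcomp (lc c) (res (beta_field \<A> D X)) (lc c) x))"
    if c: "c \<in> \<A>" and x: "x \<in> img (lc c)" for c x
  proof -
    note u = img_lcD[OF c x]
    note b = beta_props[OF u(1) pi_field_tangent[OF X u(1)]]
    show ?thesis
      using rho_apply[OF b(1) u(1,2)] b(2) u(1) by (simp add: beta_field_def prod_eq_iff)
  qed
  fix c assume c: "c \<in> \<A>"
  note S = open_img_lc[OF c]
  let ?b = "\<lambda>x. snd (vcomp (lc c) (res (beta_field \<A> D X)) (lc c) x)"
  have lin: "linear (\<lambda>w. D_comp c eta x (0, w))" if "x \<in> img (lc c)" for x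
  proof -
    have "linear (\<lambda>w::'e. (0::'e, w))" by (intro linearI) auto
    from linear_compose[OF this linear_D_comp[OF eta_pi_field c that]] show ?thesis by (simp add: comp_def)
  qed
  have "smooth_on (img (lc c)) ?b"
  proof (rule smooth_on_linear_solve[where h = "\<lambda>x w. D_comp c eta x (0, w)" and r = "\<lambda>x. - D_comp c eta x (vcomp (lc c) X c x, 0)"])
    show "open (img (lc c))" by (rule S)
    show "linear (\<lambda>w. D_comp c eta x (0, w))" if "x \<in> img (lc c)" for x by (rule lin[OF that])
    \<comment> \<open>Regularity enters here: a vector \<open>(0, w)\<close> annihilated by
      \<open>D eta\<close> is vertical and horizontal at once.\<close>
    show "inj (\<lambda>w. D_comp c eta x (0, w))" if x: "x \<in> img (lc c)" for x
      unfolding linear_injective_0[OF lin[OF x]]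
    proof (intro allI impI)
      fix w assume w: "D_comp c eta x (0, w) = 0"
      note u = img_lcD[OF c x]
      note lcu = lc_charts_at[OF u(2,1)]
      let ?u = "chart_inv (lc c) x" and ?a = "coord_vec (slit_atlas \<A>) (lc c) (0, w) (chart_inv (lc c) x)"
      note a = slit.coord_vec_tangent[OF lcu, of "(0, w)"]
      have "rho \<A> ?u ?a = 0"
        by (rule tangent_eqI[OF rho_tangent[OF a u(1)] tangent_space_closed(5) u(2)])
          (simp add: rho_apply[OF a u(1,2)] slit.coord_vec_self[OF lcu])
      moreover have "D eta ?u ?a = 0"
        by (rule tangent_eqI[OF D_tangent[OF eta_pi_field u(1) a] tangent_space_closed(5) u(2)])
          (use w in \<open>simp add: D_comp_def Let_def\<close>)
      ultimately have "?a = 0" by (rule vertical_horizontal[OF a u(1)])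
      then have "?a (lc c) = 0" by simp
      then show "w = 0" unfolding slit.coord_vec_self[OF lcu] by (simp add: zero_prod_def)
    qed
    show "smooth_on (img (lc c)) (\<lambda>x. D_comp c eta x (0, v))" for v
      by (rule D_comp_smooth[OF eta_pi_field c])
    show "smooth_on (img (lc c)) (\<lambda>x. - D_comp c eta x (vcomp (lc c) X c x, 0))"
      by (intro smooth_on_minus S smooth_on_linear_family[where h = "D_comp c eta", OF S linear_D_comp[OF eta_pi_field c]
        D_comp_smooth[OF eta_pi_field c]] smooth_on_Pair smooth_on_const pi_field_smooth[OF X c])
    show "D_comp c eta x (0, ?b x) = - D_comp c eta x (vcomp (lc c) X c x, 0)" if x: "x \<in> img (lc c)" for x
    proof -
      note u = img_lcD[OF c x]
      note b = beta_props[OF u(1) pi_field_tangent[OF X u(1)]]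
      have "res (beta_field \<A> D X) (chart_inv (lc c) x) (lc c) = (vcomp (lc c) X c x, ?b x)"
        using rho_apply[OF b(1) u(1,2)] b(2) u(1) by (simp add: beta_field_def prod_eq_iff)
      then have "D_comp c eta x (vcomp (lc c) X c x, ?b x) = 0"
        using D_apply[OF u(2,1) b(1), of eta] b(3) u by (simp add: beta_field_def)
      moreover have "D_comp c eta x (vcomp (lc c) X c x, ?b x) =
          D_comp c eta x (vcomp (lc c) X c x, 0) + D_comp c eta x (0, ?b x)"
        using linear_add[OF linear_D_comp[OF eta_pi_field c x], of "(vcomp (lc c) X c x, 0)" "(0, ?b x)"] by simp
      ultimately show ?thesis by (simp add: eq_neg_iff_add_eq_0 add.commute)
    qed
  qed
  then show "smooth_on (img (lc c)) (\<lambda>x. (vcomp (lc c) X c x, ?b x))"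
    by (intro smooth_on_Pair S pi_field_smooth[OF X c])
qed simp

end


section \<open>The Cartan connection\<close>

context slit_bundle
begin

lemma pi_field_iff_res: "pi_field \<A> X \<longleftrightarrow> res X \<in> secs"
  using res_secs pi_field_cong[OF secs_pi_field, of "res X" X] by auto

lemma res_add: "res (A + B) = res A + (res B :: _ \<Rightarrow> 'b::ab_group_add)"
  by (auto simp: res_def fun_eq_iff)

lemma res_diff: "res (A - B) = res A - (res B :: _ \<Rightarrow> 'b::ab_group_add)"
  by (auto simp: res_def fun_eq_iff)

lemma res_minus: "res (- A) = - (res A :: _ \<Rightarrow> 'b::ab_group_add)"
  by (auto simp: res_def fun_eq_iff)

lemma fd_vcomp_res:
  assumes "c' \<in> charts_at (slit_atlas \<A>) u"
  shows "fd (\<lambda>x. res F (chart_inv c' x)) (snd c' u) = fd (\<lambda>x. F (chart_inv c' x)) (snd c' u)"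
    and "fd (vcomp c' (res A) d) (snd c' u) = fd (vcomp c' A d) (snd c' u)"
proof -
  obtain c where c: "c' = lc c" "c \<in> charts_at \<A> (fst u)" "u \<in> slit \<A>"
    using assms by (rule slit_charts_atE)
  note S = open_img_lc[OF charts_atD(1)[OF c(2)]] lc_in_img[OF c(2,3)]
  note i = img_lcD(1)[OF charts_atD(1)[OF c(2)]]
  show "fd (\<lambda>x. res F (chart_inv c' x)) (snd c' u) = fd (\<lambda>x. F (chart_inv c' x)) (snd c' u)"
    unfolding c(1) by (rule fd_cong[OF S]) (simp add: i)
  show "fd (vcomp c' (res A) d) (snd c' u) = fd (vcomp c' A d) (snd c' u)"
    unfolding c(1) by (rule fd_cong[OF S]) (simp add: i)
qed

lemma lie_bracket_res: "lie_bracket (slit_atlas \<A>) (res A) (res B) = lie_bracket (slit_atlas \<A>) A B"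
proof (intro ext)
  fix u c
  show "lie_bracket (slit_atlas \<A>) (res A) (res B) u c = lie_bracket (slit_atlas \<A>) A B u c"
  proof (cases "c \<in> charts_at (slit_atlas \<A>) u")
    case True
    moreover from this have "u \<in> slit \<A>" by (rule slit_charts_atE)
    ultimately show ?thesis by (simp add: slit.lie_bracket_apply fd_vcomp_res(2))
  qed (simp add: slit.lie_bracket_off)
qed

lemma dir_deriv_res:
  assumes "u \<in> slit \<A>"
  shows "dir_deriv (slit_atlas \<A>) u a (res f) = dir_deriv (slit_atlas \<A>) u a f"
proof -
  have "some_chart (slit_atlas \<A>) u \<in> charts_at (slit_atlas \<A>) u"
    using slit.some_chart_charts_at slit_charts_at_empty_iff assms by blast
  from fd_vcomp_res(1)[OF this, of f] show ?thesis
    by (simp add: dir_deriv_def Let_def comp_def)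
qed

end

locale cartan = finsler \<A> M L + regular \<A> D
  for \<A> :: "('m, 'e::euclidean_space) chart set" and M L D +
  assumes cartan: "cartan_connection \<A> L D"
begin

text \<open>Normalised, these operators map \<open>secs\<close> and \<open>slit.vfields\<close> into
  each other and satisfy equations of functions. \<open>ga\<close> and \<open>br\<close> vanish off
  the slit tangent bundle by themselves.\<close>

definition cv :: "('m, 'e) field2 \<Rightarrow> ('m, 'e) pi_section \<Rightarrow> ('m, 'e) pi_section" where
  "cv A X = res (cov D A X)"

definition rh :: "('m, 'e) field2 \<Rightarrow> ('m, 'e) pi_section" where
  "rh A = res (rho_field \<A> A)"

definition be :: "('m, 'e) pi_section \<Rightarrow> ('m, 'e) field2" where
  "be X = res (beta_field \<A> D X)"

definition gm :: "('m, 'e) pi_section \<Rightarrow> ('m, 'e) pi_section \<Rightarrow> ('m, 'e) tpoint \<Rightarrow> real" where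
  "gm X Y = res (\<lambda>u. g u (X u) (Y u))"

abbreviation ga :: "('m, 'e) pi_section \<Rightarrow> ('m, 'e) field2" where
  "ga \<equiv> gamma_field \<A>"

abbreviation br :: "('m, 'e) field2 \<Rightarrow> ('m, 'e) field2 \<Rightarrow> ('m, 'e) field2" where
  "br \<equiv> lie_bracket (slit_atlas \<A>)"

lemma cv_apply: "u \<in> slit \<A> \<Longrightarrow> cv A X u = D X u (A u)"
  by (simp add: cv_def cov_def)

lemma rh_apply: "u \<in> slit \<A> \<Longrightarrow> rh A u = rho \<A> u (A u)"
  by (simp add: rh_def rho_field_def)

lemma be_apply: "u \<in> slit \<A> \<Longrightarrow> be X u = beta \<A> D u (X u)"
  by (simp add: be_def beta_field_def)

lemma gm_apply: "u \<in> slit \<A> \<Longrightarrow> gm X Y u = g u (X u) (Y u)"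
  by (simp add: gm_def)

lemma cv_secs: "A \<in> slit.vfields \<Longrightarrow> X \<in> secs \<Longrightarrow> cv A X \<in> secs"
  unfolding cv_def by (intro res_secs cov_pi_field secs_pi_field)

lemma rh_secs: "A \<in> slit.vfields \<Longrightarrow> rh A \<in> secs"
  unfolding rh_def by (intro res_secs rho_field_pi_field)

lemma be_vfields: "X \<in> secs \<Longrightarrow> be X \<in> slit.vfields"
  unfolding be_def by (intro beta_field_vfields secs_pi_field)

lemma ga_vfields: "X \<in> secs \<Longrightarrow> ga X \<in> slit.vfields"
  by (intro gamma_field_vfields secs_pi_field)

lemma secs_tangent: "X \<in> secs \<Longrightarrow> u \<in> slit \<A> \<Longrightarrow> X u \<in> tangent_space \<A> (fst u)"
  by (rule pi_field_tangent[OF secs_pi_field])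

lemmas secs_closed = subspace_add[OF subspace_secs] subspace_diff[OF subspace_secs] subspace_0[OF subspace_secs]

lemma rh_be: "X \<in> secs \<Longrightarrow> rh (be X) = X"
  by (rule secs_eqI[OF rh_secs[OF be_vfields]])
    (simp_all add: rh_apply be_apply beta_props secs_tangent)

lemma rh_ga: "X \<in> secs \<Longrightarrow> rh (ga X) = 0"
  by (rule secs_eqI[OF rh_secs[OF ga_vfields] secs_closed(3)])
    (simp_all add: rh_apply gamma_field_def rho_gamma secs_tangent)

lemma cv_zero: "A \<in> slit.vfields \<Longrightarrow> cv A 0 = 0"
  by (rule secs_eqI[OF cv_secs secs_closed(3)])
    (simp_all add: cv_apply D_zero_sec slit.vfields_tangent secs_closed)

lemma eta_secs: "res eta \<in> secs"
  by (rule res_secs[OF eta_pi_field])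

lemma cv_eta: "A \<in> slit.vfields \<Longrightarrow> u \<in> slit \<A> \<Longrightarrow> cv A (res eta) u = D eta u (A u)"
  by (simp add: cv_apply) (rule D_cong[OF pi_field_res[OF eta_pi_field] eta_pi_field], simp_all add: slit.vfields_tangent)

lemma cv_be_eta: "X \<in> secs \<Longrightarrow> cv (be X) (res eta) = 0"
  by (rule secs_eqI[OF cv_secs[OF be_vfields eta_secs] secs_closed(3)])
    (simp_all add: cv_eta be_vfields, simp add: be_apply beta_props secs_tangent)

text \<open>By \<open>D_cong\<close> the values of \<open>X\<close> off the slit tangent bundle do
  not influence \<open>D X\<close> on it. The smoothness claim is then read off from the normalised
  side.\<close>

lemma cov_res:
  assumes A: "res A \<in> slit.vfields" and X: "pi_field \<A> X"
  shows "res (cov D A X) = cv (res A) (res X)" "pi_field \<A> (cov D A X)"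
proof -
  show *: "res (cov D A X) = cv (res A) (res X)"
  proof (rule ext)
    fix u
    show "res (cov D A X) u = cv (res A) (res X) u"
    proof (cases "u \<in> slit \<A>")
      case True
      then have "D X u (A u) = D (res X) u (A u)"
        using slit.vfields_tangent[OF A, of u] by (intro D_cong X pi_field_res) simp_all
      then show ?thesis using True by (simp add: cv_apply cov_def)
    qed (simp add: cv_def)
  qed
  show "pi_field \<A> (cov D A X)"
    unfolding pi_field_iff_res * by (intro cv_secs A res_secs X)
qed

lemma rho_field_res: "res (rho_field \<A> A) = rh (res A)"
  by (auto simp: rh_def res_def rho_field_def fun_eq_iff)

lemma beta_field_res: "res (beta_field \<A> D X) = be (res X)"
  by (auto simp: be_def res_def beta_field_def fun_eq_iff)

lemma gamma_field_res: "res (gamma_field \<A> X) = ga (res X)"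
  by (auto simp: res_def gamma_field_def gamma_zero fun_eq_iff)

section \<open>The torsion in normalised form and in lifted charts\<close>

lemma torsion_res:
  assumes "res A \<in> slit.vfields" "res B \<in> slit.vfields"
  shows "res (torsion \<A> D A B) = cv (res A) (rh (res B)) - cv (res B) (rh (res A)) - rh (br (res A) (res B))"
proof -
  have "pi_field \<A> (rho_field \<A> A)" "pi_field \<A> (rho_field \<A> B)"
    using rh_secs assms by (simp_all add: pi_field_iff_res rho_field_res)
  then show ?thesis
    by (simp add: torsion_def res_diff cov_res assms rho_field_res lie_bracket_res
        res_vfields_eq[OF slit.lie_bracket_vfields[OF assms, unfolded lie_bracket_res]])
qed

text \<open>\<open>T\<close> after simplification by \<open>rh (be Y) = Y\<close> and
  \<open>rh (ga X) = 0\<close>. It is studied before \<open>cartan_calculus\<close> is interpreted,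
  because it has to supply the assumptions made there on torsion.\<close>

definition tors :: "('m, 'e) pi_section \<Rightarrow> ('m, 'e) pi_section \<Rightarrow> ('m, 'e) pi_section" where
  "tors X Y = cv (ga X) Y - rh (br (ga X) (be Y))"

lemma tors_secs: "X \<in> secs \<Longrightarrow> Y \<in> secs \<Longrightarrow> tors X Y \<in> secs"
  unfolding tors_def by (intro secs_closed cv_secs rh_secs slit.lie_bracket_vfields be_vfields ga_vfields)

lemma T_torsion_tors: "X \<in> secs \<Longrightarrow> Y \<in> secs \<Longrightarrow> res (T_torsion \<A> D X Y) = tors X Y"
  unfolding T_torsion_def
  by (subst torsion_res)
    (simp_all add: beta_field_res gamma_field_res res_secs_eq be_vfields ga_vfields rh_be rh_ga cv_zero tors_def)

text \<open>Along the fibres, \<open>tors\<close> is the difference of the covariant derivative and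
  the flat derivative in the fibre coordinates, since the bracket contributes just its first
  component.\<close>

lemma tors_apply:
  assumes X: "X \<in> secs" and Y: "Y \<in> secs" and u: "u \<in> slit \<A>" and c: "c \<in> charts_at \<A> (fst u)"
  shows "tors X Y u c = D Y u (gamma \<A> u (X u)) c - fibre_deriv c X Y u"
proof -
  have "fst (br (ga X) (be Y) u (lc c)) = fibre_deriv c X Y u"
  proof (rule lie_bracket_gamma_apply[OF c u secs_pi_field[OF X]])
    show "vcomp (lc c) (be Y) (lc c) differentiable (at (snd (lc c) u))"
      by (rule slit.vfields_differentiable[OF be_vfields[OF Y] lc_charts_at[OF c u]])
    show "fst (be Y w (lc c)) = Y w c" if "w \<in> slit \<A>" "c \<in> charts_at \<A> (fst w)" for w
      using rho_apply[OF slit.vfields_tangent[OF be_vfields[OF Y]] that]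
      by (metis rh_be[OF Y] rh_apply that(1))
  qed
  then show ?thesis
    using rho_apply[OF slit.vfields_tangent[OF slit.lie_bracket_vfields[OF ga_vfields[OF X] be_vfields[OF Y]]] u c]
    by (simp add: tors_def cv_apply u rh_apply gamma_field_def)
qed

lemma tors_metric:
  assumes X: "X \<in> secs" and Y: "Y \<in> secs" and Z: "Z \<in> secs" and u: "u \<in> slit \<A>"
  shows "g u (tors X Y u) (Z u) = g u (tors X Z u) (Y u)"
proof -
  have "g u (T_torsion \<A> D X Y u) (Z u) = g u (T_torsion \<A> D X Z u) (Y u)"
    using cartan[unfolded cartan_connection_def, THEN conjunct2, THEN conjunct2, THEN conjunct2]
      secs_pi_field[OF X] secs_pi_field[OF Y] secs_pi_field[OF Z] u by blast
  then show ?thesis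
    using fun_cong[OF T_torsion_tors[OF X Y], of u] fun_cong[OF T_torsion_tors[OF X Z], of u] u by simp
qed

text \<open>Koszul's argument along the fibres: \<open>T\<close> is half the fibre derivative of the metric, which is
  the totally symmetric third derivative of the energy.\<close>

lemma tors_cartan_tensor:
  assumes X: "X \<in> secs" and Y: "Y \<in> secs" and Z: "Z \<in> secs" and u: "u \<in> slit \<A>"
    and c: "c \<in> charts_at \<A> (fst u)"
  shows "2 * g u (tors X Y u) (Z u) = cartan_tensor c (snd (lc c) u) (X u c) (Y u c) (Z u c)"
proof -
  note c' = charts_atD(1)[OF c]
  note z = lc_in_img[OF c u]
  let ?a = "gamma \<A> u (X u)"
  note pX = secs_pi_field[OF X] and pY = secs_pi_field[OF Y] and pZ = secs_pi_field[OF Z]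
  have a: "?a \<in> tspace2 \<A> u" by (rule gamma_tangent[OF secs_tangent[OF X u] u])
  note DY = D_tangent[OF pY u a] and DZ = D_tangent[OF pZ u a]
  have "dir_deriv (slit_atlas \<A>) u ?a (\<lambda>w. g w (Y w) (Z w)) = g u (D Y u ?a) (Z u) + g u (Y u) (D Z u ?a)"
    using cartan pY pZ u a unfolding cartan_connection_def by blast
  then have "hess c (snd (lc c) u) (D Y u ?a c) (Z u c) + hess c (snd (lc c) u) (Y u c) (D Z u ?a c) =
      cartan_tensor c (snd (lc c) u) (X u c) (Y u c) (Z u c)
      + hess c (snd (lc c) u) (fibre_deriv c X Y u) (Z u c) + hess c (snd (lc c) u) (Y u c) (fibre_deriv c X Z u)"
    unfolding dir_deriv_metric_gamma[OF c u pX pY pZ]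
    by (simp add: metric_apply[OF c u] DY DZ secs_tangent[OF Y u] secs_tangent[OF Z u])
  then have "hess c (snd (lc c) u) (tors X Y u c) (Z u c) + hess c (snd (lc c) u) (Y u c) (tors X Z u c)
      = cartan_tensor c (snd (lc c) u) (X u c) (Y u c) (Z u c)"
    by (simp add: tors_apply[OF X Y u c] tors_apply[OF X Z u c] linear_diff[OF linear_hess_left[OF c' z]]
        linear_diff[OF linear_hess_right[OF c' z]])
  then have "g u (tors X Y u) (Z u) + g u (Y u) (tors X Z u) = cartan_tensor c (snd (lc c) u) (X u c) (Y u c) (Z u c)"
    by (simp add: metric_apply[OF c u] secs_tangent[OF _ u] X Y Z tors_secs)
  \<comment> \<open>By \<open>tors_metric\<close> and the symmetry of \<open>g\<close> both summands
    on the left are equal.\<close>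
  then show ?thesis
    using tors_metric[OF X Y Z u] metric_sym[OF u secs_tangent[OF Y u] secs_tangent[OF tors_secs[OF X Z] u]]
    by simp
qed

text \<open>The test section is \<open>X - Y\<close>, so no single tangent vector has to be extended
  to a section.\<close>

lemma secs_metric_eqI:
  assumes X: "X \<in> secs" and Y: "Y \<in> secs"
    and eq: "\<And>u Z. u \<in> slit \<A> \<Longrightarrow> Z \<in> secs \<Longrightarrow> g u (X u) (Z u) = g u (Y u) (Z u)"
  shows "X = Y"
proof (rule secs_eqI[OF X Y])
  fix u assume u: "u \<in> slit \<A>"
  let ?Z = "X - Y"
  have Z: "?Z \<in> secs" by (rule secs_closed(2)[OF X Y])
  have "g u (?Z u + Y u) (?Z u) = g u (?Z u) (?Z u) + g u (Y u) (?Z u)"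
    by (rule metric_add_left[OF u]) (rule secs_tangent[OF _ u], rule Z Y)+
  then have "g u (?Z u) (?Z u) = 0" using eq[OF u Z] by simp
  from metric_zero_iff[OF u secs_tangent[OF Z u] this] show "X u = Y u" by simp
qed

lemma tors_sym: "X \<in> secs \<Longrightarrow> Y \<in> secs \<Longrightarrow> tors X Y = tors Y X"
proof (rule secs_metric_eqI)
  fix u Z assume XY: "X \<in> secs" "Y \<in> secs" and u: "u \<in> slit \<A>" and Z: "Z \<in> secs"
  obtain c where c: "c \<in> charts_at \<A> (fst u)" using u by (rule slitE)
  show "g u (tors X Y u) (Z u) = g u (tors Y X u) (Z u)"
    using tors_cartan_tensor[OF XY Z u c] tors_cartan_tensor[OF XY(2,1) Z u c]
      cartan_tensor_sym12[OF charts_atD(1)[OF c] lc_in_img[OF c u]] by simp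
qed (auto intro: tors_secs)

lemma tors_eta: "X \<in> secs \<Longrightarrow> tors X (res eta) = 0"
proof (rule secs_metric_eqI)
  fix u Z assume X: "X \<in> secs" and u: "u \<in> slit \<A>" and Z: "Z \<in> secs"
  obtain c where c: "c \<in> charts_at \<A> (fst u)" using u by (rule slitE)
  \<comment> \<open>Additivity gives \<open>g u 0 (Z u) = 0\<close>.\<close>
  have "g u (0 + 0) (Z u) = g u 0 (Z u) + g u 0 (Z u)"
    by (rule metric_add_left[OF u]) (simp_all add: tangent_space_closed secs_tangent[OF Z u])
  then show "g u (tors X (res eta) u) (Z u) = g u (0 u) (Z u)"
    using tors_cartan_tensor[OF X eta_secs Z u c]
      cartan_tensor_euler[OF charts_atD(1)[OF c] lc_in_img[OF c u], of "X u c" "Z u c"] u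
    by (simp add: eta_def lc_apply)
qed (auto intro: tors_secs eta_secs secs_closed)

lemma fibre_deriv_eta:
  assumes c: "c \<in> charts_at \<A> (fst u)" and u: "u \<in> slit \<A>"
  shows "fibre_deriv c X (res eta) u = X u c"
proof -
  note c' = charts_atD(1)[OF c]
  have "fd (vcomp (lc c) (res eta) c) (snd (lc c) u) = fd snd (snd (lc c) u)"
  proof (rule fd_cong[OF open_img_lc[OF c'] lc_in_img[OF c u]])
    fix x assume x: "x \<in> img (lc c)"
    show "vcomp (lc c) (res eta) c x = snd x"
      using img_lcD[OF c' x] by (simp add: eta_def lc_apply prod_eq_iff)
  qed
  also have "\<dots> = snd" by (rule fd_eqI[OF has_derivative_snd[OF has_derivative_ident]])
  finally show ?thesis by (simp add: fibre_deriv_def)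
qed

text \<open>In fibre coordinates \<open>eta\<close> is the identity, so its flat derivative along
  \<open>X\<close> is \<open>X\<close>; by \<open>tors_eta\<close> the covariant derivative agrees
  with the flat one.\<close>

lemma cv_ga_eta: "X \<in> secs \<Longrightarrow> cv (ga X) (res eta) = X"
proof (rule secs_eqI)
  fix u assume X: "X \<in> secs" and u: "u \<in> slit \<A>"
  obtain c where c: "c \<in> charts_at \<A> (fst u)" using u by (rule slitE)
  have "cv (ga X) (res eta) u c = X u c"
    using tors_apply[OF X eta_secs u c] tors_eta[OF X] fibre_deriv_eta[OF c u]
    by (simp add: cv_apply u gamma_field_def)
  then show "cv (ga X) (res eta) u = X u"
    by (intro tangent_eqI[OF secs_tangent[OF _ u] secs_tangent[OF X u] c] cv_secs ga_vfields X eta_secs)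
qed (auto intro: cv_secs ga_vfields eta_secs)

text \<open>Both sides have the same values under \<open>rho\<close> and under \<open>D eta\<close>,
  which determine a tangent vector.\<close>

lemma vf_decomp:
  assumes A: "A \<in> slit.vfields" shows "A = be (rh A) + ga (cv A (res eta))"
proof (rule ext)
  fix u
  let ?B = "be (rh A) + ga (cv A (res eta))"
  note cA = cv_secs[OF A eta_secs]
  note parts = be_vfields[OF rh_secs[OF A]] ga_vfields[OF cA]
  have B: "?B \<in> slit.vfields" by (rule subspace_add[OF slit.subspace_vfields parts])
  show "A u = ?B u"
  proof (cases "u \<in> slit \<A>")
    case u: True
    show ?thesis
    proof (rule tspace2_eq_iff_rho_D[OF slit.vfields_tangent[OF A] slit.vfields_tangent[OF B] u])
      show "rho \<A> u (A u) = rho \<A> u (?B u)"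
        using fun_cong[OF rh_be[OF rh_secs[OF A]], of u] fun_cong[OF rh_ga[OF cA], of u]
        by (simp add: rho_add[OF slit.vfields_tangent[OF parts(1)] slit.vfields_tangent[OF parts(2)] u] rh_apply u)
      show "D eta u (A u) = D eta u (?B u)"
        using fun_cong[OF cv_be_eta[OF rh_secs[OF A]], of u] fun_cong[OF cv_ga_eta[OF cA], of u]
        by (simp add: D_add_vec[OF eta_pi_field u slit.vfields_tangent[OF parts(1)] slit.vfields_tangent[OF parts(2)]]
            cv_eta u A parts)
    qed
  next
    case False
    then show ?thesis
      using tspace2_off[OF slit.vfields_tangent[OF A]] tspace2_off[OF slit.vfields_tangent[OF B]] by metis
  qed
qed

text \<open>In a chart the bracket is vertical, with component the difference of two flat fibre
  derivatives. Symmetry of \<open>tors\<close> says that the corrections from flat to covariant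
  derivatives are equal, so they cancel in the difference.\<close>

lemma br_ga_ga:
  assumes X: "X \<in> secs" and Y: "Y \<in> secs"
  shows "br (ga X) (ga Y) = ga (cv (ga X) Y - cv (ga Y) X)"
proof (rule slit.vfields_eqI)
  show "br (ga X) (ga Y) \<in> slit.vfields" "ga (cv (ga X) Y - cv (ga Y) X) \<in> slit.vfields"
    by (intro slit.lie_bracket_vfields ga_vfields secs_closed cv_secs X Y)+
  fix u c' assume "c' \<in> charts_at (slit_atlas \<A>) u"
  then obtain c where c: "c' = lc c" "c \<in> charts_at \<A> (fst u)" and u: "u \<in> slit \<A>" by (rule slit_charts_atE)
  have "D Y u (gamma \<A> u (X u)) c - fibre_deriv c X Y u = D X u (gamma \<A> u (Y u)) c - fibre_deriv c Y X u"
    using tors_sym[OF X Y] tors_apply[OF X Y u c(2)] tors_apply[OF Y X u c(2)] by simp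
  then show "br (ga X) (ga Y) u c' = ga (cv (ga X) Y - cv (ga Y) X) u c'"
    by (simp add: c(1) lie_bracket_gamma_gamma_apply[OF c(2) u secs_pi_field[OF X] secs_pi_field[OF Y]]
        gamma_field_apply[OF c(2) u] cv_apply u) (simp add: gamma_field_def algebra_simps)
qed

section \<open>Verification of the assumptions of the abstract calculus\<close>

lemma be_torsion_free:
  assumes X: "X \<in> secs" and Y: "Y \<in> secs"
  shows "cv (be X) Y - cv (be Y) X - rh (br (be X) (be Y)) = 0"
proof -
  have "res (Q_torsion \<A> D X Y) = cv (be X) Y - cv (be Y) X - rh (br (be X) (be Y))"
    unfolding Q_torsion_def
    by (subst torsion_res) (simp_all add: beta_field_res res_secs_eq be_vfields rh_be X Y)
  moreover have "res (Q_torsion \<A> D X Y) = 0"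
    using cartan secs_pi_field[OF X] secs_pi_field[OF Y] by (auto simp: cartan_connection_def res_def fun_eq_iff)
  ultimately show ?thesis by simp
qed

lemma der_gm:
  assumes A: "A \<in> slit.vfields" and X: "X \<in> secs" and Y: "Y \<in> secs"
  shows "slit.der A (gm X Y) = gm (cv A X) Y + gm X (cv A Y)"
proof (rule ext)
  fix u
  show "slit.der A (gm X Y) u = (gm (cv A X) Y + gm X (cv A Y)) u"
  proof (cases "u \<in> slit \<A>")
    case u: True
    have "dir_deriv (slit_atlas \<A>) u (A u) (\<lambda>w. g w (X w) (Y w)) = g u (D X u (A u)) (Y u) + g u (X u) (D Y u (A u))"
      using cartan secs_pi_field[OF X] secs_pi_field[OF Y] u slit.vfields_tangent[OF A]
      unfolding cartan_connection_def by blast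
    then show ?thesis
      using u by (simp add: slit.der_def slit_charts_at_empty_iff gm_def dir_deriv_res cv_apply)
  qed (simp add: slit.der_def slit_charts_at_empty_iff gm_def)
qed

lemma cv_add_left:
  assumes "X \<in> secs" "A \<in> slit.vfields" "B \<in> slit.vfields" shows "cv (A + B) X = cv A X + cv B X"
proof (rule ext)
  fix u show "cv (A + B) X u = (cv A X + cv B X) u"
    using D_add_vec[OF secs_pi_field[OF assms(1)] _ slit.vfields_tangent slit.vfields_tangent, of u A B] assms
    by (cases "u \<in> slit \<A>") (simp_all add: cv_apply, simp add: cv_def)
qed

lemma cv_add_right:
  assumes "A \<in> slit.vfields" "X \<in> secs" "Y \<in> secs" shows "cv A (X + Y) = cv A X + cv A Y"
proof (rule ext)
  fix u show "cv A (X + Y) u = (cv A X + cv A Y) u"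
    using D_add_sec[OF secs_pi_field secs_pi_field _ slit.vfields_tangent, of X Y u A] assms
    by (cases "u \<in> slit \<A>") (simp_all add: cv_apply, simp add: cv_def)
qed

lemma rh_add:
  assumes "A \<in> slit.vfields" "B \<in> slit.vfields" shows "rh (A + B) = rh A + rh B"
proof (rule ext)
  fix u show "rh (A + B) u = (rh A + rh B) u"
    using rho_add[OF slit.vfields_tangent slit.vfields_tangent, of A B u] assms
    by (cases "u \<in> slit \<A>") (simp_all add: rh_apply, simp add: rh_def)
qed

lemma be_add:
  assumes "X \<in> secs" "Y \<in> secs" shows "be (X + Y) = be X + be Y"
proof (rule ext)
  fix u show "be (X + Y) u = (be X + be Y) u"
    using beta_add[OF _ secs_tangent secs_tangent, of u X Y] assms
    by (cases "u \<in> slit \<A>") (simp_all add: be_apply, simp add: be_def)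
qed

lemma ga_add: "ga (X + Y) = ga X + ga Y"
  by (rule ext) (simp add: gamma_field_def gamma_add)

lemma gm_add:
  assumes "Z \<in> secs" "X \<in> secs" "Y \<in> secs" shows "gm (X + Y) Z = gm X Z + gm Y Z"
proof (rule ext)
  fix u show "gm (X + Y) Z u = (gm X Z + gm Y Z) u"
    using metric_add_left[OF _ secs_tangent secs_tangent secs_tangent, of u X Y Z] assms
    by (cases "u \<in> slit \<A>") (simp_all add: gm_def)
qed

lemma gm_sym: "X \<in> secs \<Longrightarrow> Y \<in> secs \<Longrightarrow> gm X Y = gm Y X"
  unfolding gm_def res_def by (rule ext) (simp add: metric_sym secs_tangent)

lemma gm_nondegenerate:
  assumes "X \<in> secs" "gm X X = 0" shows "X = 0"
proof (rule secs_eqI[OF assms(1) secs_closed(3)])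
  fix u assume u: "u \<in> slit \<A>"
  show "X u = 0 u"
    using metric_zero_iff[OF u secs_tangent[OF assms(1) u]] fun_cong[OF assms(2), of u] u by (simp add: gm_def)
qed

lemma cartan_calculus: "cartan_calculus secs slit.vfields slit.fns cv br rh be ga gm slit.der (res eta)"
proof
  show "cv (ga X) (res eta) - rh (br (ga X) (be (res eta))) = 0" if "X \<in> secs" for X
    using tors_eta[OF that] unfolding tors_def .
  show "gm (cv (ga X) Y - rh (br (ga X) (be Y))) Z = gm (cv (ga X) Z - rh (br (ga X) (be Z))) Y"
    if "X \<in> secs" "Y \<in> secs" "Z \<in> secs" for X Y Z
    unfolding tors_def[symmetric] gm_def res_def using tors_metric[OF that] by (auto simp: fun_eq_iff)
qed (fact subspace_secs slit.subspace_vfields slit.subspace_fns | rule slit.lie_bracket_antisym |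
    auto simp: cv_secs slit.lie_bracket_vfields rh_secs be_vfields ga_vfields slit.der_fns eta_secs
      cv_add_left cv_add_right slit.lie_bracket_add_right slit.jacobi rh_add be_add ga_add gm_add
      slit.der_add slit.der_lie_bracket der_gm rh_be rh_ga cv_be_eta cv_ga_eta br_ga_ga be_torsion_free
      tors_sym[unfolded tors_def]
      intro: gm_sym gm_nondegenerate vf_decomp metric_fns[folded gm_def] secs_pi_field)+

end

sublocale cartan \<subseteq> cc: cartan_calculus secs slit.vfields slit.fns cv br rh be ga gm slit.der "res eta"
  by (rule cartan_calculus)

context cartan
begin

section \<open>Translation of the tensors of the theorem into the calculus\<close>

lemma curvature_res:
  assumes "res A \<in> slit.vfields" "res B \<in> slit.vfields" "pi_field \<A> Z"
  shows "res (curvature \<A> D A B Z) = cc.K (res A) (res B) (res Z)"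
proof -
  have "res (br A B) = br (res A) (res B)" "res (br A B) \<in> slit.vfields"
    using res_vfields_eq[OF slit.lie_bracket_vfields[OF assms(1,2)]] slit.lie_bracket_vfields[OF assms(1,2)]
    by (simp_all add: lie_bracket_res)
  then show ?thesis
    by (simp add: curvature_def cc.K_def res_add res_diff res_minus cov_res assms)
qed

context
  fixes X Y assumes XY: "pi_field \<A> X" "pi_field \<A> Y"
begin

lemma T_torsion_res: "res (T_torsion \<A> D X Y) = cc.T (res X) (res Y)"
  unfolding T_torsion_def cc.T_def
  by (subst torsion_res) (simp_all add: beta_field_res gamma_field_res be_vfields ga_vfields res_secs XY cc.tor_def)

lemma T_torsion_pi_field: "pi_field \<A> (T_torsion \<A> D X Y)"
  by (simp add: pi_field_iff_res[of "T_torsion \<A> D X Y"] T_torsion_res res_secs XY)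

lemma P_curv_res: "pi_field \<A> Z \<Longrightarrow> res (P_curv \<A> D X Y Z) = cc.P (res X) (res Y) (res Z)"
  unfolding P_curv_def cc.P_def
  by (subst curvature_res) (simp_all add: beta_field_res gamma_field_res be_vfields ga_vfields res_secs XY)

lemma S_curv_res: "pi_field \<A> Z \<Longrightarrow> res (S_curv \<A> D X Y Z) = cc.S (res X) (res Y) (res Z)"
  unfolding S_curv_def cc.S_def
  by (subst curvature_res) (simp_all add: beta_field_res gamma_field_res be_vfields ga_vfields res_secs XY)

lemma P_hat_res: "res (P_hat \<A> D X Y) = cc.Ph (res X) (res Y)"
  by (simp add: P_hat_def cc.Ph_def P_curv_res eta_pi_field)

lemma P_hat_pi_field: "pi_field \<A> (P_hat \<A> D X Y)"
  by (simp add: pi_field_iff_res[of "P_hat \<A> D X Y"] P_hat_res res_secs XY)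

end

lemma P_curv_pi_field:
  "pi_field \<A> X \<Longrightarrow> pi_field \<A> Y \<Longrightarrow> pi_field \<A> Z \<Longrightarrow> pi_field \<A> (P_curv \<A> D X Y Z)"
  by (simp add: pi_field_iff_res[of "P_curv \<A> D X Y Z"] P_curv_res res_secs)

lemma S_curv_pi_field:
  "pi_field \<A> X \<Longrightarrow> pi_field \<A> Y \<Longrightarrow> pi_field \<A> Z \<Longrightarrow> pi_field \<A> (S_curv \<A> D X Y Z)"
  by (simp add: pi_field_iff_res[of "S_curv \<A> D X Y Z"] S_curv_res res_secs)

lemma cov2_T_res:
  assumes "res A \<in> slit.vfields" "pi_field \<A> X" "pi_field \<A> Y"
  shows "res (cov2 D A (T_torsion \<A> D) X Y) = cc.cT (res A) (res X) (res Y)"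
  by (simp add: cov2_def cc.cT_def res_diff cov_res T_torsion_res T_torsion_pi_field assms)

lemma cov3_P_res:
  assumes "res A \<in> slit.vfields" "pi_field \<A> X" "pi_field \<A> Y" "pi_field \<A> Z"
  shows "res (cov3 D A (P_curv \<A> D) X Y Z) = cv (res A) (cc.P (res X) (res Y) (res Z))
    - cc.P (cv (res A) (res X)) (res Y) (res Z) - cc.P (res X) (cv (res A) (res Y)) (res Z)
    - cc.P (res X) (res Y) (cv (res A) (res Z))"
  by (simp add: cov3_def res_diff cov_res P_curv_res P_curv_pi_field assms)

lemma cov3_S_res:
  assumes "res A \<in> slit.vfields" "pi_field \<A> X" "pi_field \<A> Y" "pi_field \<A> Z"
  shows "res (cov3 D A (S_curv \<A> D) X Y Z) = cv (res A) (cc.S (res X) (res Y) (res Z))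
    - cc.S (cv (res A) (res X)) (res Y) (res Z) - cc.S (res X) (cv (res A) (res Y)) (res Z)
    - cc.S (res X) (res Y) (cv (res A) (res Z))"
  by (simp add: cov3_def res_diff cov_res S_curv_res S_curv_pi_field assms)

lemma metric_res: "u \<in> slit \<A> \<Longrightarrow> g u (F u) (G u) = gm (res F) (res G) u"
  by (simp add: gm_apply)

lemma res_eqD: "res F = res G \<Longrightarrow> u \<in> slit \<A> \<Longrightarrow> F u = G u"
  by (metis res_on)

end

theorem theorem3p5:
  fixes M :: "'m topology"
    and \<A> :: "('m, 'e::euclidean_space) chart set"
    and L :: "('m, 'e) tpoint \<Rightarrow> real"
    and D :: "('m, 'e) connection"
    and g :: "('m, 'e) tpoint \<Rightarrow> ('m, 'e) tvec \<Rightarrow> ('m, 'e) tvec \<Rightarrow> real"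
    and T Ph :: "('m, 'e) pi_section \<Rightarrow> ('m, 'e) pi_section \<Rightarrow> ('m, 'e) pi_section"
    and P S :: "('m, 'e) pi_section \<Rightarrow> ('m, 'e) pi_section \<Rightarrow> ('m, 'e) pi_section \<Rightarrow> ('m, 'e) pi_section"
    and \<beta> \<gamma> :: "('m, 'e) pi_section \<Rightarrow> ('m, 'e) field2"
    and X Y Z W :: "('m, 'e) pi_section"
    and u :: "('m, 'e) tpoint"
  assumes "finsler_manifold M \<A> L"
    and "cartan_connection \<A> L D"
    and "g = finsler_metric L"
    and "T = T_torsion \<A> D"
    and "S = S_curv \<A> D"
    and "P = P_curv \<A> D"
    and "Ph = P_hat \<A> D"
    and "\<beta> = beta_field \<A> D"
    and "\<gamma> = gamma_field \<A>"
    and "pi_field \<A> X" "pi_field \<A> Y" "pi_field \<A> Z" "pi_field \<A> W"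
    and "u \<in> slit \<A>"
  shows
    "g u (P X Y Z u) (W u) = - g u (P X Y W u) (Z u) \<and>
     P X Y Z u - P Z Y X u =
        cov2 D (\<beta> Z) T Y X u - cov2 D (\<beta> X) T Y Z u - T (Ph Z Y) X u + T (Ph X Y) Z u \<and>
     g u (P X Y Z u) (W u) =
        g u (cov2 D (\<beta> Z) T X Y u) (W u) - g u (cov2 D (\<beta> W) T X Y u) (Z u)
        + g u (T X Z u) (Ph W Y u) - g u (T X W u) (Ph Z Y u) \<and>
     Ph eta X u = 0 \<and>
     Ph X Y u = cov2 D (\<beta> eta) T X Y u \<and>
     Ph X Y u = Ph Y X u \<and>
     P eta X Y u = 0 \<and> P X eta Y u = 0 \<and>
     cov3 D (\<gamma> eta) P X Y Z u = - P X Y Z u \<and>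
     P X Y Z u = P Y X Z u - cov3 D (\<beta> eta) S X Y Z u"
proof -
  note sec = assms(10-13) and u = assms(14)
  have "smooth_manifold M \<A>" "regular_connection \<A> D"
    using assms(1,2) by (simp_all add: finsler_manifold_def cartan_connection_def)
  then interpret cartan \<A> M L D
    by (intro cartan.intro finsler.intro regular.intro slit_bundle.intro finsler_axioms.intro
        regular_axioms.intro cartan_axioms.intro smooth_manifold_smooth_atlas assms)
  \<comment> \<open>Facts 6 to 9 place the normalised \<open>X\<close>, \<open>Y\<close>,
    \<open>Z\<close>, \<open>W\<close> in \<open>secs\<close>; they instantiate the identities of
    the calculus below.\<close>
  note rs [simp] = sec eta_pi_field res_secs[OF sec(1)] res_secs[OF sec(2)] res_secs[OF sec(3)] res_secs[OF sec(4)]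
  note to_calculus = P_curv_res T_torsion_res P_hat_res cov2_T_res cov3_P_res cov3_S_res P_hat_pi_field
    beta_field_res gamma_field_res be_vfields ga_vfields
  have "g u (P X Y Z u) (W u) = - g u (P X Y W u) (Z u)"
    using fun_cong[OF cc.P_skew[OF rs(6-9)], of u]
    by (simp add: assms(3,6) metric_res[OF u] to_calculus)
  moreover have "P X Y Z u - P Z Y X u =
      cov2 D (\<beta> Z) T Y X u - cov2 D (\<beta> X) T Y Z u - T (Ph Z Y) X u + T (Ph X Y) Z u"
  proof -
    have "res (P X Y Z - P Z Y X) = res (cov2 D (\<beta> Z) T Y X - cov2 D (\<beta> X) T Y Z - T (Ph Z Y) X + T (Ph X Y) Z)"
      using cc.P_exchange[OF rs(6-8)] by (simp add: assms(4-9) res_add res_diff to_calculus)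
    from res_eqD[OF this u] show ?thesis by simp
  qed
  moreover have "g u (P X Y Z u) (W u) =
        g u (cov2 D (\<beta> Z) T X Y u) (W u) - g u (cov2 D (\<beta> W) T X Y u) (Z u)
        + g u (T X Z u) (Ph W Y u) - g u (T X W u) (Ph Z Y u)"
    using fun_cong[OF cc.P_formula[OF rs(6-9)], of u]
    by (simp add: assms(3-9) metric_res[OF u] to_calculus)
  moreover have "Ph eta X u = 0"
    using fun_cong[OF cc.Ph_et_left[OF rs(6)], of u] u
    by (simp add: assms(7) flip: P_hat_res)
  moreover have "Ph X Y u = cov2 D (\<beta> eta) T X Y u"
    by (rule res_eqD[OF _ u]) (simp add: assms(4-9) to_calculus cc.Ph_eq)
  moreover have "Ph X Y u = Ph Y X u"
    by (rule res_eqD[OF _ u]) (simp add: assms(7) to_calculus cc.Ph_sym[of "res X"])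
  moreover have "P eta X Y u = 0"
    using fun_cong[OF cc.P_et_left[OF rs(6,7)], of u] u
    by (simp add: assms(6) flip: P_curv_res)
  moreover have "P X eta Y u = 0"
    using fun_cong[OF cc.P_et_mid[OF rs(6,7)], of u] u
    by (simp add: assms(6) flip: P_curv_res)
  moreover have "cov3 D (\<gamma> eta) P X Y Z u = - P X Y Z u"
  proof -
    have "res (cov3 D (\<gamma> eta) P X Y Z) = res (- P X Y Z)"
      by (simp add: assms(6,9) res_minus to_calculus cc.P_homogeneous)
    from res_eqD[OF this u] show ?thesis by simp
  qed
  moreover have "P X Y Z u = P Y X Z u - cov3 D (\<beta> eta) S X Y Z u"
  proof -
    have "res (P X Y Z) = res (P Y X Z - cov3 D (\<beta> eta) S X Y Z)"
      using cc.P_commute[OF rs(6-8)] by (simp add: assms(5,6,8) res_diff to_calculus)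
    from res_eqD[OF this u] show ?thesis by simp
  qed
  ultimately show ?thesis by blast
qed

end
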